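(* Let $N\ge 2$, let $\bar n=(n_1,\dots,n_{N-1})$ be positive integers, and let $\bar t_{\bar n}=\{t^k_\ell : 1\le k\le N-1,\ 1\le \ell\le n_k\}$ be a collection of generic complex parameters; write $\bar t^k=\{t^k_1,\dots,t^k_{n_k}\}$. In the algebra $\mathcal A_q$, the elements $\mathcal B^{\bar n}(\bar t_{\bar n})$ and $\widehat{\mathcal B}^{\bar n}(\bar t_{\bar n})$ (the pre-Bethe vectors, defined in the context as sums over permissible integer matrices and permutations of the Bethe parameters) can be written as the following sums over partitions of the sets of Bethe parameters: $$ \begin{aligned} \mathcal B^{\bar n}(\bar t_{\bar n})=\sum_{\rm part}\ &\prod_{k=1}^{N-1}\ \prod_{(i,j)\prec(i',j')}\mathsf f(\bar t^k_{i',j'},\bar t^k_{i,j})\ \prod_{k=2}^{N-1}\Bigg(\prod_{(i,j)\prec(i',j')}\mathsf f(\bar t^k_{i,j},\bar t^{k-1}_{i',j'})\ \prod_{i<j}\mathsf K^{(l)}(\bar t^k_{i,j}|\bar t^{k-1}_{i,j})\Bigg)\\ &\times\prod_{1\le k\le N-1}^{\longrightarrow}\Bigg(\prod_{N\ge j>k}^{\longleftarrow}T_{k,j}(\bar t^k_{k,j-1})\Bigg)\ \prod_{k=2}^{N-1}\ \prod_{(i,j)\prec(k,k)}T_{k,k}(\bar t^k_{i,j}), \end{aligned} $$ and $$ \begin{aligned} \widehat{\mathcal B}^{\bar n}(\bar t_{\bar n})=\sum_{\rm part}\ &\prod_{k=1}^{N-1}\ \prod_{(i,j)\prec^t(i',j')}\mathsf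 f(\bar t^k_{i',j'},\bar t^k_{i,j})\ \prod_{k=2}^{N-1}\Bigg(\prod_{(i,j)\prec^t(i',j')}\mathsf f(\bar t^k_{i,j},\bar t^{k-1}_{i',j'})\ \prod_{i<j}\mathsf K^{(r)}(\bar t^k_{i,j}|\bar t^{k-1}_{i,j})\Bigg)\\ &\times\prod_{N-1\ge k\ge1}^{\longleftarrow}\Bigg(\prod_{1\le j\le k}^{\longrightarrow}T_{j,k+1}(\bar t^k_{j,k})\Bigg)\ \prod_{k=1}^{N-2}\ \prod_{(k,k)\prec^t(i,j)}T_{k+1,k+1}(\bar t^k_{i,j}). \end{aligned} $$ Here $\sum_{\rm part}$ runs over all partitions of the sets $\bar t^1,\dots,\bar t^{N-1}$ into disjoint, possibly empty, subsets $\bar t^k=\bigcup_{i=1}^{k}\bigcup_{j=k}^{N-1}\bar t^k_{i,j}$ such that for every pair $(i,j)$, $1\le i\le j\le N-1$, the cardinality $\#\bar t^k_{i,j}$ is the same for all $k$ with $i\le k\le j$.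
   Context: **Algebra.** $q\in\mathbb C$ is nonzero and not a root of unity. Set $$\mathsf f(u,v)=\mathsf f_q(u,v)=\frac{qu-q^{-1}v}{u-v},\quad \mathsf g(u,v)=\frac{q-q^{-1}}{u-v},\quad \mathsf g^{(l)}(u,v)=u\,\mathsf g(u,v),\quad \mathsf g^{(r)}(u,v)=v\,\mathsf g(u,v),$$ $$\mathrm R(u,v;q)=\mathsf f(u,v)\sum_{i}E_{ii}\otimes E_{ii}+\sum_{i<j}(E_{ii}\otimes E_{jj}+E_{jj}\otimes E_{ii})+\sum_{i<j}\big(\mathsf g^{(l)}(u,v)E_{ij}\otimes E_{ji}+\mathsf g^{(r)}(u,v)E_{ji}\otimes E_{ij}\big),$$ with $1\le i,j\le N$ and $E_{ij}$ the $N\times N$ matrix units. $\mathcal A_q$ (the standard Borel subalgebra of $U_q(\widehat{\mathfrak{gl}}_N)$) is the unital associative $\mathbb C$-algebra generated by the entries $T_{i,j}(u)$, $1\le i,j\le N$, $u\in\mathbb C\setminus\{0\}$, of the monodromy matrix $T(u)=\sum_{i,j}E_{ij}\otimes T_{i,j}(u)$, subject to, for $u\neq v$, $$\mathrm R(u,v;q)(T(u)\otimes\mathbf 1)(\mathbf 1\otimes T(v))=(\mathbf 1\otimes T(v))(T(u)\otimes\mathbf 1)\mathrm R(u,v;q).$$ In particular $T_{i,j}(u)$ and $T_{i,j}(v)$ commute. Generic parameters: nonzero, pairwise distinct, and $q^2a\ne b$ for any two of them. **Product conventions.** For finite sets, $T_{i,j}(\bar x)=\prod_{x\in\bar x}T_{i,j}(x)$,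 $\mathsf f(\bar x,\bar y)=\prod_{x\in\bar x}\prod_{y\in\bar y}\mathsf f(x,y)$; empty products are $1$. $\overset{\longrightarrow}{\prod}$ means the factor with the smallest index is leftmost and indices increase to the right; $\overset{\longleftarrow}{\prod}$ means the factor with the largest index is leftmost and indices decrease to the right. Products of diagonal entries $T_{k,k}$ stand at the far right; their order is regarded as immaterial (they are eventually applied to a vacuum vector, a common eigenvector). To fix it: in all formulas for $\mathcal B$ the diagonal entries are ordered with matrix index increasing from left to right, in all formulas for $\widehat{\mathcal B}$ with matrix index decreasing from left to right. **Izergin determinants.** For $\#\bar x=\#\bar y=n$, $$\mathsf K_n(\bar x|\bar y)=\frac{\prod_{1\le i,j\le n}(qx_i-q^{-1}y_j)}{\prod_{1\le i<j\le n}(x_i-x_j)(y_j-y_i)}\det\left[\frac{q-q^{-1}}{(x_i-y_j)(qx_i-q^{-1}y_j)}\right]_{i,j=1}^n,$$ $\mathsf K^{(l)}(\bar x|\bar y)=\prod_i x_i\cdot\mathsf K_n(\bar x|\bar y)$, $\mathsf K^{(r)}(\bar x|\bar y)=\prod_i y_i\cdot\mathsf K_n(\bar x|\bar y)$, and these equal $1$ for $n=0$. **Orderings of pairs.** $(i,j)\prec(i',j')$ iff $i<i'$, or $i=i'$ and $j<j'$. $(i,j)\prec^t(i',j')$ iff $j<j'$, or $j=j'$ and $i<i'$. In all products over pairs, only pairs for which the subsets involved are defined occur: $\bar t^k_{i,j}$ is defined for $1\le i\le k\le j\le N-1$ (so in $\prod_{i<j}\mathsf K(\bar t^k_{i,j}|\bar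 t^{k-1}_{i,j})$ one has $1\le i\le k-1<k\le j\le N-1$). **Symmetrization.** For $G(\bar t_{\bar n})$, $\mathrm{Sym}_{\bar t_{\bar n}}G(\bar t_{\bar n})=\sum_{\sigma\in S_{n_1}\times\cdots\times S_{n_{N-1}}}G({}^\sigma\bar t_{\bar n})$, where ${}^\sigma\bar t_{\bar n}$ is obtained by $t^k_\ell\mapsto t^k_{\sigma^k(\ell)}$. Put $\beta(\bar t_{\bar n})=\prod_{k=1}^{N-1}\prod_{1\le\ell<\ell'\le n_k}\mathsf f(t^k_{\ell'},t^k_\ell)$. **Permissible matrices.** An upper permissible $[\bar m]$ is a collection of nonnegative integers $m^i_j$, $1\le i\le j\le N-1$, with $m^i_i\ge m^i_{i+1}\ge\cdots\ge m^i_{N-1}\ge m^i_N:=0$ and $n_i=\sum_{j=1}^i m^j_i$ for all $i$. A lower permissible $[\bar s]$ is a collection of nonnegative integers $s^j_i$, $1\le i\le j\le N-1$, with $0=:s^j_0\le s^j_1\le\cdots\le s^j_j$ and $n_i=\sum_{j=i}^{N-1}s^j_i$ for all $i$. Set $m^j_i=0$ for $i<j$, $s^j_i=0$ for $i>j$, $\mathbf m^j_a=\sum_{i=1}^{j}m^i_a$ and $\mathbf s^j_a=\sum_{i=j}^{N-1}s^i_a$. **Pre-Bethe vectors.** $$ \begin{aligned} \mathcal B^{\bar n}(\bar t_{\bar n})=\sum_{[\bar m]}\mathrm{Sym}_{\bar t_{\bar n}}\Bigg(&\beta(\bar t_{\bar n})\prod_{1\le j\le i<N}\bigg(\frac1{(m^j_i-m^j_{i+1})!}\prod_{n_j-m^j_i<\ell'<\ell\le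 n_j-m^j_{i+1}}\mathsf f(t^j_\ell,t^j_{\ell'})^{-1}\bigg)\\ &\times\prod_{i=2}^{N-1}\prod_{j=1}^{i-1}\prod_{\ell=0}^{m^j_i-1}\bigg(\mathsf g^{(l)}(t^i_{\mathbf m^j_i-\ell},t^{i-1}_{\mathbf m^j_{i-1}-\ell})\prod_{\ell'=\mathbf m^j_{i-1}-\ell+1}^{n_{i-1}}\mathsf f(t^i_{\mathbf m^j_i-\ell},t^{i-1}_{\ell'})\bigg)\\ &\times\prod_{1\le j\le N-1}^{\longrightarrow}\Bigg(\prod_{N-1\ge i\ge j}^{\longleftarrow}\Bigg(\prod_{\ell=n_j-m^j_i+1}^{n_j-m^j_{i+1}}T_{j,i+1}(t^j_\ell)\Bigg)\Bigg)\prod_{j=1}^{N-1}\prod_{\ell=1}^{n_j-m^j_j}T_{j,j}(t^j_\ell)\Bigg), \end{aligned} $$ $$ \begin{aligned} \widehat{\mathcal B}^{\bar n}(\bar t_{\bar n})=\sum_{[\bar s]}\mathrm{Sym}_{\bar t_{\bar n}}\Bigg(&\beta(\bar t_{\bar n})\prod_{1\le i\le j<N}\bigg(\frac1{(s^j_i-s^j_{i-1})!}\prod_{s^j_{i-1}<\ell'<\ell\le s^j_i}\mathsf f(t^j_\ell,t^j_{\ell'})^{-1}\bigg)\\ &\times\prod_{j=2}^{N-1}\prod_{i=1}^{j-1}\prod_{\ell=1}^{s^j_i}\bigg(\mathsf g^{(r)}(t^{i+1}_{n_{i+1}-\mathbf s^j_{i+1}+\ell},t^i_{n_i-\mathbf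 s^j_i+\ell})\prod_{\ell'=1}^{n_{i+1}-\mathbf s^j_{i+1}+\ell-1}\mathsf f(t^{i+1}_{\ell'},t^i_{n_i-\mathbf s^j_i+\ell})\bigg)\\ &\times\prod_{N-1\ge j\ge1}^{\longleftarrow}\Bigg(\prod_{1\le i\le j}^{\longrightarrow}\Bigg(\prod_{\ell=s^j_{i-1}+1}^{s^j_i}T_{i,j+1}(t^j_\ell)\Bigg)\Bigg)\prod_{j=1}^{N-1}\prod_{\ell=s^j_j+1}^{n_j}T_{j+1,j+1}(t^j_\ell)\Bigg). \end{aligned} $$ *)

theory Defs
  imports
    "HOL-Library.Poly_Mapping"
    "HOL-Library.Disjoint_Sets"
    "HOL-Algebra.QuotRing"
    "HOL-Combinatorics.Permutations"
    "Jordan_Normal_Form.Determinant"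
begin

section \<open>The free algebra on the symbols T i j u\<close>

text \<open>The triple \<open>(i, j, u)\<close> stands for the generator $T_{i,j}(u)$. Noncommutative polynomials are
  finitely supported complex functions on words; multiplication on \<^typ>\<open>'a \<Rightarrow>\<^sub>0 'b\<close> is convolution
  with respect to \<open>+\<close> on the index type, hence the wrapper type in which \<open>+\<close> is concatenation.\<close>

datatype tword = Word (letters: "(nat \<times> nat \<times> complex) list")

instantiation tword :: monoid_add
begin
definition zero_tword :: tword where "0 = Word []"
definition plus_tword :: "tword \<Rightarrow> tword \<Rightarrow> tword" where
  "v + w = Word (letters v @ letters w)"
instance by standard (simp_all add: zero_tword_def plus_tword_def)
end

type_synonym ncpoly = "tword \<Rightarrow>\<^sub>0 complex"

definition scal :: "complex \<Rightarrow> ncpoly" where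
  "scal c = Poly_Mapping.single 0 c"

definition T :: "nat \<Rightarrow> nat \<Rightarrow> complex \<Rightarrow> ncpoly" where
  "T i j u = Poly_Mapping.single (Word [(i, j, u)]) 1"

definition generators :: "nat \<Rightarrow> (nat \<times> nat \<times> complex) set" where
  "generators N = {1..N} \<times> {1..N} \<times> (- {0})"

definition free_algebra :: "nat \<Rightarrow> ncpoly ring" where
  "free_algebra N =
     \<lparr>carrier = {p. \<forall>w \<in> Poly_Mapping.keys p. set (letters w) \<subseteq> generators N},
      monoid.mult = (*), one = 1, zero = 0, add = (+)\<rparr>"


section \<open>The algebra presented by the RTT relations\<close>

definition ff :: "complex \<Rightarrow> complex \<Rightarrow> complex \<Rightarrow> complex" where
  "ff q u v = (q * u - inverse q * v) / (u - v)"

definition gg :: "complex \<Rightarrow> complex \<Rightarrow> complex \<Rightarrow> complex" where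
  "gg q u v = (q - inverse q) / (u - v)"

definition gl :: "complex \<Rightarrow> complex \<Rightarrow> complex \<Rightarrow> complex" where
  "gl q u v = u * gg q u v"

definition gr :: "complex \<Rightarrow> complex \<Rightarrow> complex \<Rightarrow> complex" where
  "gr q u v = v * gg q u v"

text \<open>Matrices on the tensor square have rows and columns indexed by pairs in
  \<open>{1..N} \<times> {1..N}\<close>.\<close>

definition unit_mat :: "nat \<Rightarrow> nat \<Rightarrow> nat \<Rightarrow> nat \<Rightarrow> complex" where
  "unit_mat i j a b = (if a = i \<and> b = j then 1 else 0)"

definition id_mat :: "nat \<Rightarrow> nat \<Rightarrow> 'a::zero_neq_one" where
  "id_mat a b = (if a = b then 1 else 0)"

definition tensor ::
  "(nat \<Rightarrow> nat \<Rightarrow> 'a::times) \<Rightarrow> (nat \<Rightarrow> nat \<Rightarrow> 'a) \<Rightarrow> nat \<times> nat \<Rightarrow> nat \<times> nat \<Rightarrow> 'a" where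
  "tensor A B x y = A (fst x) (fst y) * B (snd x) (snd y)"

definition tmult ::
  "nat \<Rightarrow> (nat \<times> nat \<Rightarrow> nat \<times> nat \<Rightarrow> 'a::semiring_0) \<Rightarrow> (nat \<times> nat \<Rightarrow> nat \<times> nat \<Rightarrow> 'a)
     \<Rightarrow> nat \<times> nat \<Rightarrow> nat \<times> nat \<Rightarrow> 'a" where
  "tmult N A B x y = (\<Sum>z \<in> {1..N} \<times> {1..N}. A x z * B z y)"

definition R_mat :: "nat \<Rightarrow> complex \<Rightarrow> complex \<Rightarrow> complex \<Rightarrow> nat \<times> nat \<Rightarrow> nat \<times> nat \<Rightarrow> complex" where
  "R_mat N q u v x y =
     ff q u v * (\<Sum>i\<in>{1..N}. tensor (unit_mat i i) (unit_mat i i) x y)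
   + (\<Sum>i\<in>{1..N}. \<Sum>j\<in>{i<..N}.
        tensor (unit_mat i i) (unit_mat j j) x y + tensor (unit_mat j j) (unit_mat i i) x y)
   + (\<Sum>i\<in>{1..N}. \<Sum>j\<in>{i<..N}.
        gl q u v * tensor (unit_mat i j) (unit_mat j i) x y
      + gr q u v * tensor (unit_mat j i) (unit_mat i j) x y)"

definition T1 :: "complex \<Rightarrow> nat \<times> nat \<Rightarrow> nat \<times> nat \<Rightarrow> ncpoly" where
  "T1 u = tensor (\<lambda>a b. T a b u) id_mat"

definition T2 :: "complex \<Rightarrow> nat \<times> nat \<Rightarrow> nat \<times> nat \<Rightarrow> ncpoly" where
  "T2 v = tensor id_mat (\<lambda>a b. T a b v)"

definition rtt_relators :: "nat \<Rightarrow> complex \<Rightarrow> ncpoly set" where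
  "rtt_relators N q =
     {tmult N (\<lambda>x y. scal (R_mat N q u v x y)) (tmult N (T1 u) (T2 v)) x y
      - tmult N (tmult N (T2 v) (T1 u)) (\<lambda>x y. scal (R_mat N q u v x y)) x y
      | u v x y. u \<noteq> 0 \<and> v \<noteq> 0 \<and> u \<noteq> v \<and> x \<in> {1..N} \<times> {1..N} \<and> y \<in> {1..N} \<times> {1..N}}"

definition rtt_ideal :: "nat \<Rightarrow> complex \<Rightarrow> ncpoly set" where
  "rtt_ideal N q = genideal (free_algebra N) (rtt_relators N q)"

definition Aq :: "nat \<Rightarrow> complex \<Rightarrow> ncpoly set ring" where
  "Aq N q = FactRing (free_algebra N) (rtt_ideal N q)"

text \<open>The element of the algebra represented by a noncommutative polynomial.\<close>

definition in_Aq :: "nat \<Rightarrow> complex \<Rightarrow> ncpoly \<Rightarrow> ncpoly set" where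
  "in_Aq N q p = a_r_coset (free_algebra N) (rtt_ideal N q) p"

lemma carrier_free_algebra:
  "p \<in> carrier (free_algebra N) \<longleftrightarrow>
     Poly_Mapping.keys p \<subseteq> {w. set (letters w) \<subseteq> generators N}"
  by (auto simp: free_algebra_def)

lemma free_algebra_closed:
  fixes p p' :: ncpoly
  shows "0 \<in> carrier (free_algebra N)"
    and "1 \<in> carrier (free_algebra N)"
    and "scal c \<in> carrier (free_algebra N)"
    and "p \<in> carrier (free_algebra N) \<Longrightarrow> p' \<in> carrier (free_algebra N) \<Longrightarrow>
           p + p' \<in> carrier (free_algebra N)"
    and "p \<in> carrier (free_algebra N) \<Longrightarrow> p' \<in> carrier (free_algebra N) \<Longrightarrow>
           p - p' \<in> carrier (free_algebra N)"
    and "p \<in> carrier (free_algebra N) \<Longrightarrow> p' \<in> carrier (free_algebra N) \<Longrightarrow>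
           p * p' \<in> carrier (free_algebra N)"
  subgoal by (simp add: carrier_free_algebra)
  subgoal by (simp add: carrier_free_algebra zero_tword_def)
  subgoal by (simp add: carrier_free_algebra scal_def zero_tword_def)
  subgoal using Poly_Mapping.keys_add[of p p'] unfolding carrier_free_algebra by blast
  subgoal using keys_diff[of p p'] unfolding carrier_free_algebra by blast
  subgoal
  proof -
    assume p: "p \<in> carrier (free_algebra N)" "p' \<in> carrier (free_algebra N)"
    have "set (letters (v + w)) \<subseteq> generators N"
      if "v \<in> Poly_Mapping.keys p" "w \<in> Poly_Mapping.keys p'" for v w
      using p that by (auto simp: carrier_free_algebra plus_tword_def)
    then show ?thesis
      using Poly_Mapping.keys_mult[of p p'] unfolding carrier_free_algebra by blast
  qed
  done

lemma free_algebra_sum_closed: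
  "(\<And>x. x \<in> A \<Longrightarrow> g x \<in> carrier (free_algebra N)) \<Longrightarrow> sum g A \<in> carrier (free_algebra N)"
  by (induction A rule: infinite_finite_induct) (auto intro: free_algebra_closed)

lemma T_closed:
  "i \<in> {1..N} \<Longrightarrow> j \<in> {1..N} \<Longrightarrow> u \<noteq> 0 \<Longrightarrow> T i j u \<in> carrier (free_algebra N)"
  by (simp add: carrier_free_algebra T_def generators_def)

lemma free_algebra_ops:
  "monoid.mult (free_algebra N) = (*)" "one (free_algebra N) = 1"
  "zero (free_algebra N) = 0" "add (free_algebra N) = (+)"
  by (simp_all add: free_algebra_def)

lemma ring_free_algebra: "ring (free_algebra N)"
proof (rule ringI)
  show "abelian_group (free_algebra N)"
  proof (rule abelian_groupI, unfold free_algebra_ops)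
    fix p assume "p \<in> carrier (free_algebra N)"
    then have "0 - p \<in> carrier (free_algebra N)" by (intro free_algebra_closed)
    then show "\<exists>p'\<in>carrier (free_algebra N). p' + p = 0" by (rule bexI[rotated]) simp
  qed (simp_all add: free_algebra_closed add_ac)
  show "monoid (free_algebra N)"
    by (rule monoidI, unfold free_algebra_ops) (simp_all add: free_algebra_closed mult.assoc)
qed (simp_all add: free_algebra_ops distrib_left distrib_right)

lemma rtt_relators_carrier: "rtt_relators N q \<subseteq> carrier (free_algebra N)"
proof -
  have 1: "T1 u x y \<in> carrier (free_algebra N)" "T2 u x y \<in> carrier (free_algebra N)"
    if "u \<noteq> 0" "x \<in> {1..N} \<times> {1..N}" "y \<in> {1..N} \<times> {1..N}" for u x y
    using that by (auto simp: T1_def T2_def tensor_def id_mat_def mem_Times_iff free_algebra_closed T_closed)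
  have 2: "tmult N A B x y \<in> carrier (free_algebra N)"
    if "\<And>x y. x \<in> {1..N} \<times> {1..N} \<Longrightarrow> y \<in> {1..N} \<times> {1..N} \<Longrightarrow> A x y \<in> carrier (free_algebra N)"
      and "\<And>x y. x \<in> {1..N} \<times> {1..N} \<Longrightarrow> y \<in> {1..N} \<times> {1..N} \<Longrightarrow> B x y \<in> carrier (free_algebra N)"
      and "x \<in> {1..N} \<times> {1..N}" "y \<in> {1..N} \<times> {1..N}" for A B x y
    unfolding tmult_def by (intro free_algebra_sum_closed free_algebra_closed that)
  show ?thesis
    unfolding rtt_relators_def
    by (clarify, intro free_algebra_closed 2 1) auto
qed

lemma ideal_rtt_ideal: "ideal (rtt_ideal N q) (free_algebra N)"
  unfolding rtt_ideal_def by (rule ring.genideal_ideal[OF ring_free_algebra rtt_relators_carrier])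

lemma ring_Aq: "ring (Aq N q)"
  unfolding Aq_def by (rule ideal.quotient_is_ring[OF ideal_rtt_ideal])


section \<open>Products over lists of parameters\<close>

text \<open>Sets of parameters are presented by lists. In the algebra the order is irrelevant for each
  of the following: the $T_{i,j}(x)$ with fixed \<open>i\<close>, \<open>j\<close> commute, and the Izergin determinant is
  symmetric in each of its two sets of variables.\<close>

definition T_prod :: "nat \<Rightarrow> nat \<Rightarrow> complex list \<Rightarrow> ncpoly" where
  "T_prod i j xs = (\<Prod>x\<leftarrow>xs. T i j x)"

definition ff_prod :: "complex \<Rightarrow> complex list \<Rightarrow> complex list \<Rightarrow> complex" where
  "ff_prod q xs ys = (\<Prod>x\<leftarrow>xs. \<Prod>y\<leftarrow>ys. ff q x y)"

definition izergin :: "complex \<Rightarrow> complex list \<Rightarrow> complex list \<Rightarrow> complex" where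
  "izergin q xs ys = (let n = length xs in
     (\<Prod>i<n. \<Prod>j<n. q * xs ! i - inverse q * ys ! j)
     / (\<Prod>j<n. \<Prod>i<j. (xs ! i - xs ! j) * (ys ! j - ys ! i))
     * det (mat n n (\<lambda>(i, j).
         (q - inverse q) / ((xs ! i - ys ! j) * (q * xs ! i - inverse q * ys ! j)))))"

definition izergin_l :: "complex \<Rightarrow> complex list \<Rightarrow> complex list \<Rightarrow> complex" where
  "izergin_l q xs ys = prod_list xs * izergin q xs ys"

definition izergin_r :: "complex \<Rightarrow> complex list \<Rightarrow> complex list \<Rightarrow> complex" where
  "izergin_r q xs ys = prod_list ys * izergin q xs ys"


section \<open>Bethe parameters and pre-Bethe vectors\<close>

text \<open>\<open>t k l\<close> is $t^k_\ell$, for \<open>k \<in> {1..<N}\<close> and \<open>l \<in> {1..n k}\<close>; other values of \<open>t\<close> and \<open>n\<close> do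
  not matter.\<close>

definition bethe_indices :: "nat \<Rightarrow> (nat \<Rightarrow> nat) \<Rightarrow> (nat \<times> nat) set" where
  "bethe_indices N n = (SIGMA k : {1..<N}. {1..n k})"

definition generic :: "nat \<Rightarrow> complex \<Rightarrow> (nat \<Rightarrow> nat) \<Rightarrow> (nat \<Rightarrow> nat \<Rightarrow> complex) \<Rightarrow> bool" where
  "generic N q n t \<longleftrightarrow>
     (\<forall>(k, l) \<in> bethe_indices N n. t k l \<noteq> 0) \<and>
     (\<forall>(k, l) \<in> bethe_indices N n. \<forall>(k', l') \<in> bethe_indices N n.
        (k, l) \<noteq> (k', l') \<longrightarrow> t k l \<noteq> t k' l' \<and> q\<^sup>2 * t k l \<noteq> t k' l')"

definition sym_group :: "nat \<Rightarrow> (nat \<Rightarrow> nat) \<Rightarrow> (nat \<Rightarrow> nat \<Rightarrow> nat) set" where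
  "sym_group N n =
     {\<sigma>. (\<forall>k\<in>{1..<N}. \<sigma> k permutes {1..n k}) \<and> (\<forall>k. k \<notin> {1..<N} \<longrightarrow> \<sigma> k = id)}"

definition Sym ::
  "nat \<Rightarrow> (nat \<Rightarrow> nat) \<Rightarrow> ((nat \<Rightarrow> nat \<Rightarrow> complex) \<Rightarrow> ncpoly) \<Rightarrow> (nat \<Rightarrow> nat \<Rightarrow> complex) \<Rightarrow> ncpoly" where
  "Sym N n G t = (\<Sum>\<sigma> \<in> sym_group N n. G (\<lambda>k l. t k (\<sigma> k l)))"

definition beta :: "nat \<Rightarrow> complex \<Rightarrow> (nat \<Rightarrow> nat) \<Rightarrow> (nat \<Rightarrow> nat \<Rightarrow> complex) \<Rightarrow> complex" where
  "beta N q n t = (\<Prod>k\<in>{1..<N}. \<Prod>l'\<in>{1..n k}. \<Prod>l\<in>{1..<l'}. ff q (t k l') (t k l))"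

text \<open>\<open>m i j\<close> is $m^i_j$ and \<open>s j i\<close> is $s^j_i$: the upper index is the first argument. Entries
  outside the triangle are zero, which includes the conventions $m^i_N = 0$ and $s^j_0 = 0$.\<close>

definition upper_permissible :: "nat \<Rightarrow> (nat \<Rightarrow> nat) \<Rightarrow> (nat \<Rightarrow> nat \<Rightarrow> nat) set" where
  "upper_permissible N n =
     {m. (\<forall>i j. \<not> (1 \<le> i \<and> i \<le> j \<and> j < N) \<longrightarrow> m i j = 0) \<and>
         (\<forall>i\<in>{1..<N}. \<forall>j\<in>{i..<N}. m i (j + 1) \<le> m i j) \<and>
         (\<forall>i\<in>{1..<N}. n i = (\<Sum>j\<in>{1..i}. m j i))}"

definition lower_permissible :: "nat \<Rightarrow> (nat \<Rightarrow> nat) \<Rightarrow> (nat \<Rightarrow> nat \<Rightarrow> nat) set" where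
  "lower_permissible N n =
     {s. (\<forall>j i. \<not> (1 \<le> i \<and> i \<le> j \<and> j < N) \<longrightarrow> s j i = 0) \<and>
         (\<forall>j\<in>{1..<N}. \<forall>i\<in>{1..j}. s j (i - 1) \<le> s j i) \<and>
         (\<forall>i\<in>{1..<N}. n i = (\<Sum>j\<in>{i..<N}. s j i))}"

definition m_sum :: "(nat \<Rightarrow> nat \<Rightarrow> nat) \<Rightarrow> nat \<Rightarrow> nat \<Rightarrow> nat" where
  "m_sum m j a = (\<Sum>i\<in>{1..j}. m i a)"

definition s_sum :: "nat \<Rightarrow> (nat \<Rightarrow> nat \<Rightarrow> nat) \<Rightarrow> nat \<Rightarrow> nat \<Rightarrow> nat" where
  "s_sum N s j a = (\<Sum>i\<in>{j..<N}. s i a)"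

text \<open>For permissible matrices no subtraction of naturals below truncates. Products over lists are
  ordered from left to right; the diagonal entries are ordered by increasing matrix index in
  \<open>pre_bethe\<close> and by decreasing matrix index in \<open>pre_bethe_hat\<close>.\<close>

definition pre_bethe ::
  "nat \<Rightarrow> complex \<Rightarrow> (nat \<Rightarrow> nat) \<Rightarrow> (nat \<Rightarrow> nat \<Rightarrow> complex) \<Rightarrow> ncpoly" where
  "pre_bethe N q n t0 = (\<Sum>m \<in> upper_permissible N n. Sym N n (\<lambda>t.
     scal (beta N q n t
       * (\<Prod>j\<in>{1..<N}. \<Prod>i\<in>{j..<N}.
            1 / fact (m j i - m j (i + 1))
            * (\<Prod>l\<in>{n j - m j i <.. n j - m j (i + 1)}. \<Prod>l'\<in>{n j - m j i <..< l}.
                 inverse (ff q (t j l) (t j l'))))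
       * (\<Prod>i\<in>{2..<N}. \<Prod>j\<in>{1..<i}. \<Prod>l\<in>{0..<m j i}.
            gl q (t i (m_sum m j i - l)) (t (i - 1) (m_sum m j (i - 1) - l))
            * (\<Prod>l'\<in>{m_sum m j (i - 1) - l + 1 .. n (i - 1)}.
                 ff q (t i (m_sum m j i - l)) (t (i - 1) l'))))
     * (\<Prod>j\<leftarrow>[1..<N]. \<Prod>i\<leftarrow>rev [j..<N].
          \<Prod>l\<leftarrow>[n j - m j i + 1 ..< n j - m j (i + 1) + 1]. T j (i + 1) (t j l))
     * (\<Prod>j\<leftarrow>[1..<N]. \<Prod>l\<leftarrow>[1 ..< n j - m j j + 1]. T j j (t j l))) t0)"

definition pre_bethe_hat ::
  "nat \<Rightarrow> complex \<Rightarrow> (nat \<Rightarrow> nat) \<Rightarrow> (nat \<Rightarrow> nat \<Rightarrow> complex) \<Rightarrow> ncpoly" where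
  "pre_bethe_hat N q n t0 = (\<Sum>s \<in> lower_permissible N n. Sym N n (\<lambda>t.
     scal (beta N q n t
       * (\<Prod>j\<in>{1..<N}. \<Prod>i\<in>{1..j}.
            1 / fact (s j i - s j (i - 1))
            * (\<Prod>l\<in>{s j (i - 1) <.. s j i}. \<Prod>l'\<in>{s j (i - 1) <..< l}.
                 inverse (ff q (t j l) (t j l'))))
       * (\<Prod>j\<in>{2..<N}. \<Prod>i\<in>{1..<j}. \<Prod>l\<in>{1..s j i}.
            gr q (t (i + 1) (n (i + 1) - s_sum N s j (i + 1) + l)) (t i (n i - s_sum N s j i + l))
            * (\<Prod>l'\<in>{1 .. n (i + 1) - s_sum N s j (i + 1) + l - 1}.
                 ff q (t (i + 1) l') (t i (n i - s_sum N s j i + l)))))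
     * (\<Prod>j\<leftarrow>rev [1..<N]. \<Prod>i\<leftarrow>[1..<j + 1].
          \<Prod>l\<leftarrow>[s j (i - 1) + 1 ..< s j i + 1]. T i (j + 1) (t j l))
     * (\<Prod>j\<leftarrow>rev [1..<N]. \<Prod>l\<leftarrow>[s j j + 1 ..< n j + 1]. T (j + 1) (j + 1) (t j l))) t0)"


section \<open>Partitions of the Bethe parameters\<close>

definition prec :: "nat \<times> nat \<Rightarrow> nat \<times> nat \<Rightarrow> bool" (infix \<open>\<prec>\<close> 50) where
  "p \<prec> p' \<longleftrightarrow> fst p < fst p' \<or> fst p = fst p' \<and> snd p < snd p'"

definition prec_t :: "nat \<times> nat \<Rightarrow> nat \<times> nat \<Rightarrow> bool" (infix \<open>\<prec>\<^sup>t\<close> 50) where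
  "p \<prec>\<^sup>t p' \<longleftrightarrow> snd p < snd p' \<or> snd p = snd p' \<and> fst p < fst p'"

definition pair_list :: "nat \<Rightarrow> nat \<Rightarrow> (nat \<times> nat) list" where
  "pair_list N k = List.product [1..<k + 1] [k..<N]"

abbreviation pairs :: "nat \<Rightarrow> nat \<Rightarrow> (nat \<times> nat) set" where
  "pairs N k \<equiv> set (pair_list N k)"

text \<open>\<open>P k (i, j)\<close> is the set of those \<open>l\<close> for which $t^k_\ell$ lies in the subset
  $\bar t^k_{i,j}$; \<open>subpar t P k (i, j)\<close> lists the elements of that subset. Undefined subsets are
  set to be empty so that each partition is counted once.\<close>

definition bethe_partitions ::
  "nat \<Rightarrow> (nat \<Rightarrow> nat) \<Rightarrow> (nat \<Rightarrow> nat \<times> nat \<Rightarrow> nat set) set" where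
  "bethe_partitions N n =
     {P. (\<forall>k p. p \<notin> pairs N k \<longrightarrow> P k p = {}) \<and>
         (\<forall>k\<in>{1..<N}. (\<Union>p \<in> pairs N k. P k p) = {1..n k} \<and>
                      disjoint_family_on (P k) (pairs N k)) \<and>
         (\<forall>i j. 1 \<le> i \<and> i \<le> j \<and> j < N \<longrightarrow>
            (\<forall>k\<in>{i..j}. \<forall>k'\<in>{i..j}. card (P k (i, j)) = card (P k' (i, j))))}"

text \<open>The four index sets are finite, so none of the sums over them is vacuously zero.\<close>

lemma finite_triangular:
  assumes "finite A" and "\<And>m. m \<in> M \<Longrightarrow> (\<forall>i j. (i, j) \<notin> A \<longrightarrow> m i j = 0) \<and> (\<forall>i j. m i j \<le> b)"
  shows "finite (M :: (nat \<Rightarrow> nat \<Rightarrow> nat) set)"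
proof (rule finite_imageD)
  have "finite {h. h ` A \<subseteq> {..b} \<and> (\<forall>x. x \<notin> A \<longrightarrow> h x = 0)}"
    using finite_set_of_finite_funs[OF assms(1) finite_atMost, of b 0]
    by (rule rev_finite_subset) (auto simp: image_subset_iff)
  moreover have "case_prod ` M \<subseteq> {h. h ` A \<subseteq> {..b} \<and> (\<forall>x. x \<notin> A \<longrightarrow> h x = 0)}"
    using assms(2) by (intro image_subsetI) (simp add: image_subset_iff split_paired_all)
  ultimately show "finite (case_prod ` M)" by (rule rev_finite_subset)
  show "inj_on case_prod M" by (auto simp: inj_on_def fun_eq_iff)
qed

lemma finite_upper_permissible: "finite (upper_permissible N n)"
proof (rule finite_triangular)
  show "finite ({1..<N} \<times> {1..<N})" by simp
  fix m assume m: "m \<in> upper_permissible N n"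
  have "m i j \<le> (\<Sum>k\<in>{1..<N}. n k)" for i j
  proof (cases "1 \<le> i \<and> i \<le> j \<and> j < N")
    case True
    then have "m i j \<le> (\<Sum>j'\<in>{1..j}. m j' j)" by (intro member_le_sum) auto
    also have "\<dots> = n j" using m True by (auto simp: upper_permissible_def)
    also have "\<dots> \<le> (\<Sum>k\<in>{1..<N}. n k)" using True by (intro member_le_sum) auto
    finally show ?thesis .
  next
    case False
    then have "m i j = 0" using m unfolding upper_permissible_def by blast
    then show ?thesis by simp
  qed
  moreover have "m i j = 0" if "(i, j) \<notin> {1..<N} \<times> {1..<N}" for i j
  proof -
    have "\<not> (1 \<le> i \<and> i \<le> j \<and> j < N)" using that by auto
    then show ?thesis using m unfolding upper_permissible_def by blast
  qed
  ultimately show "(\<forall>i j. (i, j) \<notin> {1..<N} \<times> {1..<N} \<longrightarrow> m i j = 0) \<and>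
      (\<forall>i j. m i j \<le> (\<Sum>k\<in>{1..<N}. n k))"
    by blast
qed

lemma finite_lower_permissible: "finite (lower_permissible N n)"
proof (rule finite_triangular)
  show "finite ({1..<N} \<times> {1..<N})" by simp
  fix s assume s: "s \<in> lower_permissible N n"
  have "s j i \<le> (\<Sum>k\<in>{1..<N}. n k)" for i j
  proof (cases "1 \<le> i \<and> i \<le> j \<and> j < N")
    case True
    then have "s j i \<le> (\<Sum>j'\<in>{i..<N}. s j' i)" by (intro member_le_sum) auto
    also have "\<dots> = n i" using s True by (auto simp: lower_permissible_def)
    also have "\<dots> \<le> (\<Sum>k\<in>{1..<N}. n k)" using True by (intro member_le_sum) auto
    finally show ?thesis .
  next
    case False
    then have "s j i = 0" using s unfolding lower_permissible_def by blast
    then show ?thesis by simp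
  qed
  moreover have "s j i = 0" if "(j, i) \<notin> {1..<N} \<times> {1..<N}" for i j
  proof -
    have "\<not> (1 \<le> i \<and> i \<le> j \<and> j < N)" using that by auto
    then show ?thesis using s unfolding lower_permissible_def by blast
  qed
  ultimately show "(\<forall>j i. (j, i) \<notin> {1..<N} \<times> {1..<N} \<longrightarrow> s j i = 0) \<and>
      (\<forall>j i. s j i \<le> (\<Sum>k\<in>{1..<N}. n k))"
    by blast
qed

lemma finite_sym_group: "finite (sym_group N n)"
proof -
  have "finite {\<sigma>. \<forall>k. (k \<in> {1..<N} \<longrightarrow> \<sigma> k \<in> (\<Union>k\<in>{1..<N}. {\<pi>. \<pi> permutes {1..n k}}))
                     \<and> (k \<notin> {1..<N} \<longrightarrow> \<sigma> k = id)}"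
    by (rule finite_set_of_finite_funs) (auto intro: finite_permutations)
  then show ?thesis by (rule rev_finite_subset) (unfold sym_group_def, blast)
qed

lemma finite_bethe_partitions: "finite (bethe_partitions N n)"
proof (rule finite_imageD)
  let ?A = "{1..<N} \<times> (\<Union>k\<in>{1..<N}. pairs N k)"
  let ?B = "\<Union>k\<in>{1..<N}. {1..n k}"
  let ?H = "{h. \<forall>x. (x \<in> ?A \<longrightarrow> h x \<in> Pow ?B) \<and> (x \<notin> ?A \<longrightarrow> h x = {})}"
  have "finite ?H"
    by (rule finite_set_of_finite_funs) auto
  moreover have "case_prod P \<in> ?H" if "P \<in> bethe_partitions N n" for P
  proof -
    have empty: "P k p = {}" if "p \<notin> pairs N k" for k p
      using \<open>P \<in> bethe_partitions N n\<close> that unfolding bethe_partitions_def mem_Collect_eq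
      by (elim conjE) (erule allE[where x=k], erule allE[where x=p], simp)
    have union: "(\<Union>p \<in> pairs N k. P k p) = {1..n k}" if "k \<in> {1..<N}" for k
      using \<open>P \<in> bethe_partitions N n\<close> that unfolding bethe_partitions_def mem_Collect_eq
      by (elim conjE) (drule(1) bspec, simp)
    have sub: "P k p \<subseteq> ?B" if "k \<in> {1..<N}" for k p
    proof (cases "p \<in> pairs N k")
      case True
      then have "P k p \<subseteq> {1..n k}" using union[OF that] by blast
      then show ?thesis using that by blast
    next
      case False
      then show ?thesis using empty by simp
    qed
    have undef: "P k p = {}" if "(k, p) \<notin> ?A" for k p
    proof (rule empty)
      have "k \<in> {1..<N}" if "p \<in> pairs N k" using that by (auto simp: pair_list_def)
      then show "p \<notin> pairs N k" using that by blast
    qed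
    have "(x \<in> ?A \<longrightarrow> case_prod P x \<in> Pow ?B) \<and> (x \<notin> ?A \<longrightarrow> case_prod P x = {})" for x
    proof (cases x rule: prod.exhaust)
      case (Pair k p)
      show ?thesis
        unfolding Pair case_prod_conv by (intro conjI impI PowI sub undef) (drule SigmaD1)
    qed
    then show ?thesis by (intro CollectI allI)
  qed
  ultimately show "finite (case_prod ` bethe_partitions N n)"
    by (elim rev_finite_subset) (rule image_subsetI)
  show "inj_on case_prod (bethe_partitions N n)"
    by (rule inj_onI) (metis curry_case_prod)
qed

definition subpar ::
  "(nat \<Rightarrow> nat \<Rightarrow> complex) \<Rightarrow> (nat \<Rightarrow> nat \<times> nat \<Rightarrow> nat set) \<Rightarrow> nat \<Rightarrow> nat \<times> nat \<Rightarrow> complex list" where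
  "subpar t P k p = map (t k) (sorted_list_of_set (P k p))"

end

(*
  A pair of an upper permissible matrix m and a tuple of permutations is the same thing as a family
  of lists L k (i, j): the list of level k is cut into consecutive blocks of length
  m i j - m i (j + 1), in the lexicographic order of the pairs (i, j). The terms of the pre-Bethe
  vector with a given partition P are those for which the list L k (i, j) enumerates P k (i, j).
  In such a term, the factors that involve two different blocks depend only on P, and so does the
  operator part, since T i j u and T i j v commute. What remains is a product over blocks. On the
  lowest level of the block it contributes 1 / #P!, which the sum over orderings cancels; on a higher
  level k it contributes a function of the orderings on levels k and k - 1 whose sum over the
  orderings of level k is the Izergin determinant. As this determinant does not depend on the
  ordering on level k - 1, the sums can be carried out from the top level downwards.

  The second formula is the first one for q^-1, with the levels k replaced by N - k, and the order of
  the positions on each level reversed in the permutations.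
*)
theory Submission
  imports Defs "HOL-Combinatorics.Multiset_Permutations"
begin

section \<open>Izergin determinants: expansion along a column, sums over orderings, symmetry in each
  set\<close>

section \<open>Izergin determinants\<close>

text \<open>The determinant arises from the orderings through a recursion. Choosing the first entry
  of the upper list leaves the same sum for shorter lists, and the Izergin determinant satisfies
  this recursion because of a partial fraction identity: the function prod_a (q x_a - q^-1 z) /
  prod_b (z - y_b) vanishes at z = q^2 x_i, so its value at z = x_i is a difference of two values,
  and this difference is x_i times a combination of the matrix entries in row i. The symmetry of the
  determinant in the upper set is read off the sum over orderings; that in the lower set follows by
  exchanging the two sets together with q and q^-1. Coefficients and words are kept apart.
  Identities between coefficients are exact, and the RTT relations serve only to permute factors T i
  j with the same i and j. This separation is what permits the reflection: q^-1 replaces q in the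
  coefficients alone, while the words stay in the algebra for q and are compared directly. For this
  reason the sum over partitions is proved with an arbitrary function of the partition in place of
  the word.\<close>

lemma partial_fractions:
  fixes p :: "complex poly" and y :: "nat \<Rightarrow> complex"
  assumes inj: "inj_on y {..<n}" and deg: "degree p \<le> n"
  obtains A where "\<And>z. z \<notin> y ` {..<n} \<Longrightarrow> poly p z / (\<Prod>b<n. z - y b)
    = A + (\<Sum>b<n. poly p (y b) / (\<Prod>c\<in>{..<n} - {b}. y b - y c) / (z - y b))"
proof -
  define D where "D = (\<Prod>b<n. [:- y b, 1:])"
  \<comment> \<open>Subtracting the multiple of \<open>D\<close> with the same coefficient at z^n
    brings the degree below n, so that \<open>r\<close> must coincide with the Lagrange interpolant
    \<open>s\<close> of \<open>p\<close> at the n nodes.\<close>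
  define r where "r = p - smult (coeff p n) D"
  define B where "B b = (\<Prod>c\<in>{..<n} - {b}. [:- y c, 1:])" for b
  define s where "s = (\<Sum>b<n. smult (poly p (y b) / (\<Prod>c\<in>{..<n} - {b}. y b - y c)) (B b))"
  have D: "poly D z = (\<Prod>b<n. z - y b)" for z by (simp add: D_def poly_prod)
  have B: "poly (B b) z = (\<Prod>c\<in>{..<n} - {b}. z - y c)" for b z by (simp add: B_def poly_prod)
  have degD: "degree D = n" unfolding D_def by (subst degree_prod_eq_sum_degree) auto
  have lcD: "coeff D n = 1"
    using degD lead_coeff_prod[of "\<lambda>b. [:- y b, 1:]" "{..<n}"] by (simp add: D_def)
  have ys: "poly r (y b) = poly p (y b)" if "b < n" for b
    using that by (auto simp: r_def D prod_zero_iff)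
  have ss: "poly s (y b) = poly p (y b)" if "b < n" for b
  proof -
    have "poly s (y b) = (\<Sum>a<n. if a = b then poly p (y b) else 0)"
      unfolding s_def poly_sum
    proof (rule sum.cong[OF refl])
      fix a assume a: "a \<in> {..<n}"
      show "poly (smult (poly p (y a) / (\<Prod>c\<in>{..<n} - {a}. y a - y c)) (B a)) (y b)
         = (if a = b then poly p (y b) else 0)"
      proof (cases "a = b")
        case True
        have "(\<Prod>c\<in>{..<n} - {b}. y b - y c) \<noteq> 0"
          using inj that by (auto simp: prod_zero_iff inj_on_def)
        then show ?thesis using True by (simp add: B)
      next
        case False
        then have "poly (B a) (y b) = 0" using that by (auto simp: B prod_zero_iff)
        then show ?thesis using False by simp
      qed
    qed
    then show ?thesis using that by simp
  qed
  \<comment> \<open>For n = 0 no degree lies below n, and agreement at the nodes says nothing. There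
    \<open>p\<close> is constant and \<open>D\<close> is 1, so both sides vanish.\<close>
  have rs: "r = s"
  proof (cases "n = 0")
    case True
    then have "degree p = 0" using deg by simp
    then obtain a where "p = [:a:]" by (rule degree_eq_zeroE)
    with True show ?thesis by (simp add: r_def s_def D_def)
  next
    case False
    have "degree r \<le> n"
      unfolding r_def by (intro degree_diff_le deg order_trans[OF degree_smult_le]) (simp add: degD)
    moreover have "coeff r n = 0" by (simp add: r_def lcD)
    ultimately have "degree r < n"
      using False by (metis coeff_0 degree_0 le_neq_implies_less leading_coeff_0_iff not_gr_zero)
    moreover have "degree (B b) \<le> n - 1" if "b < n" for b
      unfolding B_def using that by (subst degree_prod_eq_sum_degree) auto
    then have "degree s \<le> n - 1"
      unfolding s_def by (intro degree_sum_le) (auto intro: order_trans[OF degree_smult_le])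
    then have "degree s < n" using False by simp
    moreover have "card (y ` {..<n}) = n" using inj by (simp add: card_image)
    ultimately show ?thesis
      by (intro poly_eqI_degree[of "y ` {..<n}"]) (auto simp: ys ss)
  qed
  show thesis
  proof (rule that)
    fix z assume z: "z \<notin> y ` {..<n}"
    have nz: "(\<Prod>b<n. z - y b) \<noteq> 0" using z by (auto simp: prod_zero_iff)
    have "poly p z = coeff p n * (\<Prod>b<n. z - y b) + poly s z"
      using rs[symmetric] by (simp add: r_def D)
    also have "poly s z / (\<Prod>b<n. z - y b)
      = (\<Sum>b<n. poly p (y b) / (\<Prod>c\<in>{..<n} - {b}. y b - y c) / (z - y b))"
      unfolding s_def poly_sum sum_divide_distrib
    proof (rule sum.cong[OF refl])
      fix b assume b: "b \<in> {..<n}"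
      have "(\<Prod>b<n. z - y b) = (z - y b) * (\<Prod>c\<in>{..<n} - {b}. z - y c)"
        using b by (simp add: prod.remove)
      with nz show "poly (smult (poly p (y b) / (\<Prod>c\<in>{..<n} - {b}. y b - y c)) (B b)) z / (\<Prod>b<n. z - y b)
        = poly p (y b) / (\<Prod>c\<in>{..<n} - {b}. y b - y c) / (z - y b)"
        by (simp add: B)
    qed
    then have "(coeff p n * (\<Prod>b<n. z - y b) + poly s z) / (\<Prod>b<n. z - y b) = coeff p n +
      (\<Sum>b<n. poly p (y b) / (\<Prod>c\<in>{..<n} - {b}. y b - y c) / (z - y b))"
      using nz by (simp add: add_divide_distrib)
    ultimately show "poly p z / (\<Prod>b<n. z - y b) = coeff p n +
      (\<Sum>b<n. poly p (y b) / (\<Prod>c\<in>{..<n} - {b}. y b - y c) / (z - y b))"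
      by simp
  qed
qed

text \<open>The increasing enumeration of the indices other than \<open>i\<close>, in the form in
  which \<open>mat_delete\<close> renumbers the rows that remain.\<close>

definition skip_index :: "nat \<Rightarrow> nat \<Rightarrow> nat" where
  "skip_index i a = (if a < i then a else Suc a)"

lemma prod_skip_index:
  assumes "i \<le> n"
  shows "(\<Prod>a\<in>{..<Suc n} - {i}. F a) = (\<Prod>a<n. F (skip_index i a))"
proof (rule prod.reindex_bij_witness[of _ "skip_index i" "\<lambda>a. if a < i then a else a - 1"])
qed (use assms in \<open>auto simp: skip_index_def\<close>)

definition vandermonde :: "nat \<Rightarrow> (nat \<Rightarrow> complex) \<Rightarrow> complex" where
  "vandermonde n x = (\<Prod>j<n. \<Prod>i<j. x i - x j)"

text \<open>Among the factors that contain x_i, the n - i ones whose other index exceeds i have x_i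
  in front; turning them round gives the sign.\<close>

lemma vandermonde_skip:
  "i \<le> n \<Longrightarrow> vandermonde (Suc n) x = (-1) ^ (n - i) * (\<Prod>a<n. x (skip_index i a) - x i) * vandermonde n (\<lambda>a. x (skip_index i a))"
proof (induction n)
  case 0
  then show ?case by (simp add: vandermonde_def)
next
  case (Suc n)
  show ?case
  proof (cases "i = Suc n")
    case True
    then have "skip_index i a = a" if "a < Suc n" for a using that by (simp add: skip_index_def)
    with True show ?thesis by (simp add: vandermonde_def)
  next
    case False
    then have i: "i \<le> n" using Suc.prems by simp
    then have sk: "skip_index i n = Suc n" by (simp add: skip_index_def)
    have "vandermonde (Suc (Suc n)) x = vandermonde (Suc n) x * (\<Prod>a<Suc n. x a - x (Suc n))"
      by (simp add: vandermonde_def)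
    also have "(\<Prod>a<Suc n. x a - x (Suc n)) = (x i - x (Suc n)) * (\<Prod>a<n. x (skip_index i a) - x (Suc n))"
      using i prod_skip_index[OF i, of "\<lambda>a. x a - x (Suc n)"] by (subst prod.remove[of _ i]) auto
    also have "vandermonde (Suc n) x = (-1) ^ (n - i) * (\<Prod>a<n. x (skip_index i a) - x i) * vandermonde n (\<lambda>a. x (skip_index i a))"
      by (rule Suc.IH[OF i])
    finally show ?thesis
      using i sk by (simp add: vandermonde_def Suc_diff_le algebra_simps)
  qed
qed

text \<open>Functions on indices instead of lists: the recursion drops an arbitrary x and the first
  y, which here is composition with \<open>skip_index i\<close> and \<open>Suc\<close>.\<close>

definition izergin_fun :: "complex \<Rightarrow> nat \<Rightarrow> (nat \<Rightarrow> complex) \<Rightarrow> (nat \<Rightarrow> complex) \<Rightarrow> complex" where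
  "izergin_fun q n x y = (\<Prod>i<n. \<Prod>j<n. q * x i - inverse q * y j)
     / (\<Prod>j<n. \<Prod>i<j. (x i - x j) * (y j - y i))
     * det (mat n n (\<lambda>(i, j). (q - inverse q) / ((x i - y j) * (q * x i - inverse q * y j))))"

lemma izergin_eq_izergin_fun: "izergin q xs ys = izergin_fun q (length xs) ((!) xs) ((!) ys)"
  by (simp add: izergin_def izergin_fun_def Let_def)

lemma izergin_fun_cong:
  "(\<And>i. i < n \<Longrightarrow> x i = x' i) \<Longrightarrow> (\<And>i. i < n \<Longrightarrow> y i = y' i) \<Longrightarrow> izergin_fun q n x y = izergin_fun q n x' y'"
  unfolding izergin_fun_def by (intro arg_cong2[of _ _ _ _ "(*)"] arg_cong2[of _ _ _ _ "(/)"] prod.cong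
      arg_cong[of _ _ det] eq_matI refl) auto

text \<open>Replacing the first column of the matrix in the Izergin determinant by a combination of all
  columns multiplies the determinant by the first coefficient. The combination with the residues
  of $\prod_a (q x_a - q^{-1} z) / \prod_b (z - y_b)$ as coefficients is explicit: it is the
  difference of the values of that function at $x_i$ and at its zero $q^2 x_i$.\<close>

lemma izergin_fun_Suc:
  assumes q: "q \<noteq> 0" "q\<^sup>2 \<noteq> 1"
    and x: "inj_on x {..<Suc n}" "\<And>i. i < Suc n \<Longrightarrow> x i \<noteq> 0"
    and y: "inj_on y {..<Suc n}"
    and xy: "\<And>i j. i < Suc n \<Longrightarrow> j < Suc n \<Longrightarrow> x i \<noteq> y j \<and> q\<^sup>2 * x i \<noteq> y j"
  shows "izergin_fun q (Suc n) x y = (\<Sum>i<Suc n. gg q (x i) (y 0)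
    * (\<Prod>a<n. ff q (x (skip_index i a)) (x i)) * (\<Prod>b<n. ff q (x i) (y (Suc b)))
    * izergin_fun q n (\<lambda>a. x (skip_index i a)) (\<lambda>b. y (Suc b)))"
proof -
  define h where "h u v = q * u - inverse q * v" for u v
  define c where "c = q - inverse q"
  define M where "M = mat (Suc n) (Suc n) (\<lambda>(i, j). c / ((x i - y j) * h (x i) (y j)))"
  define R where "R b = (\<Prod>a<Suc n. h (x a) (y b)) / (\<Prod>c\<in>{..<Suc n} - {b}. y b - y c)" for b
  \<comment> \<open>The rational function with residues \<open>R b\<close>, evaluated at z = x i;
    the product over \<open>a\<close> contains the factor for \<open>a = i\<close> too, which does
    not vanish there. The division by \<open>x i\<close> is explained by the difference computed
    below.\<close>
  define v where "v i = (\<Prod>a<Suc n. h (x a) (x i)) / (\<Prod>b<Suc n. x i - y b) / x i" for i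
  have c: "c \<noteq> 0" using q by (auto simp: c_def field_simps power2_eq_square)
  have h: "h (x i) (y j) \<noteq> 0" if "i < Suc n" "j < Suc n" for i j
    using xy[OF that] q by (auto simp: h_def field_simps power2_eq_square)
  have M: "M \<in> carrier_mat (Suc n) (Suc n)" by (simp add: M_def)
  have v: "v i = (\<Sum>b<Suc n. R b * M $$ (i, b))" if i: "i < Suc n" for i
  proof -
    define p where "p = (\<Prod>a<Suc n. [:q * x a, - inverse q:])"
    have "poly [:q * x a, - inverse q:] z = h (x a) z" for a z by (simp add: h_def)
    then have p: "poly p z = (\<Prod>a<Suc n. h (x a) z)" for z
      unfolding p_def poly_prod by (simp only:)
    have "degree p \<le> (\<Sum>a<Suc n. degree [:q * x a, - inverse q:])"
      unfolding p_def
      by (rule order_trans[OF degree_prod_sum_le]) (simp_all only: finite_lessThan o_def order_refl)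
    also have "\<dots> \<le> (\<Sum>a<Suc n. 1)" by (rule sum_mono) simp
    finally have "degree p \<le> Suc n" by simp
    then obtain A where A': "\<And>z. z \<notin> y ` {..<Suc n} \<Longrightarrow>
        poly p z / (\<Prod>b<Suc n. z - y b)
        = A + (\<Sum>b<Suc n. poly p (y b) / (\<Prod>c\<in>{..<Suc n} - {b}. y b - y c) / (z - y b))"
      using partial_fractions[OF y, of p thesis] by fast
    have A: "poly p z / (\<Prod>b<Suc n. z - y b) = A + (\<Sum>b<Suc n. R b / (z - y b))"
      if "z \<notin> y ` {..<Suc n}" for z
      unfolding A'[OF that] unfolding R_def p ..
    have 1: "poly p (x i) / (\<Prod>b<Suc n. x i - y b) = A + (\<Sum>b<Suc n. R b / (x i - y b))"
      using xy[OF i] by (intro A) (auto simp del: prod.lessThan_Suc)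
    have "h (x i) (q\<^sup>2 * x i) = 0" using q by (simp add: h_def power2_eq_square)
    then have "poly p (q\<^sup>2 * x i) = 0"
      using i by (auto simp: p prod_zero_iff simp del: prod.lessThan_Suc)
    moreover have "poly p (q\<^sup>2 * x i) / (\<Prod>b<Suc n. q\<^sup>2 * x i - y b)
        = A + (\<Sum>b<Suc n. R b / (q\<^sup>2 * x i - y b))"
      using xy[OF i] by (intro A) (auto simp del: prod.lessThan_Suc)
    \<comment> \<open>The zero at q^2 x i determines the constant that
      \<open>partial_fractions\<close> leaves open.\<close>
    ultimately have "A = - (\<Sum>b<Suc n. R b / (q\<^sup>2 * x i - y b))"
      by (simp add: eq_neg_iff_add_eq_0 del: prod.lessThan_Suc sum.lessThan_Suc)
    with 1 have "v i = ((\<Sum>b<Suc n. R b / (x i - y b)) - (\<Sum>b<Suc n. R b / (q\<^sup>2 * x i - y b))) / x i"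
      by (simp add: v_def p del: prod.lessThan_Suc sum.lessThan_Suc)
    also have "\<dots> = (\<Sum>b<Suc n. (R b / (x i - y b) - R b / (q\<^sup>2 * x i - y b)) / x i)"
      by (simp only: sum_subtractf sum_divide_distrib diff_divide_distrib)
    also have "\<dots> = (\<Sum>b<Suc n. R b * M $$ (i, b))"
    proof (rule sum.cong[OF refl])
      fix b assume b: "b \<in> {..<Suc n}"
      have nz: "x i - y b \<noteq> 0" "q\<^sup>2 * x i - y b \<noteq> 0" "x i \<noteq> 0" using xy[OF i, of b] x i b by auto
      have hh: "h (x i) (y b) = (q\<^sup>2 * x i - y b) / q"
        using q by (simp add: h_def field_simps power2_eq_square)
      have cc: "c = (q\<^sup>2 - 1) / q" using q by (simp add: c_def field_simps power2_eq_square)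
      \<comment> \<open>1 / (x - y) - 1 / (q^2 x - y) = (q^2 - 1) x / ((x - y) (q^2 x - y)): the
        numerator carries exactly the factor x by which \<open>v\<close> divides.\<close>
      have "(R b / (x i - y b) - R b / (q\<^sup>2 * x i - y b)) / x i
        = R b * ((q\<^sup>2 - 1) / ((x i - y b) * (q\<^sup>2 * x i - y b)))"
        using nz by (simp add: divide_simps) (simp add: algebra_simps)
      also have "\<dots> = R b * M $$ (i, b)"
        using q i b by (simp add: M_def hh cc)
      finally show "(R b / (x i - y b) - R b / (q\<^sup>2 * x i - y b)) / x i = R b * M $$ (i, b)" .
    qed
    finally show ?thesis .
  qed
  \<comment> \<open>The cofactors of the first column annihilate every other column. Pairing them
    with \<open>v\<close>, a combination of all columns, therefore isolates the coefficient
    \<open>R 0\<close>.\<close>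
  have orth: "(\<Sum>i<Suc n. M $$ (i, b) * cofactor M i 0) = (if b = 0 then det M else 0)"
    if b: "b < Suc n" for b
  proof -
    have "(adj_mat M * M) $$ (0, b) = (\<Sum>i<Suc n. M $$ (i, b) * cofactor M i 0)"
      using b M unfolding adj_mat_def
      by (simp add: scalar_prod_def atLeast0LessThan mult.commute del: sum.lessThan_Suc)
    then show ?thesis using adj_mat(3)[OF M] b by auto
  qed
  have main: "(\<Sum>i<Suc n. v i * cofactor M i 0) = R 0 * det M"
  proof -
    have "(\<Sum>i<Suc n. v i * cofactor M i 0) = (\<Sum>i<Suc n. \<Sum>b<Suc n. R b * (M $$ (i, b) * cofactor M i 0))"
      by (rule sum.cong[OF refl]) (simp add: v sum_distrib_right mult.assoc del: sum.lessThan_Suc)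
    also have "\<dots> = (\<Sum>b<Suc n. R b * (\<Sum>i<Suc n. M $$ (i, b) * cofactor M i 0))"
      by (subst sum.swap) (simp only: sum_distrib_left)
    also have "\<dots> = (\<Sum>b<Suc n. if b = 0 then R 0 * det M else 0)"
      by (rule sum.cong[OF refl]) (simp add: orth del: sum.lessThan_Suc)
    also have "\<dots> = R 0 * det M" by (subst sum.delta) auto
    finally show ?thesis .
  qed
  define Y where "Y = (\<Prod>b<n. y 0 - y (Suc b))"
  define H where "H = (\<Prod>i<Suc n. \<Prod>b<n. h (x i) (y (Suc b)))"
  define V where "V = vandermonde (Suc n) x"
  define W where "W = (\<Prod>j<n. \<Prod>i<j. y (Suc j) - y (Suc i))"
  have Y0: "Y \<noteq> 0" using y unfolding Y_def inj_on_def by (auto simp: prod_zero_iff)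
  have V0: "V \<noteq> 0" using x unfolding V_def vandermonde_def inj_on_def by (auto simp: prod_zero_iff simp del: prod.lessThan_Suc)
  have "y (Suc j) \<noteq> y (Suc i)" if "j < n" "i < j" for i j
    using inj_onD[OF y, of "Suc j" "Suc i"] that by auto
  then have W0: "W \<noteq> 0" unfolding W_def by (auto simp: prod_zero_iff)
  have R0: "R 0 = (\<Prod>a<Suc n. h (x a) (y 0)) / Y"
    using prod_skip_index[of 0 n "\<lambda>c. y 0 - y c"] by (simp add: R_def Y_def skip_index_def del: prod.lessThan_Suc)
  have W': "(\<Prod>j<Suc n. \<Prod>i<j. y j - y i) = (-1) ^ n * Y * W"
  proof -
    have "(\<Prod>j<Suc n. \<Prod>i<j. y j - y i) = (\<Prod>j<n. (y (Suc j) - y 0) * (\<Prod>i<j. y (Suc j) - y (Suc i)))"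
      by (subst prod.lessThan_Suc_shift) (simp add: prod.lessThan_Suc_shift del: prod.lessThan_Suc)
    also have "\<dots> = (\<Prod>j<n. y (Suc j) - y 0) * W" by (simp add: W_def prod.distrib)
    also have "(\<Prod>j<n. y (Suc j) - y 0) = (-1) ^ n * Y"
      using prod.distrib[of "\<lambda>_. -1" "\<lambda>j. y 0 - y (Suc j)" "{..<n}"] by (simp add: Y_def)
    finally show ?thesis by simp
  qed
  have "izergin_fun q (Suc n) x y = (\<Prod>i<Suc n. h (x i) (y 0) * (\<Prod>b<n. h (x i) (y (Suc b)))) / (V * ((-1) ^ n * Y * W)) * det M"
    unfolding izergin_fun_def M_def W'[symmetric] V_def vandermonde_def prod.distrib[symmetric] h_def c_def
    by (simp only: prod.lessThan_Suc_shift)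
  \<comment> \<open>The part of the prefactor that contains \<open>y 0\<close> is \<open>R 0\<close>
    up to sign, so \<open>R 0 * det M\<close> can be replaced by the sum over cofactors without any
    division.\<close>
  also have "\<dots> = H * (-1) ^ n / (V * W) * (R 0 * det M)"
    using Y0 V0 W0 unfolding R0 H_def prod.distrib
    by (simp add: field_simps del: prod.lessThan_Suc)
  also have "\<dots> = (\<Sum>i<Suc n. H * (-1) ^ n / (V * W) * (v i * cofactor M i 0))"
    unfolding main[symmetric] sum_distrib_left ..
  also have "\<dots> = (\<Sum>i<Suc n. gg q (x i) (y 0)
    * (\<Prod>a<n. ff q (x (skip_index i a)) (x i)) * (\<Prod>b<n. ff q (x i) (y (Suc b)))
    * izergin_fun q n (\<lambda>a. x (skip_index i a)) (\<lambda>b. y (Suc b)))"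
  proof (rule sum.cong[OF refl])
    fix i assume "i \<in> {..<Suc n}"
    then have i: "i < Suc n" "i \<le> n" by auto
    define Mi where "Mi = mat n n (\<lambda>(a, b). c / ((x (skip_index i a) - y (Suc b)) * h (x (skip_index i a)) (y (Suc b))))"
    define Hi where "Hi = (\<Prod>a<n. \<Prod>b<n. h (x (skip_index i a)) (y (Suc b)))"
    define Vi where "Vi = vandermonde n (\<lambda>a. x (skip_index i a))"
    define Xi where "Xi = (\<Prod>a<n. x (skip_index i a) - x i)"
    define hb where "hb = (\<Prod>b<n. h (x i) (y (Suc b)))"
    define ha where "ha = (\<Prod>a<n. h (x (skip_index i a)) (x i))"
    define xb where "xb = (\<Prod>b<n. x i - y (Suc b))"
    have "mat_delete M i 0 = Mi"
      unfolding mat_delete_def M_def Mi_def using i by (intro eq_matI) (auto simp: skip_index_def)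
    then have cof: "cofactor M i 0 = (-1) ^ i * det Mi" by (simp add: cofactor_def)
    have Ve: "V = (-1) ^ (n - i) * Xi * Vi" unfolding V_def Xi_def Vi_def by (rule vandermonde_skip[OF i(2)])
    have nz: "Xi \<noteq> 0" "Vi \<noteq> 0" using V0 Ve by auto
    have xi: "x i \<noteq> 0" using x i by simp
    have x0: "x i \<noteq> y 0" "xb \<noteq> 0" using xy[OF i(1)] by (auto simp: xb_def prod_zero_iff)
    have ve: "v i = c * ha / ((x i - y 0) * xb)"
    proof -
      \<comment> \<open>The factor with \<open>a = i\<close> is \<open>c * x i\<close>: its
        \<open>x i\<close> cancels the division in \<open>v\<close>, and \<open>c\<close> becomes
        the numerator of \<open>gg\<close>.\<close>
      have "(\<Prod>a<Suc n. h (x a) (x i)) = c * x i * ha"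
        unfolding ha_def prod_skip_index[OF i(2), of "\<lambda>a. h (x a) (x i)", symmetric]
        using i by (subst prod.remove[of _ i]) (auto simp: h_def c_def algebra_simps)
      moreover have "(\<Prod>b<Suc n. x i - y b) = (x i - y 0) * xb"
        by (simp add: xb_def prod.lessThan_Suc_shift del: prod.lessThan_Suc)
      ultimately show ?thesis using xi by (simp add: v_def del: prod.lessThan_Suc)
    qed
    have He: "H = hb * Hi"
      unfolding H_def hb_def Hi_def prod_skip_index[OF i(2), of "\<lambda>a. \<Prod>b<n. h (x a) (y (Suc b))", symmetric]
      using i by (subst prod.remove[of _ i]) auto
    \<comment> \<open>Three signs meet here: (-1)^n from the differences of the y, (-1)^(n - i) from
      \<open>vandermonde_skip\<close>, and (-1)^i from the cofactor. Their product is 1.\<close>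
    have sgn: "(-1 :: complex) ^ n = (-1) ^ i * (-1) ^ (n - i)"
      using i by (simp add: power_add[symmetric])
    have IZe: "izergin_fun q n (\<lambda>a. x (skip_index i a)) (\<lambda>b. y (Suc b)) = Hi / (Vi * W) * det Mi"
      unfolding izergin_fun_def Hi_def Vi_def W_def Mi_def vandermonde_def prod.distrib h_def c_def ..
    have fe: "(\<Prod>a<n. ff q (x (skip_index i a)) (x i)) = ha / Xi" "(\<Prod>b<n. ff q (x i) (y (Suc b))) = hb / xb"
      unfolding ff_def ha_def hb_def Xi_def xb_def h_def by (simp_all add: prod_dividef)
    have "H * (-1) ^ n / (V * W) * (v i * cofactor M i 0)
      = ((-1) ^ i * (-1) ^ i) * (hb * Hi * (c * ha) * det Mi / ((x i - y 0) * xb * Xi * Vi * W))"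
      unfolding He Ve ve cof sgn using nz x0 W0 by (simp add: field_simps)
    also have "(-1 :: complex) ^ i * (-1) ^ i = 1" by (simp add: power_mult_distrib[symmetric])
    also have "1 * (hb * Hi * (c * ha) * det Mi / ((x i - y 0) * xb * Xi * Vi * W))
       = gg q (x i) (y 0) * (ha / Xi) * (hb / xb) * (Hi / (Vi * W) * det Mi)"
      by (simp add: gg_def c_def mult_ac)
    finally show "H * (-1) ^ n / (V * W) * (v i * cofactor M i 0) = gg q (x i) (y 0)
      * (\<Prod>a<n. ff q (x (skip_index i a)) (x i)) * (\<Prod>b<n. ff q (x i) (y (Suc b)))
      * izergin_fun q n (\<lambda>a. x (skip_index i a)) (\<lambda>b. y (Suc b))"
      unfolding IZe fe .
  qed
  finally show ?thesis .
qed

text \<open>What \<open>beta\<close> contributes for a single list of parameters.\<close>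

fun desc_prod :: "complex \<Rightarrow> complex list \<Rightarrow> complex" where
  "desc_prod q [] = 1"
| "desc_prod q (x # xs) = (\<Prod>y\<leftarrow>xs. ff q y x) * desc_prod q xs"

text \<open>The factors with which \<open>pre_bethe\<close> links the elements of one block on two
  neighbouring levels, \<open>xs\<close> on the upper and \<open>ys\<close> on the lower one. The
  lists have equal length wherever it matters.\<close>

fun chain_prod :: "complex \<Rightarrow> complex list \<Rightarrow> complex list \<Rightarrow> complex" where
  "chain_prod q (x # xs) (y # ys) = gl q x y * (\<Prod>z\<leftarrow>ys. ff q x z) * chain_prod q xs ys"
| "chain_prod q _ _ = 1"

text \<open>What genericity gives for lists taken from two different levels. The condition
  \<open>q\<^sup>2 * x \<noteq> y\<close> is one-sided, but it is preserved when \<open>xs\<close>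
  and \<open>ys\<close> are exchanged and q is inverted.\<close>

definition separated :: "complex \<Rightarrow> complex list \<Rightarrow> complex list \<Rightarrow> bool" where
  "separated q xs ys \<longleftrightarrow> distinct xs \<and> distinct ys \<and> 0 \<notin> set xs \<and> 0 \<notin> set ys \<and>
     (\<forall>x\<in>set xs. \<forall>y\<in>set ys. x \<noteq> y \<and> q\<^sup>2 * x \<noteq> y)"

lemma prod_list_nth: "prod_list (map f xs) = (\<Prod>i<length xs. f (xs ! i))"
  by (induction xs) (simp_all add: prod.lessThan_Suc_shift del: prod.lessThan_Suc)

lemma prod_list_distinct: "distinct xs \<Longrightarrow> prod_list (map f xs) = prod f (set xs)"
  by (induction xs) auto

text \<open>Both sides satisfy the same recursion: the choice of the first element of \<open>xs\<close> corresponds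
  to the expansion of the determinant along its first column.\<close>

lemma sum_permutations_izergin:
  assumes q: "q \<noteq> 0" "q\<^sup>2 \<noteq> 1"
  shows "length ys = length zs \<Longrightarrow> distinct zs \<Longrightarrow> separated q (map \<tau> zs) ys \<Longrightarrow>
    (\<Sum>xs\<in>permutations_of_set (set zs). desc_prod q (map \<tau> xs) * chain_prod q (map \<tau> xs) ys)
    = izergin_l q (map \<tau> zs) ys"
proof (induction ys arbitrary: zs)
  case Nil
  then show ?case by (simp add: izergin_l_def izergin_def)
next
  case (Cons y ys)
  define n where "n = length ys"
  define x where "x i = \<tau> (zs ! i)" for i
  define zs' where "zs' i = map (\<lambda>a. zs ! skip_index i a) [0..<n]" for i
  have len: "length zs = Suc n" using Cons.prems by (simp add: n_def)
  have sep: "distinct (map \<tau> zs)" "distinct (y # ys)" "0 \<notin> \<tau> ` set zs" "0 \<notin> set (y # ys)"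
    "\<And>u v. u \<in> \<tau> ` set zs \<Longrightarrow> v \<in> set (y # ys) \<Longrightarrow> u \<noteq> v \<and> q\<^sup>2 * u \<noteq> v"
    using Cons.prems(3) unfolding separated_def by auto
  have mem: "zs ! i \<in> set zs" if "i < Suc n" for i using that len by simp
  have sk_less: "skip_index i a < Suc n" if "a < n" for i a using that by (simp add: skip_index_def)
  have bij: "bij_betw ((!) zs) {..<Suc n} (set zs)"
    using Cons.prems(2) len by (intro bij_betw_nth) auto
  have skset: "skip_index i ` {..<n} = {..<Suc n} - {i}" if "i < Suc n" for i
  proof
    show "{..<Suc n} - {i} \<subseteq> skip_index i ` {..<n}"
    proof
      fix a assume a: "a \<in> {..<Suc n} - {i}"
      have "skip_index i (if a < i then a else a - 1) = a" using a by (auto simp: skip_index_def)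
      moreover have "(if a < i then a else a - 1) < n" using a that by auto
      ultimately show "a \<in> skip_index i ` {..<n}" by (metis image_eqI lessThan_iff)
    qed
  qed (auto simp: skip_index_def)
  have skinj: "inj (skip_index i)" for i by (rule injI) (auto simp: skip_index_def split: if_splits)
  have set': "set (zs' i) = set zs - {zs ! i}" if i: "i < Suc n" for i
  proof -
    have "set (zs' i) = (!) zs ` (skip_index i ` {..<n})" by (auto simp: zs'_def)
    also have "\<dots> = (!) zs ` ({..<Suc n} - {i})" by (simp only: skset[OF i])
    also have "\<dots> = (!) zs ` {..<Suc n} - {zs ! i}"
      using i bij by (subst inj_on_image_set_diff[of _ "{..<Suc n}"]) (auto simp: bij_betw_def)
    finally show ?thesis using bij by (simp add: bij_betw_def)
  qed
  have dist': "distinct (zs' i)" for i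
    unfolding zs'_def distinct_map
    using Cons.prems(2) len sk_less skinj[of i]
    by (auto simp: inj_on_def nth_eq_iff_index_eq dest: injD)
  have step: "(\<Sum>xs\<in>permutations_of_set (set zs - {zs ! i}).
       desc_prod q (map \<tau> (zs ! i # xs)) * chain_prod q (map \<tau> (zs ! i # xs)) (y # ys))
     = prod_list (map \<tau> zs) * (gg q (x i) y * (\<Prod>a<n. ff q (x (skip_index i a)) (x i)) *
        (\<Prod>b<n. ff q (x i) (ys ! b)) * izergin_fun q n (\<lambda>a. x (skip_index i a)) ((!) ys))" if i: "i < Suc n" for i
  proof -
    have p: "(\<Prod>y\<leftarrow>map \<tau> xs. ff q y (x i)) = (\<Prod>a<n. ff q (x (skip_index i a)) (x i))"
      if xs: "xs \<in> permutations_of_set (set zs - {zs ! i})" for xs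
    proof -
      have "(\<Prod>y\<leftarrow>map \<tau> xs. ff q y (x i)) = (\<Prod>a\<leftarrow>xs. ff q (\<tau> a) (x i))" by (simp add: o_def)
      also have "\<dots> = (\<Prod>a\<in>set (zs' i). ff q (\<tau> a) (x i))"
        using permutations_of_setD[OF xs] by (simp add: prod_list_distinct set'[OF i])
      also have "\<dots> = (\<Prod>a\<leftarrow>zs' i. ff q (\<tau> a) (x i))" using dist' by (simp add: prod_list_distinct)
      also have "\<dots> = (\<Prod>a<n. ff q (x (skip_index i a)) (x i))"
        unfolding prod_list_nth by (simp add: zs'_def x_def)
      finally show ?thesis .
    qed
    have "(\<Sum>xs\<in>permutations_of_set (set zs - {zs ! i}).
       desc_prod q (map \<tau> (zs ! i # xs)) * chain_prod q (map \<tau> (zs ! i # xs)) (y # ys))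
     = (\<Sum>xs\<in>permutations_of_set (set (zs' i)). (\<Prod>a<n. ff q (x (skip_index i a)) (x i)) * gl q (x i) y *
        (\<Prod>z\<leftarrow>ys. ff q (x i) z) * (desc_prod q (map \<tau> xs) * chain_prod q (map \<tau> xs) ys))"
      unfolding set'[OF i]
      by (rule sum.cong[OF refl]) (simp add: p[unfolded x_def list.map_comp o_def] x_def o_def)
    also have "\<dots> = (\<Prod>a<n. ff q (x (skip_index i a)) (x i)) * gl q (x i) y * (\<Prod>z\<leftarrow>ys. ff q (x i) z) *
        izergin_l q (map \<tau> (zs' i)) ys"
      unfolding sum_distrib_left[symmetric]
    proof (subst Cons.IH)
      show "length ys = length (zs' i)" by (simp add: zs'_def n_def)
      show "separated q (map \<tau> (zs' i)) ys"
        unfolding separated_def using sep dist' set'[OF i] by (auto simp: distinct_map intro: inj_on_subset)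
    qed (simp_all add: dist')
    also have "izergin_l q (map \<tau> (zs' i)) ys = (\<Prod>a<n. x (skip_index i a)) * izergin_fun q n (\<lambda>a. x (skip_index i a)) ((!) ys)"
      unfolding izergin_l_def izergin_eq_izergin_fun prod_list_nth[of id, simplified] prod_list_nth
      by (intro arg_cong2[of _ _ _ _ "(*)"]) (auto simp: zs'_def x_def intro!: izergin_fun_cong prod.cong)
    also have "(\<Prod>z\<leftarrow>ys. ff q (x i) z) = (\<Prod>b<n. ff q (x i) (ys ! b))"
      by (simp add: prod_list_nth n_def)
    finally have 1: "(\<Sum>xs\<in>permutations_of_set (set zs - {zs ! i}).
       desc_prod q (map \<tau> (zs ! i # xs)) * chain_prod q (map \<tau> (zs ! i # xs)) (y # ys))
      = (\<Prod>a<n. ff q (x (skip_index i a)) (x i)) * gl q (x i) y * (\<Prod>b<n. ff q (x i) (ys ! b)) *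
        ((\<Prod>a<n. x (skip_index i a)) * izergin_fun q n (\<lambda>a. x (skip_index i a)) ((!) ys))" .
    \<comment> \<open>The \<open>x i\<close> contained in \<open>gl\<close> completes the product of
      the remaining x to the product of all of them. It is then the same for every \<open>i\<close>
      and leaves the sum.\<close>
    have "prod_list (map \<tau> zs) = (\<Prod>a<Suc n. x a)" by (simp add: prod_list_nth len x_def)
    also have "\<dots> = x i * (\<Prod>a<n. x (skip_index i a))"
      using i prod_skip_index[of i n x] by (subst prod.remove[of _ i]) auto
    finally show ?thesis unfolding 1 by (simp add: gl_def)
  qed
  have inj\<tau>: "inj_on x {..<Suc n}"
    using sep(1) len unfolding x_def inj_on_def by (auto simp: distinct_conv_nth)
  have "(\<Sum>xs\<in>permutations_of_set (set zs). desc_prod q (map \<tau> xs) * chain_prod q (map \<tau> xs) (y # ys))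
    = (\<Sum>a\<in>set zs. \<Sum>xs\<in>permutations_of_set (set zs - {a}).
        desc_prod q (map \<tau> (a # xs)) * chain_prod q (map \<tau> (a # xs)) (y # ys))"
  proof -
    have "set zs \<noteq> {}" using len by auto
    then show ?thesis
      by (subst permutations_of_set_nonempty, simp, subst sum.UNION_disjoint)
        (auto simp: sum.reindex intro!: sum.cong)
  qed
  also have "\<dots> = (\<Sum>i<Suc n. \<Sum>xs\<in>permutations_of_set (set zs - {zs ! i}).
        desc_prod q (map \<tau> (zs ! i # xs)) * chain_prod q (map \<tau> (zs ! i # xs)) (y # ys))"
    by (rule sum.reindex_bij_betw[OF bij, symmetric])
  also have "\<dots> = (\<Sum>i<Suc n. prod_list (map \<tau> zs) * (gg q (x i) y * (\<Prod>a<n. ff q (x (skip_index i a)) (x i)) *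
        (\<Prod>b<n. ff q (x i) (ys ! b)) * izergin_fun q n (\<lambda>a. x (skip_index i a)) ((!) ys)))"
    by (rule sum.cong[OF refl]) (simp only: step lessThan_iff)
  also have "\<dots> = prod_list (map \<tau> zs) * izergin_fun q (Suc n) x ((!) (y # ys))"
  proof -
    have "inj_on ((!) (y # ys)) {..<Suc n}"
      using sep(2) unfolding inj_on_def n_def
      by (metis length_Cons lessThan_iff nth_eq_iff_index_eq)
    moreover have "x i \<noteq> 0" if "i < Suc n" for i using sep(3) mem[OF that] by (auto simp: x_def)
    moreover have "x i \<noteq> (y # ys) ! j \<and> q\<^sup>2 * x i \<noteq> (y # ys) ! j" if "i < Suc n" "j < Suc n" for i j
      using mem[OF that(1)] that(2) unfolding x_def n_def by (intro sep(5) nth_mem) auto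
    ultimately show ?thesis
      by (subst izergin_fun_Suc[OF q inj\<tau>]) (simp_all add: sum_distrib_left del: sum.lessThan_Suc)
  qed
  also have "izergin_fun q (Suc n) x ((!) (y # ys)) = izergin q (map \<tau> zs) (y # ys)"
    unfolding izergin_eq_izergin_fun length_map len by (rule izergin_fun_cong) (simp_all add: x_def len)
  finally show ?case by (simp add: izergin_l_def)
qed

text \<open>Each factor \<open>h i j\<close> changes sign, so the matrix becomes minus its
  transpose. This gives (-1)^n from the determinant and (-1)^(n * n) from the prefactor, and n * n +
  n is even. In the denominator the two differences of each pair change sign together.\<close>

lemma izergin_swap:
  assumes "length xs = length ys" and "q \<noteq> 0"
  shows "izergin (inverse q) ys xs = izergin q xs ys"
proof -
  define n where "n = length xs"
  define h where "h i j = q * xs ! i - inverse q * ys ! j" for i j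
  define M where "M = mat n n (\<lambda>(i, j). (q - inverse q) / ((xs ! i - ys ! j) * h i j))"
  have h': "inverse q * ys ! j - inverse (inverse q) * xs ! i = - h i j" for i j by (simp add: h_def)
  have M: "M \<in> carrier_mat n n" by (simp add: M_def)
  have m: "mat n n (\<lambda>(i, j). (inverse q - inverse (inverse q)) /
      ((ys ! i - xs ! j) * (inverse q * ys ! i - inverse (inverse q) * xs ! j))) = (-1) \<cdot>\<^sub>m M\<^sup>T"
    unfolding h' M_def
    by (rule eq_matI) (simp_all add: divide_simps, simp add: algebra_simps)
  have "(\<Prod>i<n. \<Prod>j<n. - h j i) = (\<Prod>j<n. \<Prod>i<n. (-1) * h j i)" by (subst prod.swap) simp
  also have "\<dots> = (-1) ^ (n * n) * (\<Prod>j<n. \<Prod>i<n. h j i)"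
    by (simp only: prod.distrib prod_constant card_lessThan power_mult)
  finally have p: "(\<Prod>i<n. \<Prod>j<n. - h j i) = (-1) ^ (n * n) * (\<Prod>j<n. \<Prod>i<n. h j i)" .
  have v: "(\<Prod>j<n. \<Prod>i<j. (ys ! i - ys ! j) * (xs ! j - xs ! i)) = (\<Prod>j<n. \<Prod>i<j. (xs ! i - xs ! j) * (ys ! j - ys ! i))"
    by (intro prod.cong refl) (simp add: algebra_simps)
  have s: "(-1 :: complex) ^ (n * n) * (-1) ^ n = 1"
    by (simp add: power_add[symmetric])
  have "izergin (inverse q) ys xs = (-1) ^ (n * n) * (\<Prod>j<n. \<Prod>i<n. h j i) /
      (\<Prod>j<n. \<Prod>i<j. (xs ! i - xs ! j) * (ys ! j - ys ! i)) * ((-1) ^ n * det M)"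
    unfolding izergin_def Let_def assms(1)[symmetric] n_def[symmetric] m v det_smult
    unfolding h' p using M by (simp add: det_transpose)
  also have "\<dots> = ((-1) ^ (n * n) * (-1) ^ n) * ((\<Prod>j<n. \<Prod>i<n. h j i) /
      (\<Prod>j<n. \<Prod>i<j. (xs ! i - xs ! j) * (ys ! j - ys ! i)) * det M)" by simp
  also have "\<dots> = izergin q xs ys"
    unfolding s izergin_def Let_def n_def[symmetric] M_def h_def by simp
  finally show ?thesis .
qed

lemma izergin_r_swap:
  "length xs = length ys \<Longrightarrow> q \<noteq> 0 \<Longrightarrow> izergin_l (inverse q) ys xs = izergin_r q xs ys"
  by (simp add: izergin_l_def izergin_r_def izergin_swap)

text \<open>The sum in \<open>sum_permutations_izergin\<close> sees the upper parameters only as a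
  set. Their product, by which \<open>izergin_l\<close> differs from \<open>izergin\<close>, is
  nonzero and can be cancelled.\<close>

lemma izergin_perm_left:
  assumes q: "q \<noteq> 0" "q\<^sup>2 \<noteq> 1" and sep: "separated q xs ys"
    and len: "length xs = length ys" and xs: "distinct xs'" "set xs' = set xs"
  shows "izergin q xs' ys = izergin q xs ys"
proof -
  have d: "distinct xs" using sep by (simp add: separated_def)
  have len': "length xs' = length xs" using d xs by (metis distinct_card)
  have sep': "separated q xs' ys" using sep xs by (auto simp: separated_def)
  have "izergin_l q (map id xs') ys = izergin_l q (map id xs) ys"
    using sum_permutations_izergin[OF q, of ys xs' id] sum_permutations_izergin[OF q, of ys xs id]
      len len' sep sep' d xs by simp
  moreover have "prod_list xs' = prod_list xs"
    using prod_list_distinct[of xs' id] prod_list_distinct[of xs id] d xs by simp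
  moreover have "prod_list xs \<noteq> 0" using sep by (auto simp: separated_def prod_list_zero_iff)
  ultimately show ?thesis by (simp add: izergin_l_def)
qed

text \<open>Reduced to the other set by \<open>izergin_swap\<close>. This symmetry makes the result
  of summing over one level independent of the ordering chosen on the level below.\<close>

lemma izergin_l_perm_right:
  assumes q: "q \<noteq> 0" "q\<^sup>2 \<noteq> 1" and sep: "separated q xs ys"
    and len: "length xs = length ys" and ys: "distinct ys'" "set ys' = set ys"
  shows "izergin_l q xs ys' = izergin_l q xs ys"
proof -
  have len': "length ys' = length ys" using sep ys by (metis distinct_card separated_def)
  have "inverse q \<noteq> 0" "(inverse q)\<^sup>2 \<noteq> 1" using q by (auto simp: power_inverse)
  moreover have "separated (inverse q) ys xs"
    using sep q by (auto simp: separated_def power_inverse field_simps)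
  ultimately have "izergin (inverse q) ys' xs = izergin (inverse q) ys xs"
    using len ys by (intro izergin_perm_left) auto
  then show ?thesis
    using izergin_swap[of xs ys q] izergin_swap[of xs ys' q] len len' q by (simp add: izergin_l_def)
qed

section \<open>Blocks of positions, and the bijection between pairs (matrix, permutations) and
  orderings of a partition\<close>

section \<open>Arrangements of the Bethe parameters\<close>

text \<open>Within the group of the pairs with first component \<open>i\<close>, positions are counted from the end of
  the group. Then the block \<open>(i, j)\<close> takes up the same positions on all levels on which it occurs,
  and the pre-Bethe vector pairs its elements on neighbouring levels in order.\<close>

definition block_positions :: "(nat \<Rightarrow> nat \<Rightarrow> nat) \<Rightarrow> nat \<Rightarrow> nat \<times> nat \<Rightarrow> nat list" where
  "block_positions m k p = [m_sum m (fst p) k - m (fst p) (snd p) + 1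
                 ..< m_sum m (fst p) k - m (fst p) (snd p + 1) + 1]"

lemma pairs_iff: "(i, j) \<in> pairs N k \<longleftrightarrow> 1 \<le> i \<and> i \<le> k \<and> k \<le> j \<and> j < N"
  by (auto simp: pair_list_def)

lemma distinct_pair_list: "distinct (pair_list N k)"
  by (simp add: pair_list_def distinct_product)

lemma pair_list_concat: "pair_list N k = concat (map (\<lambda>i. map (Pair i) [k..<N]) [1..<k + 1])"
  by (simp add: pair_list_def product_concat_map)

lemma sorted_pair_list: "sorted_wrt (\<prec>) (pair_list N k)"
proof -
  have "sorted_wrt (\<prec>) (List.product xs ys)" if "sorted_wrt (<) xs" "sorted_wrt (<) ys" for xs ys :: "nat list"
    using that by (induction xs) (auto simp: sorted_wrt_append sorted_wrt_map prec_def)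
  then show ?thesis unfolding pair_list_def by (simp del: upt_Suc)
qed

lemma prec_total: "p = p' \<or> p \<prec> p' \<or> p' \<prec> p"
  by (auto simp: prec_def prod_eq_iff)

lemma upt_append: "a \<le> b \<Longrightarrow> b \<le> c \<Longrightarrow> [a..<b] @ [b..<c] = [a..<c]"
  by (metis le_add_diff_inverse upt_add_eq_append)

lemma m_sum_Suc: "m_sum m (Suc i) k = m_sum m i k + m (Suc i) k"
  by (simp add: m_sum_def)

lemma m_sum_mono: "i \<le> i' \<Longrightarrow> m_sum m i k \<le> m_sum m i' k"
  unfolding m_sum_def by (rule sum_mono2) auto

lemma le_m_sum: "1 \<le> i \<Longrightarrow> m i k \<le> m_sum m i k"
  by (cases i) (auto simp: m_sum_Suc)

context
  fixes N n m
  assumes m: "m \<in> upper_permissible N n"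
begin

lemma upper_outside: "\<not> (1 \<le> i \<and> i \<le> j \<and> j < N) \<Longrightarrow> m i j = 0"
  using m unfolding upper_permissible_def by blast

lemma upper_antimono:
  assumes "1 \<le> i" "i \<le> a" "a \<le> b"
  shows "m i b \<le> m i a"
  using assms(3)
proof (induction b rule: dec_induct)
  case (step b)
  have "m i (Suc b) \<le> m i b"
  proof (cases "b < N")
    case True
    then show ?thesis using m assms step.hyps by (simp add: upper_permissible_def)
  next
    case False
    then show ?thesis by (simp add: upper_outside)
  qed
  then show ?case using step.IH by simp
qed simp

lemma m_sum_diag: "k \<in> {1..<N} \<Longrightarrow> m_sum m k k = n k"
  using m unfolding upper_permissible_def m_sum_def by simp

lemma block_positions_row:
  assumes "1 \<le> i" "i \<le> k" "k \<le> b"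
  shows "concat (map (\<lambda>j. block_positions m k (i, j)) [k..<b]) = [m_sum m i k - m i k + 1 ..< m_sum m i k - m i b + 1]"
  using assms(3)
proof (induction b rule: dec_induct)
  case (step b)
  have 1: "m i b \<le> m i k" "m i (Suc b) \<le> m i b" using assms step.hyps by (auto intro: upper_antimono)
  have 2: "m i k \<le> m_sum m i k" using assms by (simp add: le_m_sum)
  have 3: "[m_sum m i k - m i k + 1 ..< m_sum m i k - m i b + 1] @ [m_sum m i k - m i b + 1 ..< m_sum m i k - m i (Suc b) + 1]
    = [m_sum m i k - m i k + 1 ..< m_sum m i k - m i (Suc b) + 1]"
    using 1 2 by (intro upt_append) auto
  have 4: "[k..<Suc b] = [k..<b] @ [b]" using step.hyps by simp
  show ?case unfolding 4 using step.IH 3 by (simp add: block_positions_def del: upt_Suc)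
qed simp

text \<open>Within a group the block boundaries telescope, and m i N = 0 makes the last block end at
  \<open>m_sum m i k\<close>, where the next group begins.\<close>

lemma concat_block_positions:
  assumes k: "k \<in> {1..<N}"
  shows "concat (map (block_positions m k) (pair_list N k)) = [1..<n k + 1]"
proof -
  have "concat (map (block_positions m k) (concat (map (\<lambda>i. map (Pair i) [k..<N]) [1..<c + 1]))) = [1..<m_sum m c k + 1]"
    if "c \<le> k" for c
    using that
  proof (induction c)
    case 0
    then show ?case by (simp add: m_sum_def)
  next
    case (Suc c)
    have "[1..<m_sum m c k + 1] @ [m_sum m c k + 1 ..< m_sum m (Suc c) k + 1] = [1..<m_sum m (Suc c) k + 1]"
      by (intro upt_append) (auto simp: m_sum_Suc)
    moreover have "concat (map (\<lambda>j. block_positions m k (Suc c, j)) [k..<N]) = [m_sum m c k + 1 ..< m_sum m (Suc c) k + 1]"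
      using block_positions_row[of "Suc c" k N] Suc.prems k by (simp add: upper_outside m_sum_Suc del: upt_Suc)
    moreover have "[1..<Suc c + 1] = [1..<c + 1] @ [Suc c]" by simp
    ultimately show ?case using Suc by (simp add: o_def del: upt_Suc)
  qed
  from this[of k] show ?thesis using k unfolding pair_list_concat by (simp add: m_sum_diag)
qed

lemma block_positions_union: "k \<in> {1..<N} \<Longrightarrow> (\<Union>p\<in>pairs N k. set (block_positions m k p)) = {1..n k}"
  using arg_cong[OF concat_block_positions, of k set] by (simp add: atLeastLessThanSuc_atLeastAtMost del: upt_Suc)

lemma block_positions_less:
  assumes "k \<in> {1..<N}" "p \<in> pairs N k" "p' \<in> pairs N k" "p \<prec> p'" "x \<in> set (block_positions m k p)" "y \<in> set (block_positions m k p')"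
  shows "x < y"
proof -
  obtain i j i' j' where p: "p = (i, j)" "p' = (i', j')" by (cases p, cases p')
  have ij: "1 \<le> i" "i \<le> k" "k \<le> j" "1 \<le> i'" "i' \<le> k" "k \<le> j'"
    using assms(2,3) unfolding p pairs_iff by auto
  have x: "x \<le> m_sum m i k - m i (j + 1)" and y: "m_sum m i' k - m i' j' < y"
    using assms(5,6) by (auto simp: p block_positions_def)
  show ?thesis
  proof (cases "i = i'")
    case True
    then have "j < j'" using assms(4) by (auto simp: p prec_def)
    then have "m i j' \<le> m i (j + 1)" using ij by (intro upper_antimono) auto
    then have "m_sum m i k - m i (j + 1) \<le> m_sum m i k - m i j'" by (rule diff_le_mono2)
    then show ?thesis using x y True by simp
  next
    case False
    then have "i < i'" using assms(4) by (auto simp: p prec_def)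
    then obtain c where c: "i' = Suc c" "i \<le> c" by (cases i') auto
    have "m i' j' \<le> m i' k" using ij by (intro upper_antimono) auto
    then have "m_sum m c k < y" using y by (simp add: c m_sum_Suc)
    moreover have "m_sum m i k \<le> m_sum m c k" using c by (intro m_sum_mono)
    ultimately show ?thesis using x by linarith
  qed
qed

text \<open>The length does not involve \<open>k\<close>: this is the source of the equal
  cardinalities demanded in \<open>bethe_partitions\<close>.\<close>

lemma length_block_positions: 
  assumes "(i, j) \<in> pairs N k"
  shows "length (block_positions m k (i, j)) = m i j - m i (j + 1)"
proof -
  have "1 \<le> i" "i \<le> k" "k \<le> j" using assms by (auto simp: pairs_iff)
  then have "m i j \<le> m i k" "m i (j + 1) \<le> m i j" "m i k \<le> m_sum m i k"
    by (auto intro: upper_antimono le_m_sum)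
  then show ?thesis by (simp add: block_positions_def del: upt_Suc)
qed

end

text \<open>The empty list outside \<open>pairs N k\<close> agrees with the convention in
  \<open>bethe_partitions\<close>; without it the passage back from arrangements would not be
  inverse.\<close>

definition arrangement_of :: "nat \<Rightarrow> (nat \<Rightarrow> nat \<Rightarrow> nat) \<Rightarrow> (nat \<Rightarrow> nat \<Rightarrow> nat) \<Rightarrow> nat \<Rightarrow> nat \<times> nat \<Rightarrow> nat list" where
  "arrangement_of N m \<sigma> k p = (if p \<in> pairs N k then map (\<sigma> k) (block_positions m k p) else [])"

definition partition_of :: "nat \<Rightarrow> (nat \<Rightarrow> nat \<Rightarrow> nat) \<Rightarrow> (nat \<Rightarrow> nat \<Rightarrow> nat) \<Rightarrow> nat \<Rightarrow> nat \<times> nat \<Rightarrow> nat set" where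
  "partition_of N m \<sigma> k p = set (arrangement_of N m \<sigma> k p)"

definition join_blocks :: "nat \<Rightarrow> (nat \<Rightarrow> nat \<times> nat \<Rightarrow> nat list) \<Rightarrow> nat \<Rightarrow> nat list" where
  "join_blocks N L k = concat (map (L k) (pair_list N k))"

text \<open>Block lengths are the differences m i b - m i (b + 1), so the entries are tail sums of
  lengths. They are read on level \<open>i\<close>, the only level on which all blocks (i, b) with b
  >= i occur.\<close>

definition matrix_of :: "nat \<Rightarrow> (nat \<Rightarrow> nat \<times> nat \<Rightarrow> nat list) \<Rightarrow> nat \<Rightarrow> nat \<Rightarrow> nat" where
  "matrix_of N L i j = (if 1 \<le> i \<and> i \<le> j \<and> j < N then \<Sum>b\<in>{j..<N}. length (L i (i, b)) else 0)"

definition permutation_of :: "nat \<Rightarrow> (nat \<Rightarrow> nat) \<Rightarrow> (nat \<Rightarrow> nat \<times> nat \<Rightarrow> nat list) \<Rightarrow> nat \<Rightarrow> nat \<Rightarrow> nat" where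
  "permutation_of N n L k l = (if k \<in> {1..<N} \<and> l \<in> {1..n k} then join_blocks N L k ! (l - 1) else l)"

text \<open>For a Bethe partition, an undefined subset is empty and has \<open>[]\<close> as its
  only ordering, so quantifying over all \<open>k\<close> and \<open>p\<close> adds no
  freedom.\<close>

definition arrangements :: "(nat \<Rightarrow> nat \<times> nat \<Rightarrow> nat set) \<Rightarrow> (nat \<Rightarrow> nat \<times> nat \<Rightarrow> nat list) set" where
  "arrangements P = {L. \<forall>k p. L k p \<in> permutations_of_set (P k p)}"

lemma pairs_range: "p \<in> pairs N k \<Longrightarrow> k \<in> {1..<N}"
  by (cases p) (auto simp: pairs_iff)

lemma sym_groupD:
  assumes "\<sigma> \<in> sym_group N n"
  shows "k \<in> {1..<N} \<Longrightarrow> \<sigma> k permutes {1..n k}" "k \<notin> {1..<N} \<Longrightarrow> \<sigma> k = id"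
  using assms by (auto simp: sym_group_def)

lemma distinct_concat_disjoint:
  "distinct ps \<Longrightarrow> (\<And>p. p \<in> set ps \<Longrightarrow> distinct (f p)) \<Longrightarrow>
   disjoint_family_on (\<lambda>p. set (f p)) (set ps) \<Longrightarrow> distinct (concat (map f ps))"
  by (induction ps) (auto simp: disjoint_family_on_def)

lemma disjoint_of_distinct_concat:
  "distinct ps \<Longrightarrow> distinct (concat (map f ps)) \<Longrightarrow> disjoint_family_on (\<lambda>p. set (f p)) (set ps)"
proof (induction ps)
  case (Cons a ps)
  then have "set (f a) \<inter> set (f p) = {}" if "p \<in> set ps" for p using that by auto
  then show ?case using Cons by (auto simp: disjoint_family_on_def)
qed (simp add: disjoint_family_on_def)

lemma join_blocks_arrangement_of:
  assumes "m \<in> upper_permissible N n" "k \<in> {1..<N}"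
  shows "join_blocks N (arrangement_of N m \<sigma>) k = map (\<sigma> k) [1..<n k + 1]"
proof -
  have e: "map (arrangement_of N m \<sigma> k) (pair_list N k) = map (\<lambda>p. map (\<sigma> k) (block_positions m k p)) (pair_list N k)"
    by (simp add: arrangement_of_def)
  show ?thesis
    using arg_cong[OF concat_block_positions[OF assms], of "map (\<sigma> k)"] unfolding join_blocks_def e
    by (simp add: map_concat o_def del: upt_Suc)
qed

lemma partition_of_bethe:
  assumes m: "m \<in> upper_permissible N n" and \<sigma>: "\<sigma> \<in> sym_group N n"
  shows "partition_of N m \<sigma> \<in> bethe_partitions N n"
    and "arrangement_of N m \<sigma> \<in> arrangements (partition_of N m \<sigma>)"
proof -
  have inj: "inj (\<sigma> k)" for k using sym_groupD[OF \<sigma>, of k] by (cases "k \<in> {1..<N}") (auto simp: permutes_inj)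
  have d: "distinct (arrangement_of N m \<sigma> k p)" for k p
    by (auto simp: arrangement_of_def block_positions_def distinct_map intro: inj_on_subset[OF inj])
  then show "arrangement_of N m \<sigma> \<in> arrangements (partition_of N m \<sigma>)"
    by (simp add: arrangements_def partition_of_def permutations_of_set_def)
  have c: "card (partition_of N m \<sigma> k (i, j)) = m i j - m i (j + 1)" if "(i, j) \<in> pairs N k" for k i j
    unfolding partition_of_def distinct_card[OF d] using that by (simp add: arrangement_of_def length_block_positions[OF m])
  have U: "(\<Union>p\<in>pairs N k. partition_of N m \<sigma> k p) = {1..n k}" if k: "k \<in> {1..<N}" for k
  proof -
    have "(\<Union>p\<in>pairs N k. partition_of N m \<sigma> k p) = set (join_blocks N (arrangement_of N m \<sigma>) k)" by (simp add: join_blocks_def partition_of_def)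
    also have "\<dots> = \<sigma> k ` {1..n k}"
      unfolding join_blocks_arrangement_of[OF m k] by (simp add: atLeastLessThanSuc_atLeastAtMost del: upt_Suc)
    finally show ?thesis using sym_groupD(1)[OF \<sigma> k] by (simp add: permutes_image)
  qed
  have D: "disjoint_family_on (partition_of N m \<sigma> k) (pairs N k)" if k: "k \<in> {1..<N}" for k
  proof -
    have "distinct (join_blocks N (arrangement_of N m \<sigma>) k)"
      unfolding join_blocks_arrangement_of[OF m k] by (auto simp: distinct_map intro: inj_on_subset[OF inj])
    then show ?thesis
      unfolding join_blocks_def partition_of_def by (rule disjoint_of_distinct_concat[OF distinct_pair_list])
  qed
  show "partition_of N m \<sigma> \<in> bethe_partitions N n"
    unfolding bethe_partitions_def mem_Collect_eq
  proof (intro conjI allI impI ballI)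
    fix i j k k' assume "1 \<le> i \<and> i \<le> j \<and> j < N" "k \<in> {i..j}" "k' \<in> {i..j}"
    then show "card (partition_of N m \<sigma> k (i, j)) = card (partition_of N m \<sigma> k' (i, j))"
      by (subst (1 2) c) (auto simp: pairs_iff)
  qed (simp add: partition_of_def arrangement_of_def, erule U, erule D)
qed

lemma matrix_of_arrangement_of:
  assumes m: "m \<in> upper_permissible N n"
  shows "matrix_of N (arrangement_of N m \<sigma>) = m"
proof (intro ext)
  fix i j
  show "matrix_of N (arrangement_of N m \<sigma>) i j = m i j"
  proof (cases "1 \<le> i \<and> i \<le> j \<and> j < N")
    case True
    have "(\<Sum>b\<in>{j..<N}. length (arrangement_of N m \<sigma> i (i, b))) = (\<Sum>b\<in>{j..<N}. m i b - m i (Suc b))"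
      using True by (intro sum.cong refl) (simp add: arrangement_of_def pairs_iff length_block_positions[OF m])
    moreover have "(\<Sum>b\<in>{j..<c}. m i b - m i (Suc b)) = m i j - m i c" if "j \<le> c" for c
      using that
    proof (induction c rule: dec_induct)
      case (step c)
      then have "m i c \<le> m i j" "m i (Suc c) \<le> m i c" using True by (auto intro: upper_antimono[OF m])
      then show ?case using step by simp
    qed simp
    from this[of N] have "(\<Sum>b\<in>{j..<N}. m i b - m i (Suc b)) = m i j - m i N" using True by simp
    ultimately show ?thesis using True by (simp add: matrix_of_def upper_outside[OF m])
  next
    case False
    then show ?thesis unfolding matrix_of_def using upper_outside[OF m, of i j] by auto
  qed
qed

lemma permutation_of_arrangement_of:
  assumes m: "m \<in> upper_permissible N n" and \<sigma>: "\<sigma> \<in> sym_group N n"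
  shows "permutation_of N n (arrangement_of N m \<sigma>) = \<sigma>"
proof (intro ext)
  fix k l
  show "permutation_of N n (arrangement_of N m \<sigma>) k l = \<sigma> k l"
  proof (cases "k \<in> {1..<N} \<and> l \<in> {1..n k}")
    case True
    then have "permutation_of N n (arrangement_of N m \<sigma>) k l = map (\<sigma> k) [1..<n k + 1] ! (l - 1)"
      unfolding permutation_of_def using join_blocks_arrangement_of[OF m, of k \<sigma>] by simp
    moreover have "l - 1 < n k" "1 + (l - 1) = l" using True by auto
    ultimately show ?thesis by (simp del: upt_Suc)
  next
    case False
    then have "permutation_of N n (arrangement_of N m \<sigma>) k l = l" unfolding permutation_of_def by auto
    also have "l = \<sigma> k l"
      using False sym_groupD[OF \<sigma>, of k] by (cases "k \<in> {1..<N}") (auto simp: permutes_def)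
    finally show ?thesis .
  qed
qed

lemma bethe_partitionsD:
  assumes "P \<in> bethe_partitions N n"
  shows "p \<notin> pairs N k \<Longrightarrow> P k p = {}"
    and "k \<in> {1..<N} \<Longrightarrow> (\<Union>p\<in>pairs N k. P k p) = {1..n k}"
    and "k \<in> {1..<N} \<Longrightarrow> disjoint_family_on (P k) (pairs N k)"
    and "(i, j) \<in> pairs N k \<Longrightarrow> (i, j) \<in> pairs N k' \<Longrightarrow> card (P k (i, j)) = card (P k' (i, j))"
proof -
  note D = assms[unfolded bethe_partitions_def mem_Collect_eq]
  show "p \<notin> pairs N k \<Longrightarrow> P k p = {}" using D[THEN conjunct1] by blast
  show "k \<in> {1..<N} \<Longrightarrow> (\<Union>p\<in>pairs N k. P k p) = {1..n k}"
    and "k \<in> {1..<N} \<Longrightarrow> disjoint_family_on (P k) (pairs N k)"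
    using D[THEN conjunct2, THEN conjunct1] by (blast dest: bspec)+
  show "(i, j) \<in> pairs N k \<Longrightarrow> (i, j) \<in> pairs N k' \<Longrightarrow> card (P k (i, j)) = card (P k' (i, j))"
    using D[THEN conjunct2, THEN conjunct2, rule_format, of i j k k'] by (simp add: pairs_iff)
qed

context
  fixes N n P L
  assumes P: "P \<in> bethe_partitions N n" and L: "L \<in> arrangements P"
begin

lemma arrangements_set: "set (L k p) = P k p" "distinct (L k p)"
  using L by (simp_all add: arrangements_def permutations_of_set_def del: split_paired_All)

lemma arrangements_length:
  assumes "(i, j) \<in> pairs N k" "(i, j) \<in> pairs N k'"
  shows "length (L k (i, j)) = length (L k' (i, j))"
  using bethe_partitionsD(4)[OF P assms] distinct_card[OF arrangements_set(2)] by (simp add: arrangements_set)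

lemma join_blocks_props:
  assumes k: "k \<in> {1..<N}"
  shows "distinct (join_blocks N L k)" "set (join_blocks N L k) = {1..n k}" "length (join_blocks N L k) = n k"
proof -
  show d: "distinct (join_blocks N L k)"
    unfolding join_blocks_def
    by (rule distinct_concat_disjoint[OF distinct_pair_list])
      (simp_all add: arrangements_set bethe_partitionsD(3)[OF P k])
  show s: "set (join_blocks N L k) = {1..n k}"
    using bethe_partitionsD(2)[OF P k] by (simp add: join_blocks_def arrangements_set)
  show "length (join_blocks N L k) = n k" using distinct_card[OF d] s by simp
qed

text \<open>The sum condition on level i counts the block (a, b) there, whereas
  \<open>matrix_of\<close> reads it on level a. Here the equal cardinalities of the partition
  enter.\<close>

lemma matrix_of_upper: "matrix_of N L \<in> upper_permissible N n"
  unfolding upper_permissible_def mem_Collect_eq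
proof (intro conjI ballI allI impI)
  fix i j assume "i \<in> {1..<N}" "j \<in> {i..<N}"
  then show "matrix_of N L i (j + 1) \<le> matrix_of N L i j"
    by (auto simp: matrix_of_def intro!: sum_mono2)
next
  fix i assume i: "i \<in> {1..<N}"
  have "n i = (\<Sum>p\<leftarrow>pair_list N i. length (L i p))"
    using join_blocks_props(3)[OF i] by (simp add: join_blocks_def length_concat o_def)
  also have "\<dots> = (\<Sum>p\<in>pairs N i. length (L i p))"
    using distinct_pair_list by (simp add: sum_list_distinct_conv_sum_set)
  also have "\<dots> = (\<Sum>(a, b)\<in>{1..i} \<times> {i..<N}. length (L i (a, b)))"
    by (rule sum.cong) (auto simp: pairs_iff)
  also have "\<dots> = (\<Sum>a\<in>{1..i}. \<Sum>b\<in>{i..<N}. length (L i (a, b)))" by (simp add: sum.cartesian_product)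
  also have "\<dots> = (\<Sum>a\<in>{1..i}. matrix_of N L a i)"
  proof (rule sum.cong[OF refl])
    fix a assume a: "a \<in> {1..i}"
    have "(\<Sum>b\<in>{i..<N}. length (L i (a, b))) = (\<Sum>b\<in>{i..<N}. length (L a (a, b)))"
      using a i by (intro sum.cong arrangements_length) (auto simp: pairs_iff)
    then show "(\<Sum>b\<in>{i..<N}. length (L i (a, b))) = matrix_of N L a i"
      using a i by (simp add: matrix_of_def)
  qed
  finally show "n i = (\<Sum>a\<in>{1..i}. matrix_of N L a i)" .
qed (auto simp: matrix_of_def)

lemma permutation_of_sym: "permutation_of N n L \<in> sym_group N n"
  unfolding sym_group_def mem_Collect_eq
proof (intro conjI ballI allI impI)
  fix k assume k: "k \<in> {1..<N}"
  have "inj_on (permutation_of N n L k) {1..n k}"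
    using join_blocks_props[OF k] k by (auto simp: inj_on_def permutation_of_def nth_eq_iff_index_eq)
  moreover have "permutation_of N n L k ` {1..n k} \<subseteq> {1..n k}"
  proof
    fix x assume "x \<in> permutation_of N n L k ` {1..n k}"
    then obtain l where l: "l \<in> {1..n k}" "x = join_blocks N L k ! (l - 1)" using k by (auto simp: permutation_of_def)
    moreover from l have "l - 1 < n k" by auto
    ultimately have "x \<in> set (join_blocks N L k)" using join_blocks_props(3)[OF k] by simp
    then show "x \<in> {1..n k}" using join_blocks_props[OF k] by simp
  qed
  ultimately have "bij_betw (permutation_of N n L k) {1..n k} {1..n k}"
    by (simp add: bij_betw_def endo_inj_surj)
  then show "permutation_of N n L k permutes {1..n k}"
    by (rule bij_imp_permutes) (auto simp: permutation_of_def)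
qed (auto simp: permutation_of_def fun_eq_iff)

text \<open>Both families have the same concatenation on each level and the same block lengths,
  which forces the blocks to agree.\<close>

lemma arrangement_of_inverse: "arrangement_of N (matrix_of N L) (permutation_of N n L) = L"
proof (intro ext)
  fix k p
  show "arrangement_of N (matrix_of N L) (permutation_of N n L) k p = L k p"
  proof (cases "p \<in> pairs N k")
    case True
    define A where "A = arrangement_of N (matrix_of N L) (permutation_of N n L)"
    have k: "k \<in> {1..<N}" using True by (rule pairs_range)
    have len: "length (A k p) = length (L k p)" if "p \<in> pairs N k" for p
    proof -
      obtain i j where p: "p = (i, j)" by (cases p)
      have ij: "1 \<le> i" "i \<le> k" "k \<le> j" "j < N" using that by (auto simp: p pairs_iff)
      have "length (A k p) = matrix_of N L i j - matrix_of N L i (j + 1)"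
        using that by (simp add: A_def p arrangement_of_def length_block_positions[OF matrix_of_upper])
      also have "matrix_of N L i j = length (L i (i, j)) + matrix_of N L i (j + 1)"
        using ij by (auto simp: matrix_of_def sum.atLeast_Suc_lessThan)
      finally show ?thesis using arrangements_length[of i j k i] ij by (simp add: p pairs_iff)
    qed
    have "concat (map (A k) (pair_list N k)) = map (permutation_of N n L k) [1..<n k + 1]"
      using join_blocks_arrangement_of[OF matrix_of_upper k] by (simp add: join_blocks_def A_def)
    also have "\<dots> = join_blocks N L k"
      using join_blocks_props(3)[OF k] k by (intro nth_equalityI) (auto simp: permutation_of_def simp del: upt_Suc)
    finally have "concat (map (A k) (pair_list N k)) = concat (map (L k) (pair_list N k))" by (simp add: join_blocks_def)
    then have "map (A k) (pair_list N k) = map (L k) (pair_list N k)"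
      by (rule concat_injective) (auto simp: set_zip len)
    then show ?thesis using True by (simp add: A_def)
  next
    case False
    then have "set (L k p) = {}" by (simp add: arrangements_set bethe_partitionsD(1)[OF P])
    then show ?thesis using False by (simp add: arrangement_of_def)
  qed
qed

end

text \<open>Replaces a sum over a fibre of \<open>partition_of\<close> by one in which the orderings
  of the different subsets are chosen independently of each other.\<close>

lemma sum_fiber:
  assumes P: "P \<in> bethe_partitions N n"
  shows "(\<Sum>(m, \<sigma>) | m \<in> upper_permissible N n \<and> \<sigma> \<in> sym_group N n \<and> partition_of N m \<sigma> = P. F (arrangement_of N m \<sigma>))
    = (\<Sum>L\<in>arrangements P. F L)"
proof (rule sum.reindex_bij_witness[of _ "\<lambda>L. (matrix_of N L, permutation_of N n L)" "\<lambda>(m, \<sigma>). arrangement_of N m \<sigma>"])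
  fix L assume L: "L \<in> arrangements P"
  show "(matrix_of N L, permutation_of N n L) \<in> {(m, \<sigma>). m \<in> upper_permissible N n \<and> \<sigma> \<in> sym_group N n \<and> partition_of N m \<sigma> = P}"
    using matrix_of_upper[OF P L] permutation_of_sym[OF P L] arrangement_of_inverse[OF P L] arrangements_set[OF P L]
    by (auto simp: partition_of_def fun_eq_iff)
qed (auto simp: matrix_of_arrangement_of permutation_of_arrangement_of arrangement_of_inverse[OF P] partition_of_bethe)

section \<open>The coefficient as a product of factors between blocks and weights of single
  blocks\<close>

section \<open>Factorization of the coefficients\<close>

lemma ff_prod_append_left: "ff_prod q (xs @ ys) zs = ff_prod q xs zs * ff_prod q ys zs"
  by (simp add: ff_prod_def)

lemma ff_prod_Cons_right: "ff_prod q xs (y # ys) = (\<Prod>x\<leftarrow>xs. ff q x y) * ff_prod q xs ys"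
  by (induction xs) (simp_all add: ff_prod_def mult_ac)

lemma ff_prod_Nil_right: "ff_prod q xs [] = 1"
  by (induction xs) (simp_all add: ff_prod_def)

lemma ff_prod_map:
  "distinct xs \<Longrightarrow> distinct ys \<Longrightarrow>
    ff_prod q (map f xs) (map g ys) = (\<Prod>x\<in>set xs. \<Prod>y\<in>set ys. ff q (f x) (g y))"
  by (simp add: ff_prod_def o_def prod_list_distinct)

lemma ff_prod_concat_left:
  "distinct ps \<Longrightarrow> ff_prod q (concat (map B ps)) ys = (\<Prod>p\<in>set ps. ff_prod q (B p) ys)"
  by (induction ps) (auto simp: ff_prod_append_left, simp add: ff_prod_def)

lemma desc_prod_append: "desc_prod q (xs @ ys) = desc_prod q xs * desc_prod q ys * ff_prod q ys xs"
  by (induction xs) (simp_all add: ff_prod_Nil_right ff_prod_Cons_right mult_ac)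

lemma desc_prod_upt:
  "a \<le> b \<Longrightarrow> desc_prod q (map \<tau> [a + 1..<b + 1]) = (\<Prod>l\<in>{a<..b}. \<Prod>l'\<in>{a<..<l}. ff q (\<tau> l) (\<tau> l'))"
proof (induction b rule: dec_induct)
  case (step b)
  have "{a<..Suc b} = insert (Suc b) {a<..b}" using step by auto
  moreover have "[a + 1..<Suc b + 1] = [a + 1..<b + 1] @ [Suc b]" using step by simp
  moreover have "ff_prod q [\<tau> (Suc b)] (map \<tau> [a + 1..<b + 1]) = (\<Prod>l'\<in>{a<..<Suc b}. ff q (\<tau> (Suc b)) (\<tau> l'))"
    by (simp add: ff_prod_def o_def prod_list_distinct atLeastSucLessThan_greaterThanLessThan del: upt_Suc)
  ultimately show ?case using step by (simp add: desc_prod_append mult_ac del: upt_Suc)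
qed simp

text \<open>In a list sorted by \<open>\<prec>\<close> the head precedes all later blocks and none
  precedes it, so each pair of different blocks is met once, with the later block as first argument
  of \<open>ff_prod\<close>.\<close>

lemma desc_prod_concat:
  "sorted_wrt (\<prec>) ps \<Longrightarrow> desc_prod q (concat (map B ps)) =
    (\<Prod>(p, p') | p \<in> set ps \<and> p' \<in> set ps \<and> p \<prec> p'. ff_prod q (B p') (B p)) * (\<Prod>p\<in>set ps. desc_prod q (B p))"
proof (induction ps)
  case (Cons a ps)
  have a: "a \<prec> p" if "p \<in> set ps" for p using Cons.prems that by simp
  have irr: "\<not> p \<prec> p" for p by (auto simp: prec_def)
  have asym: "p \<prec> p' \<Longrightarrow> \<not> p' \<prec> p" for p p' by (auto simp: prec_def)
  have an: "a \<notin> set ps" using a irr by blast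
  have "distinct ps" if "sorted_wrt (\<prec>) ps" for ps
    using that irr by (induction ps) auto
  then have d: "distinct ps" using Cons.prems by simp
  have "{(p, p'). p \<in> set (a # ps) \<and> p' \<in> set (a # ps) \<and> p \<prec> p'}
     = Pair a ` set ps \<union> {(p, p'). p \<in> set ps \<and> p' \<in> set ps \<and> p \<prec> p'}"
    using a irr asym by auto
  moreover have "finite {(p, p'). p \<in> set ps \<and> p' \<in> set ps \<and> p \<prec> p'}"
    by (rule finite_subset[of _ "set ps \<times> set ps"]) auto
  moreover have "Pair a ` set ps \<inter> {(p, p'). p \<in> set ps \<and> p' \<in> set ps \<and> p \<prec> p'} = {}"
    using an by auto
  ultimately have "(\<Prod>(p, p') | p \<in> set (a # ps) \<and> p' \<in> set (a # ps) \<and> p \<prec> p'. ff_prod q (B p') (B p))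
    = (\<Prod>p'\<in>set ps. ff_prod q (B p') (B a)) * (\<Prod>(p, p') | p \<in> set ps \<and> p' \<in> set ps \<and> p \<prec> p'. ff_prod q (B p') (B p))"
    by (simp add: prod.union_disjoint prod.reindex inj_on_def)
  moreover have "ff_prod q (concat (map B ps)) (B a) = (\<Prod>p'\<in>set ps. ff_prod q (B p') (B a))"
    by (rule ff_prod_concat_left[OF d])
  ultimately show ?case using Cons an by (simp add: desc_prod_append mult_ac)
qed simp

lemma chain_prod_upt:
  "chain_prod q (map f [u..<u + r]) (map g [v..<v + r]) =
    (\<Prod>c<r. gl q (f (u + c)) (g (v + c)) * (\<Prod>l\<in>{v + c + 1..<v + r}. ff q (f (u + c)) (g l)))"
proof (induction r arbitrary: u v)
  case (Suc r)
  have 1: "[u..<u + Suc r] = u # [Suc u..<Suc u + r]" "[v..<v + Suc r] = v # [Suc v..<Suc v + r]"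
    by (simp_all add: upt_rec)
  show ?case
    unfolding 1 prod.lessThan_Suc_shift using Suc[of "Suc u" "Suc v"]
    by (simp add: prod_list_distinct o_def del: upt_Suc)
qed simp

lemma ff_nonzero: "u \<noteq> v \<Longrightarrow> q\<^sup>2 * u \<noteq> v \<Longrightarrow> q \<noteq> 0 \<Longrightarrow> ff q u v \<noteq> 0"
  by (auto simp: ff_def field_simps power2_eq_square)

lemma desc_prod_nonzero:
  assumes "q \<noteq> 0"
  shows "distinct xs \<Longrightarrow> (\<And>x y. x \<in> set xs \<Longrightarrow> y \<in> set xs \<Longrightarrow> x \<noteq> y \<Longrightarrow> q\<^sup>2 * x \<noteq> y) \<Longrightarrow> desc_prod q xs \<noteq> 0"
proof (induction xs)
  case (Cons x xs)
  have "ff q y x \<noteq> 0" if y: "y \<in> set xs" for y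
  proof (rule ff_nonzero)
    show "y \<noteq> x" using y Cons.prems(1) by auto
    then show "q\<^sup>2 * y \<noteq> x" using y by (intro Cons.prems(2)) auto
  qed (rule assms)
  then show ?case using Cons by (auto simp: prod_list_zero_iff)
qed simp

text \<open>Meant for g = m a: it cuts the range of offsets in \<open>pre_bethe\<close> at the
  numbers m a b, that is, into the blocks (a, b).\<close>

lemma prod_interval_split:
  fixes g :: "nat \<Rightarrow> nat"
  assumes "k \<le> c" "\<And>b. k \<le> b \<Longrightarrow> b < c \<Longrightarrow> g (Suc b) \<le> g b"
  shows "(\<Prod>l\<in>{g c..<g k}. F l) = (\<Prod>b\<in>{k..<c}. \<Prod>l\<in>{g (Suc b)..<g b}. F l)"
  using assms
proof (induction c rule: dec_induct)
  case (step c)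
  have anti: "g (Suc b) \<le> g b" if "k \<le> b" "b \<le> c" for b
    using that by (intro step.prems) auto
  have "g b \<le> g k" if "k \<le> b" "b \<le> c" for b
    using that
  proof (induction b rule: dec_induct)
    case (step d)
    then have "g (Suc d) \<le> g d" "g d \<le> g k" using anti[of d] by simp_all
    then show ?case by simp
  qed simp
  then have "g c \<le> g k" using step.hyps by simp
  then have "(\<Prod>l\<in>{g (Suc c)..<g k}. F l) = (\<Prod>l\<in>{g (Suc c)..<g c}. F l) * (\<Prod>l\<in>{g c..<g k}. F l)"
    using step.prems[of c] step.hyps by (intro prod.atLeastLessThan_concat[symmetric]) auto
  then show ?case using step by (simp add: mult.commute)
qed simp

definition upper_coeff ::
  "nat \<Rightarrow> complex \<Rightarrow> (nat \<Rightarrow> nat) \<Rightarrow> (nat \<Rightarrow> nat \<Rightarrow> nat) \<Rightarrow> (nat \<Rightarrow> nat \<Rightarrow> complex) \<Rightarrow> complex" where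
  "upper_coeff N q n m t = beta N q n t
       * (\<Prod>j\<in>{1..<N}. \<Prod>i\<in>{j..<N}.
            1 / fact (m j i - m j (i + 1))
            * (\<Prod>l\<in>{n j - m j i <.. n j - m j (i + 1)}. \<Prod>l'\<in>{n j - m j i <..< l}.
                 inverse (ff q (t j l) (t j l'))))
       * (\<Prod>i\<in>{2..<N}. \<Prod>j\<in>{1..<i}. \<Prod>l\<in>{0..<m j i}.
            gl q (t i (m_sum m j i - l)) (t (i - 1) (m_sum m j (i - 1) - l))
            * (\<Prod>l'\<in>{m_sum m j (i - 1) - l + 1 .. n (i - 1)}.
                 ff q (t i (m_sum m j i - l)) (t (i - 1) l')))"

text \<open>The factors of the coefficient between different blocks. They see each block only as a
  set.\<close>

definition level_coeff :: "nat \<Rightarrow> complex \<Rightarrow> (nat \<Rightarrow> nat \<times> nat \<Rightarrow> complex list) \<Rightarrow> complex" where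
  "level_coeff N q B = (\<Prod>k\<in>{1..<N}. \<Prod>(p, p') | p \<in> pairs N k \<and> p' \<in> pairs N k \<and> p \<prec> p'.
                ff_prod q (B k p') (B k p))
     * (\<Prod>k\<in>{2..<N}. \<Prod>(p, p') | p \<in> pairs N k \<and> p' \<in> pairs N (k - 1) \<and> p \<prec> p'.
                   ff_prod q (B k p) (B (k - 1) p'))"

text \<open>A block (i, j) starts on level i. On that level the products of inverses of
  \<open>ff\<close> in \<open>pre_bethe\<close> cancel its \<open>desc_prod\<close> and the
  factorial is left; on the levels above, \<open>desc_prod\<close> survives and the link to the
  level below is added.\<close>

definition block_weight :: "complex \<Rightarrow> nat \<Rightarrow> nat \<times> nat \<Rightarrow> complex list \<Rightarrow> complex list \<Rightarrow> complex" where
  "block_weight q k p xs ys =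
    (if fst p < k then desc_prod q xs * chain_prod q xs ys else 1 / fact (length xs))"

lemma prod_pairs: "(\<Prod>p\<in>pairs N k. F p) = (\<Prod>a\<in>{1..k}. \<Prod>b\<in>{k..<N}. F (a, b))"
proof -
  have "pairs N k = {1..k} \<times> {k..<N}" by (auto simp: pairs_iff)
  then show ?thesis by (simp add: prod.cartesian_product)
qed

lemma prod_pairs_split: "1 \<le> k \<Longrightarrow> (\<Prod>p\<in>pairs N k. F p) = (\<Prod>a\<in>{1..<k}. \<Prod>b\<in>{k..<N}. F (a, b)) * (\<Prod>b\<in>{k..<N}. F (k, b))"
proof -
  assume "1 \<le> k"
  then have "{1..k} = insert k {1..<k}" by auto
  then show ?thesis unfolding prod_pairs by (simp add: mult.commute)
qed

lemma prod_pairs2: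
  "(\<Prod>(p, p') | p \<in> pairs N k \<and> p' \<in> pairs N k' \<and> Q p p'. F p p')
   = (\<Prod>p\<in>pairs N k. \<Prod>p' | p' \<in> pairs N k' \<and> Q p p'. F p p')"
proof -
  have "{(p, p'). p \<in> pairs N k \<and> p' \<in> pairs N k' \<and> Q p p'} = (SIGMA p:pairs N k. {p'. p' \<in> pairs N k' \<and> Q p p'})"
    by auto
  then show ?thesis by (subst prod.Sigma) simp_all
qed

definition block_params ::
  "(nat \<Rightarrow> nat \<Rightarrow> nat) \<Rightarrow> (nat \<Rightarrow> nat \<Rightarrow> complex) \<Rightarrow> nat \<Rightarrow> nat \<times> nat \<Rightarrow> complex list" where
  "block_params m \<tau> k p = map (\<tau> k) (block_positions m k p)"

context
  fixes N n m and q :: complex and \<tau> :: "nat \<Rightarrow> nat \<Rightarrow> complex"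
  assumes m: "m \<in> upper_permissible N n"
begin

text \<open>In \<open>pre_bethe\<close> the product of \<open>ff\<close> over the lower level runs
  to the end of that level. The rest of the own block goes into \<open>chain_prod\<close>, the later
  blocks into \<open>level_coeff\<close>.\<close>

lemma prod_above_block:
  assumes k: "k \<in> {1..<N}" and p: "p \<in> pairs N k" and x: "x \<in> set (block_positions m k p)"
  shows "(\<Prod>l\<in>{x + 1..n k}. F l) = (\<Prod>l | l \<in> set (block_positions m k p) \<and> x < l. F l) *
    (\<Prod>p' | p' \<in> pairs N k \<and> p \<prec> p'. \<Prod>l\<in>set (block_positions m k p'). F l)"
proof -
  have disj: "set (block_positions m k i) \<inter> set (block_positions m k j) = {}" if "i \<in> pairs N k" "j \<in> pairs N k" "i \<prec> j" for i j
  proof (rule equals0I)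
    fix l assume "l \<in> set (block_positions m k i) \<inter> set (block_positions m k j)"
    then have "l < l" using block_positions_less[OF m k that] by (elim IntE)
    then show False by simp
  qed
  let ?U = "\<Union>p'\<in>{p'. p' \<in> pairs N k \<and> p \<prec> p'}. set (block_positions m k p')"
  have irr: "\<not> p \<prec> p" by (auto simp: prec_def)
  have "{x + 1..n k} = {l. l \<in> set (block_positions m k p) \<and> x < l} \<union> ?U"
  proof (intro equalityI subsetI)
    fix l assume l: "l \<in> {x + 1..n k}"
    then have "l \<in> (\<Union>p\<in>pairs N k. set (block_positions m k p))" unfolding block_positions_union[OF m k] by simp
    then obtain p' where p': "p' \<in> pairs N k" "l \<in> set (block_positions m k p')" by blast
    have "\<not> p' \<prec> p" using block_positions_less[OF m k p'(1) p _ p'(2) x] l by auto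
    then consider "p' = p" | "p \<prec> p'" using prec_total[of p p'] by blast
    then show "l \<in> {l. l \<in> set (block_positions m k p) \<and> x < l} \<union> ?U"
    proof cases
      case 1
      then show ?thesis using p' l by simp
    next
      case 2
      then show ?thesis using p' by blast
    qed
  next
    fix l assume "l \<in> {l. l \<in> set (block_positions m k p) \<and> x < l} \<union> ?U"
    then consider "l \<in> set (block_positions m k p)" "x < l" | p' where "p' \<in> pairs N k" "p \<prec> p'" "l \<in> set (block_positions m k p')"
      by blast
    then obtain p' where p': "p' \<in> pairs N k" "l \<in> set (block_positions m k p')" "x < l"
      by cases (use p block_positions_less[OF m k p _ _ x] in blast)+
    then have "l \<in> {1..n k}" unfolding block_positions_union[OF m k, symmetric] by blast
    then show "l \<in> {x + 1..n k}" using p' by auto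
  qed
  moreover have "{l. l \<in> set (block_positions m k p) \<and> x < l} \<inter> ?U = {}"
    using disj[OF p] by blast
  moreover have "(\<Prod>l\<in>?U. F l) = (\<Prod>p' | p' \<in> pairs N k \<and> p \<prec> p'. \<Prod>l\<in>set (block_positions m k p'). F l)"
  proof (rule prod.UNION_disjoint)
    show "\<forall>i\<in>{p' \<in> pairs N k. p \<prec> p'}. \<forall>j\<in>{p' \<in> pairs N k. p \<prec> p'}. i \<noteq> j \<longrightarrow> set (block_positions m k i) \<inter> set (block_positions m k j) = {}"
    proof (intro ballI impI)
      fix i j assume "i \<in> {p' \<in> pairs N k. p \<prec> p'}" "j \<in> {p' \<in> pairs N k. p \<prec> p'}" "i \<noteq> j"
      then show "set (block_positions m k i) \<inter> set (block_positions m k j) = {}"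
        using prec_total[of i j] disj[of i j] disj[of j i] by blast
    qed
  qed auto
  ultimately show ?thesis by (simp add: prod.union_disjoint)
qed

lemma block_chain:
  assumes k: "k \<in> {2..<N}" and a: "a \<in> {1..<k}" and b: "b \<in> {k..<N}"
  shows "(\<Prod>l\<in>{m a (Suc b)..<m a b}. gl q (\<tau> k (m_sum m a k - l)) (\<tau> (k - 1) (m_sum m a (k - 1) - l))
            * (\<Prod>l'\<in>{m_sum m a (k - 1) - l + 1 .. n (k - 1)}. ff q (\<tau> k (m_sum m a k - l)) (\<tau> (k - 1) l')))
    = chain_prod q (block_params m \<tau> k (a, b)) (block_params m \<tau> (k - 1) (a, b)) *
      (\<Prod>p' | p' \<in> pairs N (k - 1) \<and> (a, b) \<prec> p'. ff_prod q (block_params m \<tau> k (a, b)) (block_params m \<tau> (k - 1) p'))"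
proof -
  define r where "r = m a b - m a (Suc b)"
  define u where "u = m_sum m a k - m a b + 1"
  define v where "v = m_sum m a (k - 1) - m a b + 1"
  have k1: "k - 1 \<in> {1..<N}" using k by auto
  have p1: "(a, b) \<in> pairs N (k - 1)" using k a b by (auto simp: pairs_iff)
  have le: "m a (Suc b) \<le> m a b" "m a b \<le> m a k" "m a b \<le> m a (k - 1)"
    using a b by (auto intro!: upper_antimono[OF m])
  have le2: "m a k \<le> m_sum m a k" "m a (k - 1) \<le> m_sum m a (k - 1)" using a by (auto intro: le_m_sum)
  have bk: "block_positions m k (a, b) = [u..<u + r]" "block_positions m (k - 1) (a, b) = [v..<v + r]"
    using le le2 by (simp_all add: block_positions_def u_def v_def r_def)
  have "(\<Prod>l\<in>{m a (Suc b)..<m a b}. gl q (\<tau> k (m_sum m a k - l)) (\<tau> (k - 1) (m_sum m a (k - 1) - l))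
            * (\<Prod>l'\<in>{m_sum m a (k - 1) - l + 1 .. n (k - 1)}. ff q (\<tau> k (m_sum m a k - l)) (\<tau> (k - 1) l')))
    = (\<Prod>c<r. gl q (\<tau> k (u + c)) (\<tau> (k - 1) (v + c)) * (\<Prod>l'\<in>{v + c + 1..n (k - 1)}. ff q (\<tau> k (u + c)) (\<tau> (k - 1) l')))"
    (is "?l = _")
  \<comment> \<open>\<open>l\<close> counts back from the end of the group, \<open>c\<close> forward
    from the start of the block. The first element of the block has \<open>l = m a b - 1\<close>, on
    both levels alike.\<close>
  proof (rule prod.reindex_bij_witness[of _ "\<lambda>c. m a b - 1 - c" "\<lambda>l. m a b - 1 - l"])
    fix l assume l: "l \<in> {m a (Suc b)..<m a b}"
    then have "u + (m a b - 1 - l) = m_sum m a k - l" "v + (m a b - 1 - l) = m_sum m a (k - 1) - l"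
      using le le2 by (auto simp: u_def v_def)
    then show "gl q (\<tau> k (u + (m a b - 1 - l))) (\<tau> (k - 1) (v + (m a b - 1 - l))) *
      (\<Prod>l'\<in>{v + (m a b - 1 - l) + 1..n (k - 1)}. ff q (\<tau> k (u + (m a b - 1 - l))) (\<tau> (k - 1) l')) =
      gl q (\<tau> k (m_sum m a k - l)) (\<tau> (k - 1) (m_sum m a (k - 1) - l))
            * (\<Prod>l'\<in>{m_sum m a (k - 1) - l + 1 .. n (k - 1)}. ff q (\<tau> k (m_sum m a k - l)) (\<tau> (k - 1) l'))"
      by simp
  qed (use le in \<open>auto simp: r_def\<close>)
  also have "\<dots> = (\<Prod>c<r. gl q (\<tau> k (u + c)) (\<tau> (k - 1) (v + c)) * (\<Prod>l'\<in>{v + c + 1..<v + r}. ff q (\<tau> k (u + c)) (\<tau> (k - 1) l'))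
       * (\<Prod>p' | p' \<in> pairs N (k - 1) \<and> (a, b) \<prec> p'. \<Prod>l'\<in>set (block_positions m (k - 1) p'). ff q (\<tau> k (u + c)) (\<tau> (k - 1) l')))"
  proof (rule prod.cong[OF refl])
    fix c assume c: "c \<in> {..<r}"
    have x: "v + c \<in> set (block_positions m (k - 1) (a, b))" unfolding bk using c by simp
    have "{l. l \<in> set (block_positions m (k - 1) (a, b)) \<and> v + c < l} = {v + c + 1..<v + r}"
      unfolding bk by auto
    then show "gl q (\<tau> k (u + c)) (\<tau> (k - 1) (v + c)) * (\<Prod>l'\<in>{v + c + 1..n (k - 1)}. ff q (\<tau> k (u + c)) (\<tau> (k - 1) l'))
      = gl q (\<tau> k (u + c)) (\<tau> (k - 1) (v + c)) * (\<Prod>l'\<in>{v + c + 1..<v + r}. ff q (\<tau> k (u + c)) (\<tau> (k - 1) l'))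
       * (\<Prod>p' | p' \<in> pairs N (k - 1) \<and> (a, b) \<prec> p'. \<Prod>l'\<in>set (block_positions m (k - 1) p'). ff q (\<tau> k (u + c)) (\<tau> (k - 1) l'))"
      unfolding prod_above_block[OF k1 p1 x] by simp
  qed
  also have "\<dots> = chain_prod q (block_params m \<tau> k (a, b)) (block_params m \<tau> (k - 1) (a, b)) * 
     (\<Prod>p' | p' \<in> pairs N (k - 1) \<and> (a, b) \<prec> p'. \<Prod>c<r. \<Prod>l'\<in>set (block_positions m (k - 1) p'). ff q (\<tau> k (u + c)) (\<tau> (k - 1) l'))"
    unfolding prod.distrib block_params_def bk chain_prod_upt by (subst prod.swap) simp
  also have "(\<Prod>p' | p' \<in> pairs N (k - 1) \<and> (a, b) \<prec> p'. \<Prod>c<r. \<Prod>l'\<in>set (block_positions m (k - 1) p'). ff q (\<tau> k (u + c)) (\<tau> (k - 1) l'))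
    = (\<Prod>p' | p' \<in> pairs N (k - 1) \<and> (a, b) \<prec> p'. ff_prod q (block_params m \<tau> k (a, b)) (block_params m \<tau> (k - 1) p'))"
  proof (rule prod.cong[OF refl])
    fix p'
    have d: "distinct (block_positions m (k - 1) p')" by (simp add: block_positions_def)
    have "(\<Prod>c<r. \<Prod>l'\<in>set (block_positions m (k - 1) p'). ff q (\<tau> k (u + c)) (\<tau> (k - 1) l'))
      = (\<Prod>l\<in>{u..<u + r}. \<Prod>l'\<in>set (block_positions m (k - 1) p'). ff q (\<tau> k l) (\<tau> (k - 1) l'))"
      by (rule prod.reindex_bij_witness[of _ "\<lambda>l. l - u" "\<lambda>c. u + c"]) auto
    then show "(\<Prod>c<r. \<Prod>l'\<in>set (block_positions m (k - 1) p'). ff q (\<tau> k (u + c)) (\<tau> (k - 1) l'))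
      = ff_prod q (block_params m \<tau> k (a, b)) (block_params m \<tau> (k - 1) p')"
      unfolding block_params_def bk(1) using d by (simp add: ff_prod_map)
  qed
  finally show ?thesis .
qed

text \<open>The hypothesis makes the cancellation on the lowest level of each block legitimate:
  there \<open>desc_prod\<close> meets its own inverse.\<close>

lemma upper_coeff_blocks:
  assumes nz: "\<And>k p. p \<in> pairs N k \<Longrightarrow> desc_prod q (block_params m \<tau> k p) \<noteq> 0"
  shows "upper_coeff N q n m \<tau> = level_coeff N q (block_params m \<tau>) *
    (\<Prod>k\<in>{1..<N}. \<Prod>p\<in>pairs N k. block_weight q k p (block_params m \<tau> k p) (block_params m \<tau> (k - 1) p))"
proof -
  define FF where "FF k = (\<Prod>(p, p') | p \<in> pairs N k \<and> p' \<in> pairs N k \<and> p \<prec> p'. ff_prod q (block_params m \<tau> k p') (block_params m \<tau> k p))" for k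
  define XX where "XX k = (\<Prod>(p, p') | p \<in> pairs N k \<and> p' \<in> pairs N (k - 1) \<and> p \<prec> p'. ff_prod q (block_params m \<tau> k p) (block_params m \<tau> (k - 1) p'))" for k
  define D where "D k = (\<Prod>a\<in>{1..<k}. \<Prod>b\<in>{k..<N}. desc_prod q (block_params m \<tau> k (a, b)))" for k
  define C where "C k = (\<Prod>a\<in>{1..<k}. \<Prod>b\<in>{k..<N}. chain_prod q (block_params m \<tau> k (a, b)) (block_params m \<tau> (k - 1) (a, b)))" for k
  define E where "E k = (\<Prod>b\<in>{k..<N}. desc_prod q (block_params m \<tau> k (k, b)))" for k
  define W where "W k = (\<Prod>b\<in>{k..<N}. 1 / fact (length (block_params m \<tau> k (k, b))) :: complex)" for k
  have E0: "E k \<noteq> 0" if "k \<in> {1..<N}" for k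
    unfolding E_def using that nz by (auto simp: prod_zero_iff pairs_iff)
  have 1: "beta N q n \<tau> = (\<Prod>k\<in>{1..<N}. FF k * (D k * E k))"
    unfolding beta_def
  proof (rule prod.cong[OF refl])
    fix k assume k: "k \<in> {1..<N}"
    have "(\<Prod>l'\<in>{1..n k}. \<Prod>l\<in>{1..<l'}. ff q (\<tau> k l') (\<tau> k l)) = desc_prod q (map (\<tau> k) [1..<n k + 1])"
      using desc_prod_upt[of 0 "n k" q "\<tau> k"]
      by (simp add: atLeastSucAtMost_greaterThanAtMost atLeastSucLessThan_greaterThanLessThan del: upt_Suc)
    also have "map (\<tau> k) [1..<n k + 1] = concat (map (block_params m \<tau> k) (pair_list N k))"
      unfolding concat_block_positions[OF m k, symmetric] map_concat block_params_def[abs_def] by (simp add: o_def)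
    also have "desc_prod q \<dots> = FF k * (\<Prod>p\<in>pairs N k. desc_prod q (block_params m \<tau> k p))"
      unfolding desc_prod_concat[OF sorted_pair_list] FF_def ..
    also have "(\<Prod>p\<in>pairs N k. desc_prod q (block_params m \<tau> k p)) = D k * E k"
      using k by (simp add: prod_pairs_split D_def E_def)
    finally show "(\<Prod>l'\<in>{1..n k}. \<Prod>l\<in>{1..<l'}. ff q (\<tau> k l') (\<tau> k l)) = FF k * (D k * E k)" .
  qed
  have 2: "(\<Prod>j\<in>{1..<N}. \<Prod>i\<in>{j..<N}. 1 / fact (m j i - m j (i + 1))
            * (\<Prod>l\<in>{n j - m j i <.. n j - m j (i + 1)}. \<Prod>l'\<in>{n j - m j i <..< l}.
                 inverse (ff q (\<tau> j l) (\<tau> j l')))) = (\<Prod>k\<in>{1..<N}. W k * inverse (E k))"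
  proof (rule prod.cong[OF refl])
    fix k assume k: "k \<in> {1..<N}"
    have r: "1 / fact (m k i - m k (i + 1)) * (\<Prod>l\<in>{n k - m k i <.. n k - m k (i + 1)}. \<Prod>l'\<in>{n k - m k i <..< l}.
                 inverse (ff q (\<tau> k l) (\<tau> k l'))) =
         (1 / fact (length (block_params m \<tau> k (k, i))) :: complex) * inverse (desc_prod q (block_params m \<tau> k (k, i)))"
      if i: "i \<in> {k..<N}" for i
    proof -
      have "(k, i) \<in> pairs N k" using k i by (auto simp: pairs_iff)
      then have "length (block_params m \<tau> k (k, i)) = m k i - m k (i + 1)"
        by (simp add: block_params_def length_block_positions[OF m])
      moreover have "m k (i + 1) \<le> m k i" using k i by (auto intro: upper_antimono[OF m])
      then have "desc_prod q (block_params m \<tau> k (k, i)) =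
          (\<Prod>l\<in>{n k - m k i <.. n k - m k (i + 1)}. \<Prod>l'\<in>{n k - m k i <..< l}. ff q (\<tau> k l) (\<tau> k l'))"
        using m_sum_diag[OF m k] unfolding block_params_def block_positions_def by (subst desc_prod_upt[symmetric]) auto
      ultimately show ?thesis by (simp add: prod_inversef[symmetric] o_def)
    qed
    have w: "W k * inverse (E k) = (\<Prod>i\<in>{k..<N}. 1 / fact (length (block_params m \<tau> k (k, i))) * inverse (desc_prod q (block_params m \<tau> k (k, i))))"
      by (simp only: W_def E_def prod.distrib prod_inversef[symmetric] o_def)
    show "(\<Prod>i\<in>{k..<N}. 1 / fact (m k i - m k (i + 1))
            * (\<Prod>l\<in>{n k - m k i <.. n k - m k (i + 1)}. \<Prod>l'\<in>{n k - m k i <..< l}.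
                 inverse (ff q (\<tau> k l) (\<tau> k l')))) = W k * inverse (E k)"
      unfolding w by (rule prod.cong[OF refl]) (rule r)
  qed
  have 3: "(\<Prod>i\<in>{2..<N}. \<Prod>j\<in>{1..<i}. \<Prod>l\<in>{0..<m j i}.
            gl q (\<tau> i (m_sum m j i - l)) (\<tau> (i - 1) (m_sum m j (i - 1) - l))
            * (\<Prod>l'\<in>{m_sum m j (i - 1) - l + 1 .. n (i - 1)}.
                 ff q (\<tau> i (m_sum m j i - l)) (\<tau> (i - 1) l'))) = (\<Prod>k\<in>{2..<N}. C k * XX k)"
  proof (rule prod.cong[OF refl])
    fix k assume k: "k \<in> {2..<N}"
    let ?P = "\<lambda>a b. \<Prod>p' | p' \<in> pairs N (k - 1) \<and> (a, b) \<prec> p'. ff_prod q (block_params m \<tau> k (a, b)) (block_params m \<tau> (k - 1) p')"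
    have row: "(\<Prod>l\<in>{0..<m a k}. gl q (\<tau> k (m_sum m a k - l)) (\<tau> (k - 1) (m_sum m a (k - 1) - l))
            * (\<Prod>l'\<in>{m_sum m a (k - 1) - l + 1 .. n (k - 1)}. ff q (\<tau> k (m_sum m a k - l)) (\<tau> (k - 1) l')))
        = (\<Prod>b\<in>{k..<N}. chain_prod q (block_params m \<tau> k (a, b)) (block_params m \<tau> (k - 1) (a, b)) * ?P a b)"
      if a: "a \<in> {1..<k}" for a
    proof -
      \<comment> \<open>Rewriting the lower end 0 of the range of offsets as \<open>m a N\<close>
        brings the interval into the form required by \<open>prod_interval_split\<close>.\<close>
      have 0: "m a N = 0" by (simp add: upper_outside[OF m])
      show ?thesis
        using prod_interval_split[of k N "m a"] k a
        by (subst 0[symmetric], subst prod_interval_split)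
          (auto intro!: upper_antimono[OF m] prod.cong block_chain simp del: One_nat_def)
    qed
    \<comment> \<open>Blocks starting on level k have no successor on level k - 1, where first
      components are at most k - 1. So \<open>XX k\<close> involves only the groups a < k, the same
      as \<open>C k\<close>.\<close>
    have "?P k b = 1" for b
    proof -
      have "{p'. p' \<in> pairs N (k - 1) \<and> (k, b) \<prec> p'} = {}"
        using k by (auto simp: pairs_iff prec_def)
      then show ?thesis by (simp only: prod.empty)
    qed
    then have "XX k = (\<Prod>a\<in>{1..<k}. \<Prod>b\<in>{k..<N}. ?P a b)"
      unfolding XX_def prod_pairs2 using k by (subst prod_pairs_split) auto
    then have X: "C k * XX k = (\<Prod>a\<in>{1..<k}. \<Prod>b\<in>{k..<N}.
        chain_prod q (block_params m \<tau> k (a, b)) (block_params m \<tau> (k - 1) (a, b)) * ?P a b)"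
      by (simp only: C_def prod.distrib)
    show "(\<Prod>j\<in>{1..<k}. \<Prod>l\<in>{0..<m j k}.
            gl q (\<tau> k (m_sum m j k - l)) (\<tau> (k - 1) (m_sum m j (k - 1) - l))
            * (\<Prod>l'\<in>{m_sum m j (k - 1) - l + 1 .. n (k - 1)}.
                 ff q (\<tau> k (m_sum m j k - l)) (\<tau> (k - 1) l'))) = C k * XX k"
      unfolding X by (rule prod.cong[OF refl]) (rule row)
  qed
  have C1: "C 1 = 1" by (simp add: C_def)
  \<comment> \<open>No block comes up from below level 1, so the product over neighbouring levels
    may start at 1 like the other products.\<close>
  have CC: "(\<Prod>k\<in>{2..<N}. C k) = (\<Prod>k\<in>{1..<N}. C k)"
  proof (cases "1 < N")
    case True
    then have "{1..<N} = insert 1 {2..<N}" by auto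
    then show ?thesis using C1 by simp
  qed simp
  have 4: "(\<Prod>k\<in>{1..<N}. \<Prod>p\<in>pairs N k. block_weight q k p (block_params m \<tau> k p) (block_params m \<tau> (k - 1) p))
    = (\<Prod>k\<in>{1..<N}. D k * C k * W k)"
    by (rule prod.cong[OF refl]) (simp add: prod_pairs_split block_weight_def D_def C_def W_def prod.distrib)
  have "upper_coeff N q n m \<tau> = (\<Prod>k\<in>{1..<N}. FF k * (D k * E k)) * (\<Prod>k\<in>{1..<N}. W k * inverse (E k)) * (\<Prod>k\<in>{2..<N}. C k * XX k)"
    unfolding upper_coeff_def 1 2 3 ..
  also have "\<dots> = (\<Prod>k\<in>{1..<N}. FF k * (D k * E k) * (W k * inverse (E k)) * C k) * (\<Prod>k\<in>{2..<N}. XX k)"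
    by (simp add: prod.distrib CC)
  also have "(\<Prod>k\<in>{1..<N}. FF k * (D k * E k) * (W k * inverse (E k)) * C k) = (\<Prod>k\<in>{1..<N}. FF k * (D k * C k * W k))"
    by (rule prod.cong[OF refl]) (use E0 in \<open>simp add: field_simps\<close>)
  finally show ?thesis
    unfolding level_coeff_def 4 by (simp add: prod.distrib FF_def XX_def)
qed

end

section \<open>Sums over families of choices, independent or coupled along a chain\<close>

section \<open>Summation over the arrangements of a partition\<close>

text \<open>Families are total functions here. The coordinate that is split off is frozen at a
  default \<open>d\<close>, so that the families of the other coordinates are still counted once
  each.\<close>

lemma sum_dependent_functions_split:
  "(\<Sum>h | \<forall>j. h j \<in> A j. \<Phi> h) = (\<Sum>h | \<forall>j. h j \<in> (A(i := {d})) j. \<Sum>x\<in>A i. \<Phi> (h(i := x)))"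
proof -
  have "(\<Sum>h | \<forall>j. h j \<in> A j. \<Phi> h)
    = (\<Sum>(h, x)\<in>{h. \<forall>j. h j \<in> (A(i := {d})) j} \<times> A i. \<Phi> (h(i := x)))"
  proof (rule sum.reindex_bij_witness[of _ "\<lambda>(h, x). h(i := x)" "\<lambda>h. (h(i := d), h i)"])
    fix a assume "a \<in> {h. \<forall>j. h j \<in> (A(i := {d})) j} \<times> A i"
    then obtain h x where a: "a = (h, x)" "\<And>j. h j \<in> (A(i := {d})) j" "x \<in> A i" by blast
    have "h i = d" using a(2)[of i] by simp
    then have "h(i := d) = h" by auto
    then show "((case a of (h, x) \<Rightarrow> h(i := x))(i := d), (case a of (h, x) \<Rightarrow> h(i := x)) i) = a"
      by (simp add: a(1))
    show "(case a of (h, x) \<Rightarrow> h(i := x)) \<in> {h. \<forall>j. h j \<in> A j}"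
    proof -
      have "(h(i := x)) j \<in> A j" for j using a(2)[of j] a(3) by (cases "j = i") auto
      then show ?thesis by (simp add: a(1))
    qed
  qed auto
  then show ?thesis by (simp add: sum.cartesian_product)
qed

text \<open>Outside \<open>I\<close> each factor is a singleton, so the functions are in effect
  families on the finite set \<open>I\<close>.\<close>

lemma sum_prod_dependent_functions:
  fixes w :: "'i \<Rightarrow> 'a \<Rightarrow> 'b :: comm_semiring_1"
  assumes "finite I"
  shows "(\<And>i. i \<notin> I \<Longrightarrow> \<exists>d. A i = {d}) \<Longrightarrow>
    (\<Sum>h | \<forall>i. h i \<in> A i. \<Prod>i\<in>I. w i (h i)) = (\<Prod>i\<in>I. \<Sum>x\<in>A i. w i x)"
  using assms
proof (induction I arbitrary: A)
  case empty
  then obtain d where "A i = {d i}" for i by (metis empty_iff)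
  then have "{h. \<forall>i. h i \<in> A i} = {d}" by auto
  then show ?case by simp
next
  case (insert i I)
  let ?A = "A(i := {undefined})"
  have "(\<Sum>h | \<forall>i. h i \<in> A i. \<Prod>i\<in>insert i I. w i (h i)) =
    (\<Sum>h | \<forall>j. h j \<in> ?A j. \<Sum>x\<in>A i. \<Prod>j\<in>insert i I. w j ((h(i := x)) j))"
    by (rule sum_dependent_functions_split)
  also have "\<dots> = (\<Sum>h | \<forall>j. h j \<in> ?A j. (\<Sum>x\<in>A i. w i x) * (\<Prod>j\<in>I. w j (h j)))"
  proof (rule sum.cong[OF refl])
    fix h
    have "(\<Prod>j\<in>insert i I. w j ((h(i := x)) j)) = w i x * (\<Prod>j\<in>I. w j (h j))" for x
    proof -
      have "(\<Prod>j\<in>I. w j ((h(i := x)) j)) = (\<Prod>j\<in>I. w j (h j))"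
        using insert.hyps by (intro prod.cong) auto
      then show ?thesis using insert.hyps by simp
    qed
    then show "(\<Sum>x\<in>A i. \<Prod>j\<in>insert i I. w j ((h(i := x)) j)) = (\<Sum>x\<in>A i. w i x) * (\<Prod>j\<in>I. w j (h j))"
      by (simp only: sum_distrib_right)
  qed
  also have "\<dots> = (\<Sum>x\<in>A i. w i x) * (\<Sum>h | \<forall>j. h j \<in> ?A j. \<Prod>j\<in>I. w j (h j))"
    by (simp only: sum_distrib_left)
  also have "(\<Sum>h | \<forall>j. h j \<in> ?A j. \<Prod>j\<in>I. w j (h j)) = (\<Prod>j\<in>I. \<Sum>x\<in>?A j. w j x)"
    using insert.prems by (intro insert.IH) auto
  also have "\<dots> = (\<Prod>j\<in>I. \<Sum>x\<in>A j. w j x)" using insert.hyps by (intro prod.cong) auto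
  finally show ?case using insert.hyps by simp
qed

text \<open>The weights couple neighbouring coordinates, so the sum does not split into independent
  sums at once. The topmost coordinate occurs in a single factor, whose sum is the constant
  \<open>c K\<close> for every admissible value below it; freezing it leaves a shorter
  chain.\<close>

lemma sum_chain_dependent_functions:
  fixes G :: "nat \<Rightarrow> 'a \<Rightarrow> 'a \<Rightarrow> 'b :: comm_semiring_1"
  assumes "1 \<le> K"
    and "\<And>k. k \<notin> {1..<K} \<Longrightarrow> \<exists>d. A k = {d}"
    and "\<And>k g. k \<in> {1..<K} \<Longrightarrow> g \<in> A (k - 1) \<Longrightarrow> (\<Sum>x\<in>A k. G k x g) = c k"
  shows "(\<Sum>h | \<forall>k. h k \<in> A k. \<Prod>k\<in>{1..<K}. G k (h k) (h (k - 1))) = (\<Prod>k\<in>{1..<K}. c k)"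
  using assms
proof (induction K arbitrary: A rule: dec_induct)
  case base
  then obtain d where "A i = {d i}" for i by (metis atLeastLessThan_empty order_refl empty_iff)
  then have "{h. \<forall>i. h i \<in> A i} = {d}" by auto
  then show ?case by simp
next
  case (step K)
  let ?A = "A(K := {undefined})"
  have S: "{1..<Suc K} = insert K {1..<K}" using step.hyps by auto
  have "(\<Sum>h | \<forall>i. h i \<in> A i. \<Prod>k\<in>{1..<Suc K}. G k (h k) (h (k - 1))) =
    (\<Sum>h | \<forall>j. h j \<in> ?A j. \<Sum>x\<in>A K. \<Prod>k\<in>{1..<Suc K}. G k ((h(K := x)) k) ((h(K := x)) (k - 1)))"
    by (rule sum_dependent_functions_split)
  also have "\<dots> = (\<Sum>h | \<forall>j. h j \<in> ?A j. c K * (\<Prod>k\<in>{1..<K}. G k (h k) (h (k - 1))))"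
  proof (rule sum.cong[OF refl])
    fix h assume h: "h \<in> {h. \<forall>j. h j \<in> ?A j}"
    \<comment> \<open>Truncated subtraction would make this fail for \<open>K = 0\<close>; hence the
      coordinates that are summed start at 1, and coordinate 0 is a singleton.\<close>
    have K: "K - 1 \<noteq> K" using step.hyps by simp
    have "h (K - 1) \<in> ?A (K - 1)" using h by blast
    then have hK: "h (K - 1) \<in> A (K - 1)" using K by simp
    have "(\<Prod>k\<in>{1..<Suc K}. G k ((h(K := x)) k) ((h(K := x)) (k - 1))) =
        G K x (h (K - 1)) * (\<Prod>k\<in>{1..<K}. G k (h k) (h (k - 1)))" for x
    proof -
      have "(\<Prod>k\<in>{1..<K}. G k ((h(K := x)) k) ((h(K := x)) (k - 1))) = (\<Prod>k\<in>{1..<K}. G k (h k) (h (k - 1)))"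
        by (intro prod.cong refl) auto
      then show ?thesis unfolding S using K by simp
    qed
    then have "(\<Sum>x\<in>A K. \<Prod>k\<in>{1..<Suc K}. G k ((h(K := x)) k) ((h(K := x)) (k - 1)))
      = (\<Sum>x\<in>A K. G K x (h (K - 1))) * (\<Prod>k\<in>{1..<K}. G k (h k) (h (k - 1)))"
      by (simp only: sum_distrib_right)
    also have "(\<Sum>x\<in>A K. G K x (h (K - 1))) = c K"
      using hK step.hyps by (intro step.prems) auto
    finally show "(\<Sum>x\<in>A K. \<Prod>k\<in>{1..<Suc K}. G k ((h(K := x)) k) ((h(K := x)) (k - 1)))
      = c K * (\<Prod>k\<in>{1..<K}. G k (h k) (h (k - 1)))" .
  qed
  also have "\<dots> = c K * (\<Sum>h | \<forall>j. h j \<in> ?A j. \<Prod>k\<in>{1..<K}. G k (h k) (h (k - 1)))"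
    by (simp only: sum_distrib_left)
  also have "(\<Sum>h | \<forall>j. h j \<in> ?A j. \<Prod>k\<in>{1..<K}. G k (h k) (h (k - 1))) = (\<Prod>k\<in>{1..<K}. c k)"
  proof (rule step.IH)
    fix k assume "k \<notin> {1..<K}"
    then show "\<exists>d. ?A k = {d}" using step.prems(1)[of k] by (cases "k = K") auto
  next
    fix k g assume k: "k \<in> {1..<K}" and g: "g \<in> ?A (k - 1)"
    have "k - 1 \<noteq> K" using k by auto
    then have "g \<in> A (k - 1)" using g by simp
    then show "(\<Sum>x\<in>?A k. G k x g) = c k"
      using step.prems(2)[of k g] k by simp
  qed
  finally show ?case unfolding S by simp
qed

lemma genericD:
  assumes "generic N q n t" "k \<in> {1..<N}" "l \<in> {1..n k}"
  shows "t k l \<noteq> 0"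
    and "k' \<in> {1..<N} \<Longrightarrow> l' \<in> {1..n k'} \<Longrightarrow> (k, l) \<noteq> (k', l') \<Longrightarrow> t k l \<noteq> t k' l' \<and> q\<^sup>2 * t k l \<noteq> t k' l'"
  using assms unfolding generic_def bethe_indices_def by fastforce+

lemma generic_inj_on: "generic N q n t \<Longrightarrow> k \<in> {1..<N} \<Longrightarrow> inj_on (t k) {1..n k}"
  by (rule inj_onI) (metis genericD(2) prod.inject)

lemma generic_separated:
  assumes g: "generic N q n t" and k: "k \<in> {1..<N}" "k' \<in> {1..<N}" "k \<noteq> k'"
    and xs: "distinct xs" "set xs \<subseteq> {1..n k}" and ys: "distinct ys" "set ys \<subseteq> {1..n k'}"
  shows "separated q (map (t k) xs) (map (t k') ys)"
proof -
  have "inj_on (t k) (set xs)" "inj_on (t k') (set ys)"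
    using generic_inj_on[OF g] k xs ys by (blast intro: inj_on_subset)+
  moreover have "t k x \<noteq> 0" if "x \<in> set xs" for x using genericD(1)[OF g k(1)] that xs by blast
  moreover have "t k' x \<noteq> 0" if "x \<in> set ys" for x using genericD(1)[OF g k(2)] that ys by blast
  moreover have "t k x \<noteq> t k' y \<and> q\<^sup>2 * t k x \<noteq> t k' y" if "x \<in> set xs" "y \<in> set ys" for x y
    using genericD(2)[OF g k(1) _ k(2), of x y] that xs ys k(3) by blast
  ultimately show ?thesis using xs ys by (auto simp: separated_def distinct_map)
qed

text \<open>The right-hand side contains the sorted list of the lower set and not \<open>ys\<close>:
  this is the independence that \<open>sum_chain_dependent_functions\<close> asks for.\<close>

lemma sum_permutations_block_weight:
  assumes q: "q \<noteq> 0" "q\<^sup>2 \<noteq> 1" and g: "generic N q n t" and P: "P \<in> bethe_partitions N n"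
    and k: "k \<in> {1..<N}" and p: "p \<in> pairs N k" and ys: "ys \<in> permutations_of_set (P (k - 1) p)"
  shows "(\<Sum>xs\<in>permutations_of_set (P k p). block_weight q k p (map (t k) xs) (map (t (k - 1)) ys))
    = (if fst p < k then izergin_l q (subpar t P k p) (subpar t P (k - 1) p) else 1)"
proof -
  obtain a b where ab: "p = (a, b)" by (cases p)
  have sub: "P k p \<subseteq> {1..n k}" if "k \<in> {1..<N}" "p \<in> pairs N k" for k p
    using bethe_partitionsD(2)[OF P] that by blast
  then have fin: "finite (P k p)" using k p by (meson finite_atLeastAtMost finite_subset)
  show ?thesis
  proof (cases "a < k")
    case True
    have k1: "k - 1 \<in> {1..<N}" "p \<in> pairs N (k - 1)" "k \<noteq> k - 1"
      using True p k by (auto simp: ab pairs_iff)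
    have fin1: "finite (P (k - 1) p)" using sub[OF k1(1,2)] by (meson finite_atLeastAtMost finite_subset)
    have card: "card (P k p) = card (P (k - 1) p)"
      using bethe_partitionsD(4)[OF P] p k1 unfolding ab by blast
    define zs where "zs = sorted_list_of_set (P k p)"
    define vs where "vs = sorted_list_of_set (P (k - 1) p)"
    have zs: "set zs = P k p" "distinct zs" using fin by (auto simp: zs_def)
    have vs: "set vs = P (k - 1) p" "distinct vs" using fin1 by (auto simp: vs_def)
    have ys': "set ys = P (k - 1) p" "distinct ys" using ys by (auto dest: permutations_of_setD)
    have len: "length ys = length zs" "length vs = length zs"
      using card ys' zs vs distinct_card by metis+
    have "(\<Sum>xs\<in>permutations_of_set (P k p). block_weight q k p (map (t k) xs) (map (t (k - 1)) ys))
      = izergin_l q (map (t k) zs) (map (t (k - 1)) ys)"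
      using True sum_permutations_izergin[OF q, of "map (t (k - 1)) ys" zs "t k"] zs len
        generic_separated[OF g k k1(1,3), of zs ys] ys' sub[OF k p] sub[OF k1(1,2)]
      by (simp add: block_weight_def ab)
    also have "\<dots> = izergin_l q (map (t k) zs) (map (t (k - 1)) vs)"
    proof (rule izergin_l_perm_right[OF q])
      show "separated q (map (t k) zs) (map (t (k - 1)) vs)"
        using generic_separated[OF g k k1(1,3), of zs vs] zs vs sub[OF k p] sub[OF k1(1,2)] by simp
      show "distinct (map (t (k - 1)) ys)"
        using generic_separated[OF g k k1(1,3), of zs ys] zs ys' sub[OF k p] sub[OF k1(1,2)]
        by (simp add: separated_def)
    qed (use len ys' vs in auto)
    finally show ?thesis using True by (simp add: ab subpar_def zs_def vs_def)
  next
    case False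
    \<comment> \<open>On the lowest level of the block each ordering has the weight 1 / r!, where r
      is the size of the block, and there are r! orderings.\<close>
    have "length xs = card (P k p)" if "xs \<in> permutations_of_set (P k p)" for xs
      using that by (rule length_finite_permutations_of_set)
    then show ?thesis
      using False fin by (simp add: block_weight_def ab)
  qed
qed

definition part_coeff ::
  "nat \<Rightarrow> complex \<Rightarrow> (nat \<Rightarrow> nat \<Rightarrow> complex) \<Rightarrow> (nat \<Rightarrow> nat \<times> nat \<Rightarrow> nat set) \<Rightarrow> complex" where
  "part_coeff N q t P = (\<Prod>k\<in>{1..<N}. \<Prod>(p, p') | p \<in> pairs N k \<and> p' \<in> pairs N k \<and> p \<prec> p'.
                ff_prod q (subpar t P k p') (subpar t P k p))
           * (\<Prod>k\<in>{2..<N}.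
                (\<Prod>(p, p') | p \<in> pairs N k \<and> p' \<in> pairs N (k - 1) \<and> p \<prec> p'.
                   ff_prod q (subpar t P k p) (subpar t P (k - 1) p'))
              * (\<Prod>(i, j) | (i, j) \<in> pairs N k \<and> (i, j) \<in> pairs N (k - 1) \<and> i < j.
                   izergin_l q (subpar t P k (i, j)) (subpar t P (k - 1) (i, j))))"

lemma level_coeff_cong:
  assumes "\<And>k p. p \<in> pairs N k \<Longrightarrow> L k p = map (t k) (M k p)"
    and "\<And>k p. p \<in> pairs N k \<Longrightarrow> L' k p = map (t k) (M' k p)"
    and "\<And>k p. p \<in> pairs N k \<Longrightarrow> distinct (M k p) \<and> distinct (M' k p) \<and> set (M k p) = set (M' k p)"
  shows "level_coeff N q L = level_coeff N q L'"
proof -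
  have "ff_prod q (L k p) (L k' p') = ff_prod q (L' k p) (L' k' p')"
    if "p \<in> pairs N k" "p' \<in> pairs N k'" for k k' p p'
    using assms(3)[OF that(1)] assms(3)[OF that(2)]
    by (simp add: assms(1,2)[OF that(1)] assms(1,2)[OF that(2)] ff_prod_map)
  then show ?thesis
    unfolding level_coeff_def
    by (intro arg_cong2[of _ _ _ _ "(*)"] prod.cong refl) (auto simp: case_prod_beta)
qed

lemma sum_fiber_upper_coeff:
  assumes N: "1 \<le> N" and q: "q \<noteq> 0" "q\<^sup>2 \<noteq> 1" and g: "generic N q n t" and P: "P \<in> bethe_partitions N n"
  shows "(\<Sum>(m, \<sigma>) | m \<in> upper_permissible N n \<and> \<sigma> \<in> sym_group N n \<and> partition_of N m \<sigma> = P.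
      upper_coeff N q n m (\<lambda>k l. t k (\<sigma> k l))) = part_coeff N q t P"
proof -
  define G where "G L = level_coeff N q (\<lambda>k p. map (t k) (L k p)) *
    (\<Prod>k\<in>{1..<N}. \<Prod>p\<in>pairs N k. block_weight q k p (map (t k) (L k p)) (map (t (k - 1)) (L (k - 1) p)))" for L
  define A where "A k = {h. \<forall>p. h p \<in> permutations_of_set (P k p)}" for k
  have sub: "P k p \<subseteq> {1..n k}" for k p
  proof (cases "p \<in> pairs N k")
    case True
    then show ?thesis using bethe_partitionsD(2)[OF P] pairs_range[OF True] by blast
  next
    case False
    then show ?thesis using bethe_partitionsD(1)[OF P] by simp
  qed
  have "(\<Sum>(m, \<sigma>) | m \<in> upper_permissible N n \<and> \<sigma> \<in> sym_group N n \<and> partition_of N m \<sigma> = P.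
      upper_coeff N q n m (\<lambda>k l. t k (\<sigma> k l)))
    = (\<Sum>(m, \<sigma>) | m \<in> upper_permissible N n \<and> \<sigma> \<in> sym_group N n \<and> partition_of N m \<sigma> = P. G (arrangement_of N m \<sigma>))"
  proof (rule sum.cong[OF refl], clarify)
    fix m \<sigma> assume m: "m \<in> upper_permissible N n" and \<sigma>: "\<sigma> \<in> sym_group N n"
    let ?\<tau> = "\<lambda>k l. t k (\<sigma> k l)"
    have e: "block_params m ?\<tau> k p = map (t k) (arrangement_of N m \<sigma> k p)" if "p \<in> pairs N k" for k p
      using that by (simp add: block_params_def arrangement_of_def)
    have "desc_prod q (block_params m ?\<tau> k p) \<noteq> 0" if p: "p \<in> pairs N k" for k p
    proof -
      have k: "k \<in> {1..<N}" using p by (rule pairs_range)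
      have d: "distinct (arrangement_of N m \<sigma> k p)" "set (arrangement_of N m \<sigma> k p) \<subseteq> {1..n k}"
      proof -
        show "distinct (arrangement_of N m \<sigma> k p)"
          using partition_of_bethe(2)[OF m \<sigma>] by (simp add: arrangements_def permutations_of_set_def del: split_paired_All)
        show "set (arrangement_of N m \<sigma> k p) \<subseteq> {1..n k}"
          using bethe_partitionsD(2)[OF partition_of_bethe(1)[OF m \<sigma>] k] p unfolding partition_of_def by blast
      qed
      have inj: "inj_on (t k) (set (arrangement_of N m \<sigma> k p))"
        using generic_inj_on[OF g k] d(2) by (rule inj_on_subset)
      show ?thesis
        unfolding e[OF p]
      proof (rule desc_prod_nonzero[OF q(1)])
        fix x y assume "x \<in> set (map (t k) (arrangement_of N m \<sigma> k p))" "y \<in> set (map (t k) (arrangement_of N m \<sigma> k p))" "x \<noteq> y"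
        then obtain l l' where l: "l \<in> set (arrangement_of N m \<sigma> k p)" "l' \<in> set (arrangement_of N m \<sigma> k p)" and
          xy: "x = t k l" "y = t k l'" "l \<noteq> l'"
          by auto
        have "l \<in> {1..n k}" "l' \<in> {1..n k}" using l d(2) by blast+
        then show "q\<^sup>2 * x \<noteq> y" using genericD(2)[OF g k _ k, of l l'] xy by simp
      qed (use d inj in \<open>simp add: distinct_map\<close>)
    qed
    then have "upper_coeff N q n m ?\<tau> = level_coeff N q (block_params m ?\<tau>) *
      (\<Prod>k\<in>{1..<N}. \<Prod>p\<in>pairs N k. block_weight q k p (block_params m ?\<tau> k p) (block_params m ?\<tau> (k - 1) p))"
      by (rule upper_coeff_blocks[OF m])
    also have "level_coeff N q (block_params m ?\<tau>) = level_coeff N q (\<lambda>k p. map (t k) (arrangement_of N m \<sigma> k p))"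
      unfolding level_coeff_def by (intro arg_cong2[of _ _ _ _ "(*)"] prod.cong refl) (auto simp: e)
    also have "(\<Prod>k\<in>{1..<N}. \<Prod>p\<in>pairs N k. block_weight q k p (block_params m ?\<tau> k p) (block_params m ?\<tau> (k - 1) p))
      = (\<Prod>k\<in>{1..<N}. \<Prod>p\<in>pairs N k. block_weight q k p (map (t k) (arrangement_of N m \<sigma> k p)) (map (t (k - 1)) (arrangement_of N m \<sigma> (k - 1) p)))"
    proof (intro prod.cong refl)
      fix k p assume k: "k \<in> {1..<N}" and p: "p \<in> pairs N k"
      show "block_weight q k p (block_params m ?\<tau> k p) (block_params m ?\<tau> (k - 1) p)
        = block_weight q k p (map (t k) (arrangement_of N m \<sigma> k p)) (map (t (k - 1)) (arrangement_of N m \<sigma> (k - 1) p))"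
      \<comment> \<open>A block on its lowest level is not defined one level below, where
        \<open>block_params\<close> and \<open>arrangement_of\<close> may differ. There
        \<open>block_weight\<close> ignores the second list.\<close>
      proof (cases "fst p < k")
        case True
        then have "p \<in> pairs N (k - 1)" using p by (cases p) (auto simp: pairs_iff)
        then show ?thesis using p by (simp only: e)
      next
        case False
        then show ?thesis using p by (simp add: block_weight_def e)
      qed
    qed
    finally show "upper_coeff N q n m ?\<tau> = G (arrangement_of N m \<sigma>)" unfolding G_def .
  qed
  also have "\<dots> = (\<Sum>L\<in>arrangements P. G L)" by (rule sum_fiber[OF P])
  also have "\<dots> = (\<Sum>L\<in>arrangements P. level_coeff N q (subpar t P) *
    (\<Prod>k\<in>{1..<N}. \<Prod>p\<in>pairs N k. block_weight q k p (map (t k) (L k p)) (map (t (k - 1)) (L (k - 1) p))))"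
  proof (rule sum.cong[OF refl])
    fix L assume L: "L \<in> arrangements P"
    have fin: "finite (P k p)" for k p using sub by (rule finite_subset) simp
    have "level_coeff N q (\<lambda>k p. map (t k) (L k p)) = level_coeff N q (subpar t P)"
      using arrangements_set[OF P L] fin
      by (intro level_coeff_cong[of N _ t L _ "\<lambda>k p. sorted_list_of_set (P k p)"]) (simp_all add: subpar_def)
    then show "G L = level_coeff N q (subpar t P) *
      (\<Prod>k\<in>{1..<N}. \<Prod>p\<in>pairs N k. block_weight q k p (map (t k) (L k p)) (map (t (k - 1)) (L (k - 1) p)))"
      by (simp only: G_def)
  qed
  also have "\<dots> = level_coeff N q (subpar t P) * (\<Sum>L\<in>arrangements P.
    \<Prod>k\<in>{1..<N}. \<Prod>p\<in>pairs N k. block_weight q k p (map (t k) (L k p)) (map (t (k - 1)) (L (k - 1) p)))"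
    by (simp only: sum_distrib_left)
  \<comment> \<open>An arrangement becomes one choice per level: the levels form the chain, and
    within a level the blocks are independent once the level below is fixed.\<close>
  also have "arrangements P = {L. \<forall>k. L k \<in> A k}"
    by (simp add: arrangements_def A_def del: split_paired_All)
  also have "(\<Sum>L | \<forall>k. L k \<in> A k. \<Prod>k\<in>{1..<N}. \<Prod>p\<in>pairs N k.
        block_weight q k p (map (t k) (L k p)) (map (t (k - 1)) (L (k - 1) p)))
    = (\<Prod>k\<in>{1..<N}. \<Prod>p\<in>pairs N k. if fst p < k then izergin_l q (subpar t P k p) (subpar t P (k - 1) p) else 1)"
  proof (rule sum_chain_dependent_functions[OF N])
    fix k assume k: "k \<notin> {1..<N}"
    have "P k p = {}" for p
      using k by (intro bethe_partitionsD(1)[OF P]) (blast dest: pairs_range)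
    then have "A k = {\<lambda>_. []}" by (auto simp: A_def fun_eq_iff simp del: split_paired_All)
    then show "\<exists>d. A k = {d}" by blast
  next
    fix k h assume k: "k \<in> {1..<N}" and h: "h \<in> A (k - 1)"
    have "(\<Sum>x\<in>A k. \<Prod>p\<in>pairs N k. block_weight q k p (map (t k) (x p)) (map (t (k - 1)) (h p)))
      = (\<Prod>p\<in>pairs N k. \<Sum>xs\<in>permutations_of_set (P k p). block_weight q k p (map (t k) xs) (map (t (k - 1)) (h p)))"
      unfolding A_def
    proof (rule sum_prod_dependent_functions[OF finite_set])
      fix p assume "p \<notin> pairs N k"
      then have "P k p = {}" by (rule bethe_partitionsD(1)[OF P])
      then show "\<exists>d. permutations_of_set (P k p) = {d}" by simp
    qed
    also have "\<dots> = (\<Prod>p\<in>pairs N k. if fst p < k then izergin_l q (subpar t P k p) (subpar t P (k - 1) p) else 1)"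
    proof (rule prod.cong[OF refl])
      fix p assume p: "p \<in> pairs N k"
      have "h p \<in> permutations_of_set (P (k - 1) p)" using h by (simp add: A_def del: split_paired_All)
      then show "(\<Sum>xs\<in>permutations_of_set (P k p). block_weight q k p (map (t k) xs) (map (t (k - 1)) (h p)))
        = (if fst p < k then izergin_l q (subpar t P k p) (subpar t P (k - 1) p) else 1)"
        by (rule sum_permutations_block_weight[OF q g P k p])
    qed
    finally show "(\<Sum>x\<in>A k. \<Prod>p\<in>pairs N k. block_weight q k p (map (t k) (x p)) (map (t (k - 1)) (h p)))
      = (\<Prod>p\<in>pairs N k. if fst p < k then izergin_l q (subpar t P k p) (subpar t P (k - 1) p) else 1)" .
  qed
  also have "\<dots> = (\<Prod>k\<in>{2..<N}. \<Prod>(i, j) | (i, j) \<in> pairs N k \<and> (i, j) \<in> pairs N (k - 1) \<and> i < j.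
                   izergin_l q (subpar t P k (i, j)) (subpar t P (k - 1) (i, j)))"
  proof -
    let ?I = "\<lambda>k p. izergin_l q (subpar t P k p) (subpar t P (k - 1) p)"
    define X where "X k = (\<Prod>p\<in>pairs N k. if fst p < k then ?I k p else 1)" for k
    have e: "X k
      = (\<Prod>(i, j) | (i, j) \<in> pairs N k \<and> (i, j) \<in> pairs N (k - 1) \<and> i < j. ?I k (i, j))" for k
    proof -
      have "{p \<in> pairs N k. fst p < k} = {(i, j). (i, j) \<in> pairs N k \<and> (i, j) \<in> pairs N (k - 1) \<and> i < j}"
        by (auto simp: pairs_iff)
      then show ?thesis by (simp add: X_def prod.inter_filter[symmetric] case_prod_beta)
    qed
    have X1: "X 1 = 1"
      unfolding X_def by (intro prod.neutral) (auto simp: pairs_iff)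
    have "(\<Prod>k\<in>{1..<N}. X k) = (\<Prod>k\<in>{2..<N}. X k)"
    proof (cases "N = 1")
      case False
      then have "{1..<N} = insert 1 {2..<N}" using N by auto
      then show ?thesis using X1 by simp
    qed simp
    also have "\<dots> = (\<Prod>k\<in>{2..<N}. \<Prod>(i, j) | (i, j) \<in> pairs N k \<and> (i, j) \<in> pairs N (k - 1) \<and> i < j. ?I k (i, j))"
      unfolding e ..
    finally show ?thesis unfolding X_def .
  qed
  finally show ?thesis by (simp add: level_coeff_def part_coeff_def prod.distrib)
qed

section \<open>Commutation in the quotient algebra and comparison of the operator words\<close>

section \<open>Congruence modulo the RTT relations\<close>

text \<open>Membership in the carrier is built in, because \<open>in_Aq\<close> respects sums and
  products only there; thus the congruence rules need no side conditions.\<close>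

definition rtt_cong :: "nat \<Rightarrow> complex \<Rightarrow> ncpoly \<Rightarrow> ncpoly \<Rightarrow> bool" where
  "rtt_cong N q p p' \<longleftrightarrow> p \<in> carrier (free_algebra N) \<and> p' \<in> carrier (free_algebra N) \<and> in_Aq N q p = in_Aq N q p'"

lemma in_Aq_hom: "in_Aq N q \<in> Ring.ring_hom (free_algebra N) (Aq N q)"
  using ideal.rcos_ring_hom[OF ideal_rtt_ideal] unfolding in_Aq_def[abs_def] Aq_def .

lemma in_Aq_mult:
  "p \<in> carrier (free_algebra N) \<Longrightarrow> p' \<in> carrier (free_algebra N) \<Longrightarrow>
    in_Aq N q (p * p') = in_Aq N q p \<otimes>\<^bsub>Aq N q\<^esub> in_Aq N q p'"
  using ring_hom_mult[OF in_Aq_hom] by (metis free_algebra_ops(1))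

lemma in_Aq_add:
  "p \<in> carrier (free_algebra N) \<Longrightarrow> p' \<in> carrier (free_algebra N) \<Longrightarrow>
    in_Aq N q (p + p') = in_Aq N q p \<oplus>\<^bsub>Aq N q\<^esub> in_Aq N q p'"
  using ring_hom_add[OF in_Aq_hom] by (metis free_algebra_ops(4))

lemma rtt_cong_refl: "p \<in> carrier (free_algebra N) \<Longrightarrow> rtt_cong N q p p"
  by (simp add: rtt_cong_def)

lemma rtt_cong_trans [trans]: "rtt_cong N q p p' \<Longrightarrow> rtt_cong N q p' p'' \<Longrightarrow> rtt_cong N q p p''"
  by (simp add: rtt_cong_def)

lemma rtt_cong_mult: "rtt_cong N q a b \<Longrightarrow> rtt_cong N q c d \<Longrightarrow> rtt_cong N q (a * c) (b * d)"
  unfolding rtt_cong_def by (simp add: in_Aq_mult free_algebra_closed)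

lemma rtt_cong_add: "rtt_cong N q a b \<Longrightarrow> rtt_cong N q c d \<Longrightarrow> rtt_cong N q (a + c) (b + d)"
  unfolding rtt_cong_def by (simp add: in_Aq_add free_algebra_closed)

lemma rtt_cong_sum: "(\<And>x. x \<in> A \<Longrightarrow> rtt_cong N q (f x) (g x)) \<Longrightarrow> rtt_cong N q (sum f A) (sum g A)"
  by (induction A rule: infinite_finite_induct)
    (auto intro: rtt_cong_add rtt_cong_refl free_algebra_closed)

lemma rtt_cong_prod_list:
  "(\<And>x. x \<in> set xs \<Longrightarrow> rtt_cong N q (f x) (g x)) \<Longrightarrow> rtt_cong N q (\<Prod>x\<leftarrow>xs. f x) (\<Prod>x\<leftarrow>xs. g x)"
  by (induction xs) (auto intro: rtt_cong_mult rtt_cong_refl free_algebra_closed)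

lemma rtt_cong_scal: "rtt_cong N q p p' \<Longrightarrow> rtt_cong N q (scal c * p) (scal c * p')"
  by (intro rtt_cong_mult rtt_cong_refl free_algebra_closed)

lemma scal_simps: "scal a * scal b = scal (a * b)" "scal 1 = 1" "scal 0 = 0"
  by (simp_all add: scal_def mult_single)

lemma scal_sum: "scal (sum f A) = (\<Sum>x\<in>A. scal (f x))"
  by (induction A rule: infinite_finite_induct) (simp_all add: scal_def single_add)

lemma scal_T_T: "T i j u * T k l v * scal c = scal c * (T i j u * T k l v)"
  by (simp add: T_def scal_def mult_single)

text \<open>No term of \<open>R_mat\<close> with two different indices has an entry in the row or
  column (a, a).\<close>

lemma R_mat_diag:
  assumes "a \<in> {1..N}"
  shows "R_mat N q u v (a, a) z = (if z = (a, a) then ff q u v else 0)"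
    and "R_mat N q u v z (a, a) = (if z = (a, a) then ff q u v else 0)"
proof -
  obtain c d where z: "z = (c, d)" by (cases z)
  have "tensor (unit_mat i i) (unit_mat i i) (a, a) z = (if i = a then if z = (a, a) then 1 else (0 :: complex) else 0)"
    "tensor (unit_mat i i) (unit_mat i i) z (a, a) = (if i = a then if z = (a, a) then 1 else (0 :: complex) else 0)" for i
    by (auto simp: tensor_def unit_mat_def z)
  then have 1: "(\<Sum>i\<in>{1..N}. tensor (unit_mat i i) (unit_mat i i) (a, a) z) = (if z = (a, a) then 1 else (0 :: complex))"
    "(\<Sum>i\<in>{1..N}. tensor (unit_mat i i) (unit_mat i i) z (a, a)) = (if z = (a, a) then 1 else (0 :: complex))"
    using assms by (simp_all only: sum.delta finite_atLeastAtMost if_True)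
  have "tensor (unit_mat i i) (unit_mat j j) (a, a) z = 0" "tensor (unit_mat i i) (unit_mat j j) z (a, a) = 0"
    "tensor (unit_mat i j) (unit_mat j i) (a, a) z = 0" "tensor (unit_mat i j) (unit_mat j i) z (a, a) = 0"
    if "i \<noteq> j" for i j
    using that by (auto simp: tensor_def unit_mat_def)
  then have 2: "(\<Sum>i\<in>{1..N}. \<Sum>j\<in>{i<..N}. tensor (unit_mat i i) (unit_mat j j) x y + tensor (unit_mat j j) (unit_mat i i) x y) = 0"
    "(\<Sum>i\<in>{1..N}. \<Sum>j\<in>{i<..N}. gl q u v * tensor (unit_mat i j) (unit_mat j i) x y
      + gr q u v * tensor (unit_mat j i) (unit_mat i j) x y) = 0"
    if "(x, y) = ((a, a), z) \<or> (x, y) = (z, (a, a))" for x y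
    using that by (auto intro!: sum.neutral)
  show "R_mat N q u v (a, a) z = (if z = (a, a) then ff q u v else 0)"
    "R_mat N q u v z (a, a) = (if z = (a, a) then ff q u v else 0)"
    unfolding R_mat_def using 1 2 by simp_all
qed

text \<open>The entry of the RTT relation in row (i, i) and column (j, j). There the R-matrix acts
  on both sides as the scalar \<open>f\<close>, which is invertible because of
  \<open>q\<^sup>2 * u \<noteq> v\<close>.\<close>

lemma T_commute:
  assumes q: "q \<noteq> 0" and ij: "i \<in> {1..N}" "j \<in> {1..N}" and uv: "u \<noteq> 0" "v \<noteq> 0" "u \<noteq> v" "q\<^sup>2 * u \<noteq> v"
  shows "rtt_cong N q (T i j u * T i j v) (T i j v * T i j u)"
proof -
  define f where "f = ff q u v"
  have f: "f \<noteq> 0" unfolding f_def using uv q by (intro ff_nonzero)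
  have c: "T i j u * T i j v \<in> carrier (free_algebra N)" "T i j v * T i j u \<in> carrier (free_algebra N)"
    using ij uv(1,2) by (simp_all add: free_algebra_closed(6) T_closed del: One_nat_def atLeastAtMost_iff)
  have "T1 u (i, i) z * T2 v z (j, j) = (if z = (j, i) then T i j u * T i j v else 0)"
    "T2 v (i, i) z * T1 u z (j, j) = (if z = (i, j) then T i j v * T i j u else 0)" for z
    by (cases z; simp add: T1_def T2_def tensor_def id_mat_def)+
  then have TT: "tmult N (T1 u) (T2 v) (i, i) (j, j) = T i j u * T i j v"
    "tmult N (T2 v) (T1 u) (i, i) (j, j) = T i j v * T i j u"
    using ij unfolding tmult_def by simp_all
  have "tmult N (\<lambda>x y. scal (R_mat N q u v x y)) (tmult N (T1 u) (T2 v)) (i, i) (j, j) = scal f * (T i j u * T i j v)"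
  proof -
    have "scal (R_mat N q u v (i, i) z) * tmult N (T1 u) (T2 v) z (j, j)
      = (if z = (i, i) then scal f * tmult N (T1 u) (T2 v) z (j, j) else 0)" for z
      by (simp add: R_mat_diag(1)[OF ij(1)] scal_simps f_def)
    then show ?thesis
      unfolding tmult_def[of N "\<lambda>x y. scal (R_mat N q u v x y)"] using ij by (simp add: TT)
  qed
  moreover have "tmult N (tmult N (T2 v) (T1 u)) (\<lambda>x y. scal (R_mat N q u v x y)) (i, i) (j, j) = T i j v * T i j u * scal f"
  proof -
    have "B z * scal (R_mat N q u v z (j, j)) = (if z = (j, j) then B z * scal f else 0)" for B z
      by (simp add: R_mat_diag(2)[OF ij(2)] scal_simps f_def)
    then show ?thesis
      unfolding tmult_def[of N _ "\<lambda>x y. scal (R_mat N q u v x y)"] using ij by (simp add: TT)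
  qed
  ultimately have "scal f * (T i j u * T i j v) - T i j v * T i j u * scal f \<in> rtt_relators N q"
    unfolding rtt_relators_def mem_Collect_eq using ij uv
    by (intro exI[of _ u] exI[of _ v] exI[of _ "(i, i)"] exI[of _ "(j, j)"]) simp
  then have r: "scal f * (T i j u * T i j v) - scal f * (T i j v * T i j u) \<in> rtt_ideal N q" (is "?a - ?b \<in> _")
    unfolding rtt_ideal_def scal_T_T
    using ring.genideal_self[OF ring_free_algebra rtt_relators_carrier] by blast
  have ab: "?a \<in> carrier (free_algebra N)" "?b \<in> carrier (free_algebra N)"
    using c by (auto intro: free_algebra_closed)
  interpret I: ideal "rtt_ideal N q" "free_algebra N" by (rule ideal_rtt_ideal)
  interpret A: ring "Aq N q" by (rule ring_Aq)
  have "in_Aq N q (?a - ?b) = \<zero>\<^bsub>Aq N q\<^esub>"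
    unfolding in_Aq_def Aq_def FactRing_def using I.a_rcos_const[OF r] by simp
  then have "in_Aq N q ((?a - ?b) + ?b) = in_Aq N q ?b"
    using ab ring_hom_closed[OF in_Aq_hom ab(2)]
    by (subst in_Aq_add) (auto intro: free_algebra_closed)
  then have "rtt_cong N q ?a ?b" using ab by (simp add: rtt_cong_def)
  then have "rtt_cong N q (scal (inverse f) * ?a) (scal (inverse f) * ?b)" by (rule rtt_cong_scal)
  then show ?thesis using f by (simp add: mult.assoc[symmetric] scal_simps)
qed

text \<open>The head of \<open>xs\<close> is located in \<open>ys\<close> and moved to the front
  across its predecessors; distinctness ensures that it only passes different elements of
  \<open>A\<close>.\<close>

lemma rtt_cong_commuting_perm:
  assumes "\<And>x. x \<in> A \<Longrightarrow> f x \<in> carrier (free_algebra N)"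
    and "\<And>x y. x \<in> A \<Longrightarrow> y \<in> A \<Longrightarrow> x \<noteq> y \<Longrightarrow> rtt_cong N q (f x * f y) (f y * f x)"
  shows "distinct xs \<Longrightarrow> distinct ys \<Longrightarrow> set xs = set ys \<Longrightarrow> set ys \<subseteq> A \<Longrightarrow>
    rtt_cong N q (\<Prod>x\<leftarrow>xs. f x) (\<Prod>x\<leftarrow>ys. f x)"
proof (induction xs arbitrary: ys)
  case Nil
  then show ?case by (auto intro: rtt_cong_refl free_algebra_closed)
next
  case (Cons x xs)
  have closed: "(\<Prod>x\<leftarrow>zs. f x) \<in> carrier (free_algebra N)" if "set zs \<subseteq> A" for zs
    using that by (induction zs) (auto intro: free_algebra_closed assms(1))
  obtain as bs where ys: "ys = as @ x # bs" using Cons.prems by (metis list.set_intros(1) split_list)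
  have xA: "x \<in> A" using Cons.prems by auto
  have move: "rtt_cong N q (f x * (\<Prod>x\<leftarrow>zs. f x)) ((\<Prod>x\<leftarrow>zs. f x) * f x)" if "set zs \<subseteq> A - {x}" for zs
    using that
  proof (induction zs)
    case Nil
    then show ?case using xA by (auto intro: rtt_cong_refl assms(1))
  next
    case (Cons z zs)
    have zs: "set zs \<subseteq> A" using Cons.prems by auto
    have "rtt_cong N q (f x * f z * (\<Prod>x\<leftarrow>zs. f x)) (f z * f x * (\<Prod>x\<leftarrow>zs. f x))"
      using Cons.prems xA closed[OF zs] by (intro rtt_cong_mult rtt_cong_refl assms(2)) auto
    also have "f z * f x * (\<Prod>x\<leftarrow>zs. f x) = f z * (f x * (\<Prod>x\<leftarrow>zs. f x))" by (simp add: mult.assoc)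
    also have "rtt_cong N q \<dots> (f z * ((\<Prod>x\<leftarrow>zs. f x) * f x))"
      using Cons.prems by (intro rtt_cong_mult[OF rtt_cong_refl Cons.IH] assms(1)) auto
    finally show ?case by (simp add: mult.assoc)
  qed
  have sub: "set as \<subseteq> A - {x}" "set bs \<subseteq> A - {x}" using Cons.prems unfolding ys by auto
  have "rtt_cong N q (\<Prod>x\<leftarrow>xs. f x) (\<Prod>x\<leftarrow>as @ bs. f x)"
    using Cons.prems sub unfolding ys by (intro Cons.IH) auto
  then have "rtt_cong N q (\<Prod>x\<leftarrow>x # xs. f x) (f x * ((\<Prod>x\<leftarrow>as. f x) * (\<Prod>x\<leftarrow>bs. f x)))"
    using xA by (auto intro!: rtt_cong_mult rtt_cong_refl assms(1))
  also have "f x * ((\<Prod>x\<leftarrow>as. f x) * (\<Prod>x\<leftarrow>bs. f x)) = f x * (\<Prod>x\<leftarrow>as. f x) * (\<Prod>x\<leftarrow>bs. f x)"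
    by (simp add: mult.assoc)
  also have "rtt_cong N q \<dots> ((\<Prod>x\<leftarrow>as. f x) * f x * (\<Prod>x\<leftarrow>bs. f x))"
    using sub by (intro rtt_cong_mult move rtt_cong_refl closed) auto
  finally show ?case by (simp add: ys mult.assoc)
qed

lemma T_prod_cong:
  assumes q: "q \<noteq> 0" and g: "generic N q n t" and ij: "i \<in> {1..N}" "j \<in> {1..N}" and k: "k \<in> {1..<N}"
    and xs: "distinct xs" "distinct ys" "set xs = set ys" "set ys \<subseteq> {1..n k}"
  shows "rtt_cong N q (\<Prod>l\<leftarrow>xs. T i j (t k l)) (\<Prod>l\<leftarrow>ys. T i j (t k l))"
proof (rule rtt_cong_commuting_perm[OF _ _ xs])
  fix x assume "x \<in> {1..n k}"
  then show "T i j (t k x) \<in> carrier (free_algebra N)"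
    using genericD(1)[OF g k] ij by (intro T_closed)
next
  fix x y assume "x \<in> {1..n k}" "y \<in> {1..n k}" "x \<noteq> y"
  then show "rtt_cong N q (T i j (t k x) * T i j (t k y)) (T i j (t k y) * T i j (t k x))"
    using genericD(1)[OF g k, of x] genericD(1)[OF g k, of y] genericD(2)[OF g k _ k, of x y]
    by (intro T_commute q ij) auto
qed

lemma T_prod_subpar: "T_prod i j (subpar t P k p) = (\<Prod>l\<leftarrow>sorted_list_of_set (P k p). T i j (t k l))"
  by (simp add: T_prod_def subpar_def o_def)

text \<open>An equation in the free algebra for every function \<open>V\<close> of the partition.
  Hence it can be used with q^-1 in the coefficients while the values of \<open>V\<close> are words
  to be read modulo the relations for q.\<close>

lemma sum_over_partitions:
  assumes N: "1 \<le> N" and q: "q \<noteq> 0" "q\<^sup>2 \<noteq> 1" and g: "generic N q n t"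
  shows "(\<Sum>m\<in>upper_permissible N n. \<Sum>\<sigma>\<in>sym_group N n.
      scal (upper_coeff N q n m (\<lambda>k l. t k (\<sigma> k l))) * V (partition_of N m \<sigma>))
    = (\<Sum>P\<in>bethe_partitions N n. scal (part_coeff N q t P) * V P)"
proof -
  let ?S = "upper_permissible N n \<times> sym_group N n"
  let ?c = "\<lambda>(m, \<sigma>). upper_coeff N q n m (\<lambda>k l. t k (\<sigma> k l))"
  have "(\<Sum>m\<in>upper_permissible N n. \<Sum>\<sigma>\<in>sym_group N n.
      scal (upper_coeff N q n m (\<lambda>k l. t k (\<sigma> k l))) * V (partition_of N m \<sigma>))
    = (\<Sum>x\<in>?S. scal (?c x) * V (case_prod (partition_of N) x))"
    by (simp add: sum.cartesian_product case_prod_beta)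
  also have "\<dots> = (\<Sum>P\<in>bethe_partitions N n. \<Sum>x | x \<in> ?S \<and> case_prod (partition_of N) x = P. scal (?c x) * V (case_prod (partition_of N) x))"
    by (rule sum.group[symmetric])
      (auto simp: finite_upper_permissible finite_sym_group finite_bethe_partitions partition_of_bethe(1))
  also have "\<dots> = (\<Sum>P\<in>bethe_partitions N n. scal (part_coeff N q t P) * V P)"
  proof (rule sum.cong[OF refl])
    fix P assume P: "P \<in> bethe_partitions N n"
    have "(\<Sum>x | x \<in> ?S \<and> case_prod (partition_of N) x = P. scal (?c x) * V (case_prod (partition_of N) x))
      = scal (\<Sum>x | x \<in> ?S \<and> case_prod (partition_of N) x = P. ?c x) * V P"
      unfolding scal_sum sum_distrib_right by (rule sum.cong) auto
    moreover have S: "{x. x \<in> ?S \<and> case_prod (partition_of N) x = P}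
      = {(m, \<sigma>). m \<in> upper_permissible N n \<and> \<sigma> \<in> sym_group N n \<and> partition_of N m \<sigma> = P}" by auto
    ultimately show "(\<Sum>x | x \<in> ?S \<and> case_prod (partition_of N) x = P. scal (?c x) * V (case_prod (partition_of N) x))
      = scal (part_coeff N q t P) * V P"
      by (simp only: sum_fiber_upper_coeff[OF N q g P])
  qed
  finally show ?thesis .
qed

lemma partition_of_arrangement_of:
  assumes "m \<in> upper_permissible N n" "\<sigma> \<in> sym_group N n"
  shows "distinct (arrangement_of N m \<sigma> k p)" "set (arrangement_of N m \<sigma> k p) = partition_of N m \<sigma> k p" "partition_of N m \<sigma> k p \<subseteq> {1..n k}"
    "finite (partition_of N m \<sigma> k p)"
proof -
  show "distinct (arrangement_of N m \<sigma> k p)"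
    using partition_of_bethe(2)[OF assms] by (simp add: arrangements_def permutations_of_set_def del: split_paired_All)
  show s: "set (arrangement_of N m \<sigma> k p) = partition_of N m \<sigma> k p" by (simp add: partition_of_def)
  then show "finite (partition_of N m \<sigma> k p)" by (metis List.finite_set)
  show "partition_of N m \<sigma> k p \<subseteq> {1..n k}"
  proof (cases "p \<in> pairs N k")
    case True
    then show ?thesis
      using bethe_partitionsD(2)[OF partition_of_bethe(1)[OF assms]] pairs_range[OF True] by blast
  next
    case False
    then show ?thesis by (simp add: partition_of_def arrangement_of_def)
  qed
qed

definition upper_word :: "nat \<Rightarrow> (nat \<Rightarrow> nat) \<Rightarrow> (nat \<Rightarrow> nat \<Rightarrow> nat) \<Rightarrow> (nat \<Rightarrow> nat \<Rightarrow> complex) \<Rightarrow> ncpoly" where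
  "upper_word N n m t = (\<Prod>j\<leftarrow>[1..<N]. \<Prod>i\<leftarrow>rev [j..<N].
          \<Prod>l\<leftarrow>[n j - m j i + 1 ..< n j - m j (i + 1) + 1]. T j (i + 1) (t j l))
     * (\<Prod>j\<leftarrow>[1..<N]. \<Prod>l\<leftarrow>[1 ..< n j - m j j + 1]. T j j (t j l))"

definition part_word :: "nat \<Rightarrow> (nat \<Rightarrow> nat \<Rightarrow> complex) \<Rightarrow> (nat \<Rightarrow> nat \<times> nat \<Rightarrow> nat set) \<Rightarrow> ncpoly" where
  "part_word N t P = (\<Prod>k\<leftarrow>[1..<N]. \<Prod>j\<leftarrow>rev [k + 1..<N + 1]. T_prod k j (subpar t P k (k, j - 1)))
       * (\<Prod>k\<leftarrow>[2..<N]. \<Prod>p\<leftarrow>filter (\<lambda>p. p \<prec> (k, k)) (pair_list N k). T_prod k k (subpar t P k p))"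

text \<open>Second components on level k are at least k, so \<open>p \<prec> (k, k)\<close> means
  that the first component is below k. The group k comes last and fills the final
  \<open>m k k\<close> positions.\<close>

lemma diag_positions:
  assumes m: "m \<in> upper_permissible N n" and k: "k \<in> {1..<N}"
  shows "(\<Union>p\<in>{p \<in> pairs N k. p \<prec> (k, k)}. set (block_positions m k p)) = {1..n k - m k k}"
proof -
  obtain c where c: "k = Suc c" using k by (cases k) auto
  have "set (block_positions m k (k, b)) \<inter> {1..n k - m k k} = {}" if "k \<le> b" "b < N" for b
  proof -
    have "m k b \<le> m k k" using that k by (auto intro: upper_antimono[OF m])
    then have "n k - m k k \<le> n k - m k b" by simp
    then show ?thesis using m_sum_diag[OF m k] by (auto simp: block_positions_def)
  qed
  moreover have "set (block_positions m k (a, b)) \<subseteq> {1..n k - m k k}" if "(a, b) \<in> pairs N k" "a < k" for a b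
  proof
    fix x assume x: "x \<in> set (block_positions m k (a, b))"
    then have "x \<in> {1..n k}" using block_positions_union[OF m k] that by blast
    moreover have "x \<le> m_sum m a k" using x by (auto simp: block_positions_def)
    moreover have "m_sum m a k \<le> m_sum m c k" using that by (intro m_sum_mono) (simp add: c)
    moreover have "m_sum m c k = n k - m k k" using m_sum_diag[OF m k] by (simp add: c m_sum_Suc)
    ultimately show "x \<in> {1..n k - m k k}" by simp
  qed
  moreover have "p \<prec> (k, k) \<longleftrightarrow> fst p < k" if "p \<in> pairs N k" for p
  proof (cases p)
    case (Pair a b)
    then have "k \<le> b" using that by (simp add: pairs_iff)
    then show ?thesis by (auto simp: Pair prec_def)
  qed
  moreover have "(\<Union>p\<in>pairs N k. set (block_positions m k p)) = {1..n k}" by (rule block_positions_union[OF m k])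
  ultimately show ?thesis
  proof (intro equalityI subsetI, goal_cases)
    case (1 x)
    then show ?case by fastforce
  next
    case (2 x)
    then have "x \<in> (\<Union>p\<in>pairs N k. set (block_positions m k p))" by auto
    then obtain a b where p: "(a, b) \<in> pairs N k" "x \<in> set (block_positions m k (a, b))" by auto
    then have "a \<le> k" "k \<le> b" "b < N" by (auto simp: pairs_iff)
    moreover have "a \<noteq> k" using 2(1)[of b] 2(5) p \<open>k \<le> b\<close> \<open>b < N\<close> by blast
    ultimately show ?case using p 2(3)[OF p(1)] by auto
  qed
qed

lemma upper_word_cong:
  assumes q: "q \<noteq> 0" and g: "generic N q n t" and m: "m \<in> upper_permissible N n" and \<sigma>: "\<sigma> \<in> sym_group N n"
  shows "rtt_cong N q (upper_word N n m (\<lambda>k l. t k (\<sigma> k l))) (part_word N t (partition_of N m \<sigma>))"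
proof -
  let ?P = "partition_of N m \<sigma>"
  note P = partition_of_arrangement_of[OF m \<sigma>]
  have "rtt_cong N q (\<Prod>l\<leftarrow>[n j - m j i + 1 ..< n j - m j (i + 1) + 1]. T j (i + 1) (t j (\<sigma> j l)))
     (T_prod j (i + 1) (subpar t ?P j (j, i)))" if j: "j \<in> {1..<N}" and i: "i \<in> {j..<N}" for i j
  proof -
    have "(j, i) \<in> pairs N j" using i j by (auto simp: pairs_iff)
    \<comment> \<open>On level j the group j ends at \<open>m_sum m j j = n j\<close>, so the
      positions of the block (j, i) are the range used in \<open>pre_bethe\<close>.\<close>
    then have "arrangement_of N m \<sigma> j (j, i) = map (\<sigma> j) [n j - m j i + 1 ..< n j - m j (i + 1) + 1]"
      using m_sum_diag[OF m j] by (simp add: arrangement_of_def block_positions_def)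
    then have "(\<Prod>l\<leftarrow>[n j - m j i + 1 ..< n j - m j (i + 1) + 1]. T j (i + 1) (t j (\<sigma> j l)))
      = (\<Prod>l\<leftarrow>arrangement_of N m \<sigma> j (j, i). T j (i + 1) (t j l))"
      by (simp add: o_def del: upt_Suc)
    then show ?thesis
      unfolding T_prod_subpar using i j P(1,2,4) P(3)[of j "(j, i)"]
      by (auto intro!: T_prod_cong[OF q g] simp del: One_nat_def)
  qed
  then have "rtt_cong N q (\<Prod>j\<leftarrow>[1..<N]. \<Prod>i\<leftarrow>rev [j..<N].
          \<Prod>l\<leftarrow>[n j - m j i + 1 ..< n j - m j (i + 1) + 1]. T j (i + 1) (t j (\<sigma> j l)))
     (\<Prod>j\<leftarrow>[1..<N]. \<Prod>i\<leftarrow>rev [j..<N]. T_prod j (i + 1) (subpar t ?P j (j, i)))"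
    by (intro rtt_cong_prod_list) simp
  also have "(\<Prod>j\<leftarrow>[1..<N]. \<Prod>i\<leftarrow>rev [j..<N]. T_prod j (i + 1) (subpar t ?P j (j, i)))
    = (\<Prod>k\<leftarrow>[1..<N]. \<Prod>j\<leftarrow>rev [k + 1..<N + 1]. T_prod k j (subpar t ?P k (k, j - 1)))"
  proof -
    have "rev [k + 1..<N + 1] = map Suc (rev [k..<N])" for k
      by (simp add: map_Suc_upt rev_map[symmetric] del: upt_Suc)
    then show ?thesis by (simp add: o_def del: upt_Suc)
  qed
  finally have 1: "rtt_cong N q (\<Prod>j\<leftarrow>[1..<N]. \<Prod>i\<leftarrow>rev [j..<N].
          \<Prod>l\<leftarrow>[n j - m j i + 1 ..< n j - m j (i + 1) + 1]. T j (i + 1) (t j (\<sigma> j l)))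
     (\<Prod>k\<leftarrow>[1..<N]. \<Prod>j\<leftarrow>rev [k + 1..<N + 1]. T_prod k j (subpar t ?P k (k, j - 1)))" .
  have "rtt_cong N q (\<Prod>l\<leftarrow>[1 ..< n k - m k k + 1]. T k k (t k (\<sigma> k l)))
     (\<Prod>p\<leftarrow>filter (\<lambda>p. p \<prec> (k, k)) (pair_list N k). T_prod k k (subpar t ?P k p))" if k: "k \<in> {1..<N}" for k
  proof -
    let ?ps = "filter (\<lambda>p. p \<prec> (k, k)) (pair_list N k)"
    let ?ys = "concat (map (\<lambda>p. sorted_list_of_set (?P k p)) ?ps)"
    have inj: "inj (\<sigma> k)" using sym_groupD(1)[OF \<sigma> k] by (rule permutes_inj)
    have "(\<Prod>p\<leftarrow>ps. \<Prod>l\<leftarrow>h p. F l) = (\<Prod>l\<leftarrow>concat (map h ps). F l)"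
      for ps and h :: "nat \<times> nat \<Rightarrow> nat list" and F :: "nat \<Rightarrow> ncpoly"
      by (induction ps) simp_all
    then have "(\<Prod>p\<leftarrow>?ps. T_prod k k (subpar t ?P k p)) = (\<Prod>l\<leftarrow>?ys. T k k (t k l))"
      unfolding T_prod_subpar .
    moreover have "(\<Prod>l\<leftarrow>[1 ..< n k - m k k + 1]. T k k (t k (\<sigma> k l)))
       = (\<Prod>l\<leftarrow>map (\<sigma> k) [1 ..< n k - m k k + 1]. T k k (t k l))" by (simp add: o_def del: upt_Suc)
    moreover have "rtt_cong N q \<dots> (\<Prod>l\<leftarrow>?ys. T k k (t k l))"
    proof (rule T_prod_cong[OF q g])
      show "distinct (map (\<sigma> k) [1 ..< n k - m k k + 1])"
        by (auto simp: distinct_map intro: inj_on_subset[OF inj])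
      have "disjoint_family_on (?P k) (pairs N k)"
        by (rule bethe_partitionsD(3)[OF partition_of_bethe(1)[OF m \<sigma>] k])
      then have "disjoint_family_on (?P k) (set ?ps)"
        by (rule disjoint_family_on_mono[rotated]) auto
      then show "distinct ?ys"
        using P by (intro distinct_concat_disjoint) (auto simp: distinct_pair_list)
      have "set ?ys = (\<Union>p\<in>{p \<in> pairs N k. p \<prec> (k, k)}. \<sigma> k ` set (block_positions m k p))"
        using P by (auto simp: partition_of_def arrangement_of_def)
      also have "\<dots> = \<sigma> k ` {1..n k - m k k}"
        unfolding diag_positions[OF m k, symmetric] by (rule image_UN[symmetric])
      finally show "set (map (\<sigma> k) [1 ..< n k - m k k + 1]) = set ?ys"
        by (simp add: atLeastLessThanSuc_atLeastAtMost del: upt_Suc)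
      show "set ?ys \<subseteq> {1..n k}" using P by (simp add: UN_subset_iff)
    qed (use k in auto)
    ultimately show ?thesis by simp
  qed
  then have "rtt_cong N q (\<Prod>k\<leftarrow>[1..<N]. \<Prod>l\<leftarrow>[1 ..< n k - m k k + 1]. T k k (t k (\<sigma> k l)))
     (\<Prod>k\<leftarrow>[1..<N]. \<Prod>p\<leftarrow>filter (\<lambda>p. p \<prec> (k, k)) (pair_list N k). T_prod k k (subpar t ?P k p))"
    by (intro rtt_cong_prod_list) simp
  also have "(\<Prod>k\<leftarrow>[1..<N]. \<Prod>p\<leftarrow>filter (\<lambda>p. p \<prec> (k, k)) (pair_list N k). T_prod k k (subpar t ?P k p))
    = (\<Prod>k\<leftarrow>[2..<N]. \<Prod>p\<leftarrow>filter (\<lambda>p. p \<prec> (k, k)) (pair_list N k). T_prod k k (subpar t ?P k p))"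
  proof (cases "1 < N")
    case True
    \<comment> \<open>No pair precedes (1, 1), so level 1 contributes no diagonal factor and the
      product may start at 2.\<close>
    have "filter (\<lambda>p. p \<prec> (1, 1)) (pair_list N 1) = []"
      by (auto simp: filter_empty_conv pairs_iff prec_def)
    moreover have "[1..<N] = 1 # [2..<N]" using True by (simp add: upt_rec numeral_2_eq_2)
    ultimately show ?thesis by simp
  qed simp
  finally show ?thesis unfolding upper_word_def part_word_def by (intro rtt_cong_mult 1)
qed

lemma pre_bethe_sum_over_partitions:
  assumes N: "1 \<le> N" and q: "q \<noteq> 0" "q\<^sup>2 \<noteq> 1" and g: "generic N q n t"
  shows "in_Aq N q (pre_bethe N q n t) =
    in_Aq N q (\<Sum>P\<in>bethe_partitions N n. scal (part_coeff N q t P) * part_word N t P)"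
proof -
  have 1: "pre_bethe N q n t = (\<Sum>m\<in>upper_permissible N n. \<Sum>\<sigma>\<in>sym_group N n.
      scal (upper_coeff N q n m (\<lambda>k l. t k (\<sigma> k l))) * upper_word N n m (\<lambda>k l. t k (\<sigma> k l)))"
    unfolding pre_bethe_def Sym_def upper_coeff_def upper_word_def by (simp only: mult.assoc)
  have "rtt_cong N q (pre_bethe N q n t) (\<Sum>m\<in>upper_permissible N n. \<Sum>\<sigma>\<in>sym_group N n.
      scal (upper_coeff N q n m (\<lambda>k l. t k (\<sigma> k l))) * part_word N t (partition_of N m \<sigma>))"
    unfolding 1 by (intro rtt_cong_sum rtt_cong_scal upper_word_cong q g)
  then show ?thesis
    unfolding sum_over_partitions[OF N q g] by (simp add: rtt_cong_def)
qed

section \<open>Transfer of the coefficients under k to N - k and q to q^-1, and the second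
  formula\<close>

section \<open>Reflection of the levels\<close>

definition lower_coeff ::
  "nat \<Rightarrow> complex \<Rightarrow> (nat \<Rightarrow> nat) \<Rightarrow> (nat \<Rightarrow> nat \<Rightarrow> nat) \<Rightarrow> (nat \<Rightarrow> nat \<Rightarrow> complex) \<Rightarrow> complex" where
  "lower_coeff N q n s t = beta N q n t
       * (\<Prod>j\<in>{1..<N}. \<Prod>i\<in>{1..j}.
            1 / fact (s j i - s j (i - 1))
            * (\<Prod>l\<in>{s j (i - 1) <.. s j i}. \<Prod>l'\<in>{s j (i - 1) <..< l}.
                 inverse (ff q (t j l) (t j l'))))
       * (\<Prod>j\<in>{2..<N}. \<Prod>i\<in>{1..<j}. \<Prod>l\<in>{1..s j i}.
            gr q (t (i + 1) (n (i + 1) - s_sum N s j (i + 1) + l)) (t i (n i - s_sum N s j i + l))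
            * (\<Prod>l'\<in>{1 .. n (i + 1) - s_sum N s j (i + 1) + l - 1}.
                 ff q (t (i + 1) l') (t i (n i - s_sum N s j i + l))))"

definition lower_word :: "nat \<Rightarrow> (nat \<Rightarrow> nat) \<Rightarrow> (nat \<Rightarrow> nat \<Rightarrow> nat) \<Rightarrow> (nat \<Rightarrow> nat \<Rightarrow> complex) \<Rightarrow> ncpoly" where
  "lower_word N n s t = (\<Prod>j\<leftarrow>rev [1..<N]. \<Prod>i\<leftarrow>[1..<j + 1].
          \<Prod>l\<leftarrow>[s j (i - 1) + 1 ..< s j i + 1]. T i (j + 1) (t j l))
     * (\<Prod>j\<leftarrow>rev [1..<N]. \<Prod>l\<leftarrow>[s j j + 1 ..< n j + 1]. T (j + 1) (j + 1) (t j l))"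

definition part_coeff_hat ::
  "nat \<Rightarrow> complex \<Rightarrow> (nat \<Rightarrow> nat \<Rightarrow> complex) \<Rightarrow> (nat \<Rightarrow> nat \<times> nat \<Rightarrow> nat set) \<Rightarrow> complex" where
  "part_coeff_hat N q t P = (\<Prod>k\<in>{1..<N}. \<Prod>(p, p') | p \<in> pairs N k \<and> p' \<in> pairs N k \<and> p \<prec>\<^sup>t p'.
                ff_prod q (subpar t P k p') (subpar t P k p))
           * (\<Prod>k\<in>{2..<N}.
                (\<Prod>(p, p') | p \<in> pairs N k \<and> p' \<in> pairs N (k - 1) \<and> p \<prec>\<^sup>t p'.
                   ff_prod q (subpar t P k p) (subpar t P (k - 1) p'))
              * (\<Prod>(i, j) | (i, j) \<in> pairs N k \<and> (i, j) \<in> pairs N (k - 1) \<and> i < j.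
                   izergin_r q (subpar t P k (i, j)) (subpar t P (k - 1) (i, j))))"

definition part_word_hat :: "nat \<Rightarrow> (nat \<Rightarrow> nat \<Rightarrow> complex) \<Rightarrow> (nat \<Rightarrow> nat \<times> nat \<Rightarrow> nat set) \<Rightarrow> ncpoly" where
  "part_word_hat N t P = (\<Prod>k\<leftarrow>rev [1..<N]. \<Prod>j\<leftarrow>[1..<k + 1]. T_prod j (k + 1) (subpar t P k (j, k)))
       * (\<Prod>k\<leftarrow>rev [1..<N - 1]. \<Prod>p\<leftarrow>filter (\<lambda>p. (k, k) \<prec>\<^sup>t p) (pair_list N k).
            T_prod (k + 1) (k + 1) (subpar t P k p))"

text \<open>Used in both directions between lower and upper matrices. Truncated subtraction sends
  indices from \<open>N\<close> on to 0, where permissible matrices vanish.\<close>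

definition flip_mat :: "nat \<Rightarrow> (nat \<Rightarrow> nat \<Rightarrow> nat) \<Rightarrow> nat \<Rightarrow> nat \<Rightarrow> nat" where
  "flip_mat N s i j = s (N - i) (N - j)"

definition flip_pos :: "nat \<Rightarrow> nat \<Rightarrow> nat" where
  "flip_pos c l = (if l \<in> {1..c} then c + 1 - l else l)"

text \<open>The reversal acts on the positions, before the permutation. The labels of the parameters
  do not change, so the reflected partition consists of the same index sets.\<close>

definition flip_perm :: "nat \<Rightarrow> (nat \<Rightarrow> nat) \<Rightarrow> (nat \<Rightarrow> nat \<Rightarrow> nat) \<Rightarrow> nat \<Rightarrow> nat \<Rightarrow> nat" where
  "flip_perm N n \<sigma> k = (if k \<in> {1..<N} then \<sigma> (N - k) \<circ> flip_pos (n (N - k)) else id)"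

text \<open>i <= k <= j is equivalent to N - j <= N - k <= N - i, hence the exchange of the
  components.\<close>

definition flip_pair :: "nat \<Rightarrow> nat \<times> nat \<Rightarrow> nat \<times> nat" where
  "flip_pair N p = (N - snd p, N - fst p)"

definition flip_part :: "nat \<Rightarrow> (nat \<Rightarrow> nat \<times> nat \<Rightarrow> nat set) \<Rightarrow> nat \<Rightarrow> nat \<times> nat \<Rightarrow> nat set" where
  "flip_part N P k p = P (N - k) (flip_pair N p)"

text \<open>Replacing \<open>q\<close> by its inverse exchanges the arguments of $\mathsf f$ and turns
  $\mathsf g^{(r)}$ into $\mathsf g^{(l)}$; this compensates for the reversal of the levels.\<close>

lemma ff_inverse: "ff (inverse q) u v = ff q v u"
proof -
  have "ff (inverse q) u v = (- (q * v - inverse q * u)) / (- (v - u))" by (simp add: ff_def)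
  then show ?thesis by (simp only: minus_divide_divide ff_def)
qed

lemma gl_inverse: "gl (inverse q) u v = gr q v u"
proof -
  have "gg (inverse q) u v = (- (q - inverse q)) / (- (v - u))" by (simp add: gg_def)
  then have "gg (inverse q) u v = gg q v u" by (simp only: minus_divide_divide gg_def)
  then show ?thesis by (simp add: gl_def gr_def)
qed

lemma ff_prod_inverse: "ff_prod (inverse q) xs ys = ff_prod q ys xs"
  unfolding ff_prod_def ff_inverse
proof (induction xs)
  case Nil
  show ?case by (induction ys) auto
next
  case (Cons x xs)
  have "(\<Prod>y\<leftarrow>ys. f y * g y) = (\<Prod>y\<leftarrow>ys. f y) * (\<Prod>y\<leftarrow>ys. g y)" for f g :: "complex \<Rightarrow> complex"
    by (induction ys) (auto simp: mult_ac)
  then show ?case using Cons by simp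
qed

lemma flip_pos_invol: "flip_pos c (flip_pos c l) = l"
  by (auto simp: flip_pos_def)

lemma flip_pos_permutes: "flip_pos c permutes {1..c}"
proof (rule bij_imp_permutes)
  show "bij_betw (flip_pos c) {1..c} {1..c}"
    by (rule bij_betw_byWitness[of _ "flip_pos c"]) (auto simp: flip_pos_def)
qed (auto simp: flip_pos_def)

lemma flip_perm_sym:
  assumes "\<sigma> \<in> sym_group N n"
  shows "flip_perm N n \<sigma> \<in> sym_group N (\<lambda>k. n (N - k))"
  unfolding sym_group_def mem_Collect_eq
proof (intro conjI ballI allI impI)
  fix k assume k: "k \<in> {1..<N}"
  then have "\<sigma> (N - k) permutes {1..n (N - k)}" using assms by (intro sym_groupD) auto
  from permutes_compose[OF flip_pos_permutes this] show "flip_perm N n \<sigma> k permutes {1..n (N - k)}"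
    using k by (simp add: flip_perm_def)
qed (auto simp: flip_perm_def)

lemma flip_perm_invol:
  assumes "\<sigma> \<in> sym_group N n"
  shows "flip_perm N (\<lambda>k. n (N - k)) (flip_perm N n \<sigma>) = \<sigma>"
proof
  fix k
  show "flip_perm N (\<lambda>k. n (N - k)) (flip_perm N n \<sigma>) k = \<sigma> k"
  proof (cases "k \<in> {1..<N}")
    case True
    then have "N - k \<in> {1..<N}" "N - (N - k) = k" by auto
    then show ?thesis using True by (auto simp: flip_perm_def fun_eq_iff flip_pos_invol)
  next
    case False
    then show ?thesis using sym_groupD(2)[OF assms False] unfolding flip_perm_def by (simp only: if_False)
  qed
qed

lemma lower_outside: "s \<in> lower_permissible N n \<Longrightarrow> \<not> (1 \<le> i \<and> i \<le> j \<and> j < N) \<Longrightarrow> s j i = 0"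
  unfolding lower_permissible_def by blast

lemma flip_mat_upper:
  assumes s: "s \<in> lower_permissible N n"
  shows "flip_mat N s \<in> upper_permissible N (\<lambda>k. n (N - k))"
  unfolding upper_permissible_def mem_Collect_eq
proof (intro conjI ballI allI impI)
  fix i j assume "\<not> (1 \<le> i \<and> i \<le> j \<and> j < N)"
  then have "\<not> (1 \<le> N - j \<and> N - j \<le> N - i \<and> N - i < N)" by arith
  then show "flip_mat N s i j = 0" unfolding flip_mat_def by (rule lower_outside[OF s])
next
  fix i j assume ij: "i \<in> {1..<N}" "j \<in> {i..<N}"
  have "\<forall>j\<in>{1..<N}. \<forall>i\<in>{1..j}. s j (i - 1) \<le> s j i" using s by (simp add: lower_permissible_def)
  moreover have "N - i \<in> {1..<N}" "N - j \<in> {1..N - i}" using ij by auto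
  ultimately have "s (N - i) (N - j - 1) \<le> s (N - i) (N - j)" by blast
  then show "flip_mat N s i (j + 1) \<le> flip_mat N s i j" by (simp add: flip_mat_def)
next
  fix i assume i: "i \<in> {1..<N}"
  have "\<forall>i\<in>{1..<N}. n i = (\<Sum>j\<in>{i..<N}. s j i)" using s by (simp add: lower_permissible_def)
  then have "n (N - i) = (\<Sum>j\<in>{N - i..<N}. s j (N - i))" using i by auto
  also have "\<dots> = (\<Sum>j\<in>{1..i}. flip_mat N s j i)"
    by (rule sum.reindex_bij_witness[of _ "\<lambda>j. N - j" "\<lambda>j. N - j"]) (use i in \<open>auto simp: flip_mat_def\<close>)
  finally show "n (N - i) = (\<Sum>j\<in>{1..i}. flip_mat N s j i)" .
qed

lemma flip_mat_lower:
  assumes m: "m \<in> upper_permissible N (\<lambda>k. n (N - k))"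
  shows "flip_mat N m \<in> lower_permissible N n"
  unfolding lower_permissible_def mem_Collect_eq
proof (intro conjI ballI allI impI)
  fix i j assume "\<not> (1 \<le> i \<and> i \<le> j \<and> j < N)"
  then have "\<not> (1 \<le> N - j \<and> N - j \<le> N - i \<and> N - i < N)" by arith
  then show "flip_mat N m j i = 0" unfolding flip_mat_def by (rule upper_outside[OF m])
next
  fix i j assume ij: "j \<in> {1..<N}" "i \<in> {1..j}"
  then show "flip_mat N m j (i - 1) \<le> flip_mat N m j i"
    unfolding flip_mat_def by (intro upper_antimono[OF m]) auto
next
  fix i assume i: "i \<in> {1..<N}"
  then have "N - i \<in> {1..<N}" "N - (N - i) = i" by auto
  then have "n i = (\<Sum>j\<in>{1..N - i}. m j (N - i))"
    using m_sum_diag[OF m, of "N - i"] by (simp add: m_sum_def)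
  also have "\<dots> = (\<Sum>j\<in>{i..<N}. flip_mat N m j i)"
    by (rule sum.reindex_bij_witness[of _ "\<lambda>j. N - j" "\<lambda>j. N - j"]) (use i in \<open>auto simp: flip_mat_def\<close>)
  finally show "n i = (\<Sum>j\<in>{i..<N}. flip_mat N m j i)" .
qed

text \<open>For i > N truncated subtraction gives N - (N - i) = N, so an entry beyond
  \<open>N\<close> is traded for one with index \<open>N\<close>, and both have to vanish.\<close>

lemma flip_mat_invol:
  assumes "\<And>i j. \<not> (i \<le> N \<and> j \<le> N) \<Longrightarrow> s i j = 0" "\<And>i j. i = N \<or> j = N \<Longrightarrow> s i j = 0"
  shows "flip_mat N (flip_mat N s) = s"
proof (intro ext)
  fix i j
  show "flip_mat N (flip_mat N s) i j = s i j"
    using assms(1)[of i j] assms(2)[of "N - (N - i)" "N - (N - j)"] unfolding flip_mat_def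
    by (cases "i \<le> N \<and> j \<le> N") auto
qed

lemma flip_mat_invol_lower: "s \<in> lower_permissible N n \<Longrightarrow> flip_mat N (flip_mat N s) = s"
  by (intro flip_mat_invol) (auto intro: lower_outside)

lemma flip_mat_invol_upper: "m \<in> upper_permissible N n \<Longrightarrow> flip_mat N (flip_mat N m) = m"
  by (intro flip_mat_invol) (auto intro: upper_outside)

lemma flip_pair_mem: "flip_pair N p \<in> pairs N (N - k) \<longleftrightarrow> p \<in> pairs N k"
proof (cases p)
  case (Pair i j)
  show ?thesis unfolding Pair flip_pair_def fst_conv snd_conv pairs_iff by arith
qed

lemma flip_pair_mem_iff: "k \<in> {1..<N} \<Longrightarrow> flip_pair N p \<in> pairs N k \<longleftrightarrow> p \<in> pairs N (N - k)"
  using flip_pair_mem[of N p "N - k"] by simp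

lemma flip_pair_invol: "p \<in> pairs N k \<Longrightarrow> flip_pair N (flip_pair N p) = p"
  by (cases p) (auto simp: flip_pair_def pairs_iff)

text \<open>Exchanging the components turns one lexicographic order into the other; subtraction from
  \<open>N\<close> reverses it.\<close>

lemma flip_pair_prec:
  "p \<in> pairs N k \<Longrightarrow> p' \<in> pairs N k' \<Longrightarrow> flip_pair N p \<prec> flip_pair N p' \<longleftrightarrow> p' \<prec>\<^sup>t p"
  by (cases p; cases p') (auto simp: flip_pair_def pairs_iff prec_def prec_t_def)

lemma flip_pair_image:
  assumes "k \<in> {1..<N}"
  shows "flip_pair N ` pairs N (N - k) = pairs N k" "inj_on (flip_pair N) (pairs N (N - k))"
proof -
  show "flip_pair N ` pairs N (N - k) = pairs N k"
    using flip_pair_mem_iff[OF assms] flip_pair_mem[of N _ k] flip_pair_invol[of _ N k]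
    by (auto simp: image_iff) (metis flip_pair_mem flip_pair_invol)
  show "inj_on (flip_pair N) (pairs N (N - k))"
    by (rule inj_on_inverseI[of _ "flip_pair N"]) (rule flip_pair_invol)
qed

lemma flip_part_bethe:
  assumes P: "P \<in> bethe_partitions N n"
  shows "flip_part N P \<in> bethe_partitions N (\<lambda>k. n (N - k))"
  unfolding bethe_partitions_def mem_Collect_eq
proof (intro conjI ballI allI impI)
  fix k p assume "p \<notin> pairs N k"
  then show "flip_part N P k p = {}"
    unfolding flip_part_def by (intro bethe_partitionsD(1)[OF P]) (simp only: flip_pair_mem not_False_eq_True)
next
  fix k assume k: "k \<in> {1..<N}"
  then have k': "N - k \<in> {1..<N}" "N - (N - k) = k" by auto
  note im = flip_pair_image[OF k'(1), unfolded k'(2)]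
  have "(\<Union>p\<in>pairs N k. flip_part N P k p) = (\<Union>p\<in>flip_pair N ` pairs N k. P (N - k) p)"
    by (simp add: flip_part_def)
  then show "(\<Union>p\<in>pairs N k. flip_part N P k p) = {1..n (N - k)}"
    unfolding im(1) using bethe_partitionsD(2)[OF P k'(1)] by simp
  show "disjoint_family_on (flip_part N P k) (pairs N k)"
    unfolding disjoint_family_on_def
  proof (intro ballI impI)
    fix p p' assume p: "p \<in> pairs N k" "p' \<in> pairs N k" "p \<noteq> p'"
    then have "flip_pair N p \<noteq> flip_pair N p'" using im(2) by (auto dest: inj_onD)
    moreover have "flip_pair N p \<in> pairs N (N - k)" "flip_pair N p' \<in> pairs N (N - k)"
      using p by (simp_all only: flip_pair_mem)
    ultimately show "flip_part N P k p \<inter> flip_part N P k p' = {}"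
      using bethe_partitionsD(3)[OF P k'(1)] unfolding disjoint_family_on_def flip_part_def by blast
  qed
next
  fix i j k k' assume "1 \<le> i \<and> i \<le> j \<and> j < N" "k \<in> {i..j}" "k' \<in> {i..j}"
  then show "card (flip_part N P k (i, j)) = card (flip_part N P k' (i, j))"
    unfolding flip_part_def flip_pair_def by (intro bethe_partitionsD(4)[OF P]) (auto simp: pairs_iff)
qed

lemma flip_part_invol:
  assumes P: "P \<in> bethe_partitions N n"
  shows "flip_part N (flip_part N P) = P"
proof (intro ext)
  fix k p
  show "flip_part N (flip_part N P) k p = P k p"
  proof (cases "p \<in> pairs N k")
    case True
    then have "N - (N - k) = k" using pairs_range[OF True] by auto
    then show ?thesis using flip_pair_invol[OF True] by (simp add: flip_part_def)
  next
    case False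
    then have "flip_pair N p \<notin> pairs N (N - k)" by (simp only: flip_pair_mem not_False_eq_True)
    then have "flip_part N P (N - k) (flip_pair N p) = {}"
      by (rule bethe_partitionsD(1)[OF flip_part_bethe[OF P]])
    then show ?thesis using bethe_partitionsD(1)[OF P False] by (simp add: flip_part_def[of N "flip_part N P"])
  qed
qed

text \<open>\<open>n (N - (N - k))\<close> is \<open>n k\<close> on the levels k < N, the only ones
  at which \<open>bethe_partitions\<close> looks.\<close>

lemma flip_part_bethe_back:
  "P \<in> bethe_partitions N (\<lambda>k. n (N - k)) \<Longrightarrow> flip_part N P \<in> bethe_partitions N n"
proof -
  assume P: "P \<in> bethe_partitions N (\<lambda>k. n (N - k))"
  have "bethe_partitions N (\<lambda>k. n (N - (N - k))) = bethe_partitions N n"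
    unfolding bethe_partitions_def by (intro Collect_cong conj_cong refl ball_cong) auto
  then show ?thesis using flip_part_bethe[OF P] by simp
qed

lemma subpar_flip: "subpar (\<lambda>k. t (N - k)) (flip_part N P) k p = subpar t P (N - k) (flip_pair N p)"
  by (simp add: subpar_def flip_part_def)

text \<open>Reversing positions exchanges the larger and the smaller index, so the arguments of
  \<open>F\<close> trade places; \<open>ff_inverse\<close> undoes this.\<close>

lemma prod_triangle_flip:
  assumes "a \<le> b" "b \<le> c"
  shows "(\<Prod>l\<in>{c - b<..c - a}. \<Prod>l'\<in>{c - b<..<l}. F l l') =
    (\<Prod>l\<in>{a<..b}. \<Prod>l'\<in>{a<..<l}. F (c + 1 - l') (c + 1 - l :: nat))"
  unfolding prod.Sigma[OF finite_greaterThanAtMost ballI[OF finite_greaterThanLessThan]]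
  by (rule prod.reindex_bij_witness[of _ "\<lambda>(l, l'). (c + 1 - l', c + 1 - l)" "\<lambda>(l, l'). (c + 1 - l', c + 1 - l)"])
    (use assms in auto)

lemma m_sum_flip:
  assumes "1 \<le> J" "J \<le> N"
  shows "m_sum (flip_mat N s) J I = s_sum N s (N - J) (N - I)"
  unfolding m_sum_def s_sum_def flip_mat_def
  by (rule sum.reindex_bij_witness[of _ "\<lambda>j. N - j" "\<lambda>j. N - j"]) (use assms in auto)

text \<open>\<open>\<tau>'\<close> carries the parameters of level k on level N - k, in reversed
  order. Within a level the reversal swaps earlier and later; between levels the reflection swaps
  upper and lower. In either case the arguments of \<open>ff\<close> are exchanged, which is the
  effect of inverting q.\<close>

lemma lower_coeff_flip:
  assumes s: "s \<in> lower_permissible N n"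
    and \<tau>: "\<And>k l. k \<in> {1..<N} \<Longrightarrow> l \<in> {1..n k} \<Longrightarrow> \<tau>' (N - k) l = \<tau> k (n k + 1 - l)"
  shows "lower_coeff N q n s \<tau> = upper_coeff N (inverse q) (\<lambda>k. n (N - k)) (flip_mat N s) \<tau>'"
proof -
  let ?m = "flip_mat N s"
  note m = flip_mat_upper[OF s]
  have sle: "s j i \<le> s j i'" if "i \<le> i'" "i' \<le> j" "j < N" for i i' j
  proof (cases "i = 0")
    case True
    then show ?thesis using lower_outside[OF s, of 0 j] by simp
  next
    case False
    then have "?m (N - j) (N - i) \<le> ?m (N - j) (N - i')" using that by (intro upper_antimono[OF m]) auto
    then show ?thesis using that by (simp add: flip_mat_def)
  qed
  have ssum: "s j i \<le> s_sum N s j i" "s_sum N s j i \<le> n i" if "1 \<le> i" "i \<le> j" "j < N" for i j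
  proof -
    show "s j i \<le> s_sum N s j i" unfolding s_sum_def using that by (intro member_le_sum) auto
    have "n i = (\<Sum>j\<in>{i..<N}. s j i)" using s that by (simp add: lower_permissible_def)
    then show "s_sum N s j i \<le> n i" unfolding s_sum_def using that by (simp add: sum_mono2)
  qed
  have sn: "s j i \<le> n j" if "i \<le> j" "1 \<le> j" "j < N" for i j
    using sle[of i j j] ssum[of j j] that by simp
  have re: "(\<Prod>k\<in>{1..<N}. F k) = (\<Prod>k\<in>{1..<N}. F (N - k))" for F :: "nat \<Rightarrow> complex"
    by (rule prod.reindex_bij_witness[of _ "\<lambda>k. N - k" "\<lambda>k. N - k"]) auto
  have tri: "(\<Prod>l\<in>{a<..b}. \<Prod>l'\<in>{a<..<l}. G (ff q (\<tau> k l) (\<tau> k l'))) =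
     (\<Prod>l\<in>{n k - b<..n k - a}. \<Prod>l'\<in>{n k - b<..<l}. G (ff (inverse q) (\<tau>' (N - k) l) (\<tau>' (N - k) l')))"
    if k: "k \<in> {1..<N}" and "a \<le> b" "b \<le> n k" for a b k and G :: "complex \<Rightarrow> complex"
  proof -
    have "\<tau>' (N - k) (n k + 1 - l) = \<tau> k l" if "l \<in> {1..n k}" for l
    proof -
      have "n k + 1 - l \<in> {1..n k}" "n k + 1 - (n k + 1 - l) = l" using that by auto
      then show ?thesis using \<tau>[OF k, of "n k + 1 - l"] by simp
    qed
    then show ?thesis
      unfolding prod_triangle_flip[OF that(2,3)] using that(3)
      by (intro prod.cong refl) (auto simp: ff_inverse)
  qed
  have 1: "beta N q n \<tau> = beta N (inverse q) (\<lambda>k. n (N - k)) \<tau>'"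
  proof -
    have "(\<Prod>l'\<in>{1..n k}. \<Prod>l\<in>{1..<l'}. ff q (\<tau> k l') (\<tau> k l)) =
      (\<Prod>l'\<in>{1..n k}. \<Prod>l\<in>{1..<l'}. ff (inverse q) (\<tau>' (N - k) l') (\<tau>' (N - k) l))" if "k \<in> {1..<N}" for k
      using tri[OF that, of 0 "n k" id]
      by (simp add: atLeastSucAtMost_greaterThanAtMost atLeastSucLessThan_greaterThanLessThan)
    then show ?thesis
      unfolding beta_def by (subst (2) re, intro prod.cong[OF refl]) (simp add: diff_diff_cancel)
  qed
  have 2: "(\<Prod>j\<in>{1..<N}. \<Prod>i\<in>{1..j}. 1 / fact (s j i - s j (i - 1))
            * (\<Prod>l\<in>{s j (i - 1) <.. s j i}. \<Prod>l'\<in>{s j (i - 1) <..< l}. inverse (ff q (\<tau> j l) (\<tau> j l'))))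
    = (\<Prod>j\<in>{1..<N}. \<Prod>i\<in>{j..<N}. 1 / fact (?m j i - ?m j (i + 1))
            * (\<Prod>l\<in>{n (N - j) - ?m j i <.. n (N - j) - ?m j (i + 1)}. \<Prod>l'\<in>{n (N - j) - ?m j i <..< l}.
                 inverse (ff (inverse q) (\<tau>' j l) (\<tau>' j l'))))"
  proof (subst (2) re, rule prod.cong[OF refl])
    fix j assume j: "j \<in> {1..<N}"
    show "(\<Prod>i\<in>{1..j}. 1 / fact (s j i - s j (i - 1))
            * (\<Prod>l\<in>{s j (i - 1) <.. s j i}. \<Prod>l'\<in>{s j (i - 1) <..< l}. inverse (ff q (\<tau> j l) (\<tau> j l'))))
      = (\<Prod>i\<in>{N - j..<N}. 1 / fact (?m (N - j) i - ?m (N - j) (i + 1))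
            * (\<Prod>l\<in>{n (N - (N - j)) - ?m (N - j) i <.. n (N - (N - j)) - ?m (N - j) (i + 1)}. \<Prod>l'\<in>{n (N - (N - j)) - ?m (N - j) i <..< l}.
                 inverse (ff (inverse q) (\<tau>' (N - j) l) (\<tau>' (N - j) l'))))"
    proof (rule prod.reindex_bij_witness[of _ "\<lambda>i. N - i" "\<lambda>i. N - i"])
      fix i assume i: "i \<in> {1..j}"
      have e: "N - (N - j) = j" "N - (N - i) = i" "N - (N - i + 1) = i - 1" using i j by auto
      have "s j (i - 1) \<le> s j i" "s j i \<le> n j" using i j by (auto intro!: sle sn)
      from tri[OF j this, of inverse]
      show "1 / fact (?m (N - j) (N - i) - ?m (N - j) (N - i + 1))
            * (\<Prod>l\<in>{n (N - (N - j)) - ?m (N - j) (N - i) <.. n (N - (N - j)) - ?m (N - j) (N - i + 1)}. \<Prod>l'\<in>{n (N - (N - j)) - ?m (N - j) (N - i) <..< l}.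
                 inverse (ff (inverse q) (\<tau>' (N - j) l) (\<tau>' (N - j) l')))
        = 1 / fact (s j i - s j (i - 1))
            * (\<Prod>l\<in>{s j (i - 1) <.. s j i}. \<Prod>l'\<in>{s j (i - 1) <..< l}. inverse (ff q (\<tau> j l) (\<tau> j l')))"
        unfolding flip_mat_def e by simp
    qed (use j in auto)
  qed
  define A where "A j i l = gr q (\<tau> (i + 1) (n (i + 1) - s_sum N s j (i + 1) + l)) (\<tau> i (n i - s_sum N s j i + l))
            * (\<Prod>l'\<in>{1 .. n (i + 1) - s_sum N s j (i + 1) + l - 1}.
                 ff q (\<tau> (i + 1) l') (\<tau> i (n i - s_sum N s j i + l)))" for j i l
  define B where "B i j l = gl (inverse q) (\<tau>' i (m_sum ?m j i - l)) (\<tau>' (i - 1) (m_sum ?m j (i - 1) - l))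
            * (\<Prod>l'\<in>{m_sum ?m j (i - 1) - l + 1 .. n (N - (i - 1))}.
                 ff (inverse q) (\<tau>' i (m_sum ?m j i - l)) (\<tau>' (i - 1) l'))" for i j l
  have AB: "(\<Prod>l\<in>{1..s j i}. A j i l) = (\<Prod>l\<in>{0..<?m (N - j) (N - i)}. B (N - i) (N - j) l)"
    if ji: "j \<in> {2..<N}" "i \<in> {1..<j}" for i j
  \<comment> \<open>After the reversal both offsets count the same elements, in
    \<open>lower_coeff\<close> starting from 1 and in \<open>upper_coeff\<close> from 0.\<close>
  proof (rule prod.reindex_bij_witness[of _ "\<lambda>l. l + 1" "\<lambda>l. l - 1"])
    have e: "N - (N - j) = j" "N - (N - i) = i" "N - (i + 1) = N - i - 1" "N - (N - i - 1) = i + 1"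
      using ji by auto
    fix l assume "l \<in> {1..s j i}"
    then obtain L where L: "l = L + 1" "L < s j i" by (cases l) auto
    have m1: "m_sum ?m (N - j) (N - i) = s_sum N s j i" "m_sum ?m (N - j) (N - i - 1) = s_sum N s j (i + 1)"
      using ji by (simp_all add: m_sum_flip e)
    have le: "s j i \<le> s_sum N s j i" "s_sum N s j i \<le> n i" "s j i \<le> s_sum N s j (i + 1)" "s_sum N s j (i + 1) \<le> n (i + 1)"
      using ji ssum[of i j] ssum[of "i + 1" j] sle[of i "i + 1" j] by auto
    have t1: "\<tau>' (N - i) (s_sum N s j i - L) = \<tau> i (n i - s_sum N s j i + l)"
    proof -
      have "s_sum N s j i - L \<in> {1..n i}" "n i + 1 - (s_sum N s j i - L) = n i - s_sum N s j i + l"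
        using L le by auto
      then show ?thesis using \<tau>[of "i" "s_sum N s j i - L"] ji by simp
    qed
    have t2: "\<tau>' (N - i - 1) (s_sum N s j (i + 1) - L) = \<tau> (i + 1) (n (i + 1) - s_sum N s j (i + 1) + l)"
    proof -
      have "s_sum N s j (i + 1) - L \<in> {1..n (i + 1)}" "n (i + 1) + 1 - (s_sum N s j (i + 1) - L) = n (i + 1) - s_sum N s j (i + 1) + l"
        using L le by auto
      then show ?thesis using \<tau>[of "i + 1" "s_sum N s j (i + 1) - L"] ji by simp
    qed
    have "(\<Prod>l'\<in>{s_sum N s j (i + 1) - L + 1 .. n (i + 1)}. ff (inverse q) x (\<tau>' (N - i - 1) l'))
      = (\<Prod>l'\<in>{1 .. n (i + 1) - s_sum N s j (i + 1) + l - 1}. ff q (\<tau> (i + 1) l') x)" for x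
    proof (rule prod.reindex_bij_witness[of _ "\<lambda>l. n (i + 1) + 1 - l" "\<lambda>l. n (i + 1) + 1 - l"])
      fix l' assume l': "l' \<in> {s_sum N s j (i + 1) - L + 1 .. n (i + 1)}"
      then have "\<tau>' (N - i - 1) l' = \<tau> (i + 1) (n (i + 1) + 1 - l')"
        using \<tau>[of "i + 1" l'] ji by auto
      then show "ff q (\<tau> (i + 1) (n (i + 1) + 1 - l')) x = ff (inverse q) x (\<tau>' (N - i - 1) l')"
        by (simp add: ff_inverse)
    qed (use L le in auto)
    then show "B (N - i) (N - j) (l - 1) = A j i l"
      unfolding A_def B_def m1 e using t1 t2 L(1) by (simp add: gl_inverse)
  qed (auto simp: flip_mat_def, (use ji in \<open>auto\<close>))
  have S: "(\<Prod>j\<in>{2..<N}. \<Prod>i\<in>{1..<j}. G j i) = (\<Prod>(j, i)\<in>(SIGMA j:{2..<N}. {1..<j}). G j i)"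
    for G :: "nat \<Rightarrow> nat \<Rightarrow> complex"
    by (rule prod.Sigma) auto
  have 3: "(\<Prod>j\<in>{2..<N}. \<Prod>i\<in>{1..<j}. \<Prod>l\<in>{1..s j i}. A j i l)
    = (\<Prod>i\<in>{2..<N}. \<Prod>j\<in>{1..<i}. \<Prod>l\<in>{0..<?m j i}. B i j l)"
    unfolding S
  \<comment> \<open>In \<open>lower_coeff\<close> the pair (j, i) stands for group j on the levels i
    + 1 and i. These become the levels N - i - 1 and N - i with group N - j, so the upper level is N
    - i.\<close>
  proof (rule prod.reindex_bij_witness[of _ "\<lambda>(i, j). (N - j, N - i)" "\<lambda>(j, i). (N - i, N - j)"])
    fix p assume "p \<in> (SIGMA j:{2..<N}. {1..<j})"
    then obtain j i where p: "p = (j, i)" "j \<in> {2..<N}" "i \<in> {1..<j}" by blast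
    show "(case (case p of (j, i) \<Rightarrow> (N - i, N - j)) of (i, j) \<Rightarrow> \<Prod>l\<in>{0..<?m j i}. B i j l)
      = (case p of (j, i) \<Rightarrow> \<Prod>l\<in>{1..s j i}. A j i l)"
      unfolding p(1) prod.case using AB[OF p(2,3)] ..
  qed auto
  show ?thesis
    unfolding lower_coeff_def upper_coeff_def 1 2 using 3 unfolding A_def B_def by simp
qed

lemma prod_pairs_flip:
  assumes k: "k \<in> {1..<N}" and k': "k' \<in> {1..<N}"
  shows "(\<Prod>(p, p') | p \<in> pairs N k \<and> p' \<in> pairs N k' \<and> p \<prec>\<^sup>t p'. F p p')
    = (\<Prod>(p, p') | p \<in> pairs N (N - k') \<and> p' \<in> pairs N (N - k) \<and> p \<prec> p'. F (flip_pair N p') (flip_pair N p))"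
proof -
  let ?f = "\<lambda>(p, p'). (flip_pair N p', flip_pair N p)"
  show ?thesis
  proof (rule prod.reindex_bij_witness[of _ ?f ?f])
    fix x assume "x \<in> {(p, p'). p \<in> pairs N k \<and> p' \<in> pairs N k' \<and> p \<prec>\<^sup>t p'}"
    then obtain p p' where x: "x = (p, p')" "p \<in> pairs N k" "p' \<in> pairs N k'" "p \<prec>\<^sup>t p'" by blast
    show "?f (?f x) = x" using x flip_pair_invol by simp
    show "?f x \<in> {(p, p'). p \<in> pairs N (N - k') \<and> p' \<in> pairs N (N - k) \<and> p \<prec> p'}"
      using x flip_pair_prec[OF x(3,2)] by (simp add: flip_pair_mem)
    show "(case ?f x of (p, p') \<Rightarrow> F (flip_pair N p') (flip_pair N p)) = (case x of (p, p') \<Rightarrow> F p p')"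
      using x flip_pair_invol by simp
  next
    fix x assume "x \<in> {(p, p'). p \<in> pairs N (N - k') \<and> p' \<in> pairs N (N - k) \<and> p \<prec> p'}"
    then obtain p p' where x: "x = (p, p')" "p \<in> pairs N (N - k')" "p' \<in> pairs N (N - k)" "p \<prec> p'" by blast
    have i: "flip_pair N (flip_pair N p) = p" "flip_pair N (flip_pair N p') = p'"
      using x flip_pair_invol by blast+
    have mem: "flip_pair N p \<in> pairs N k'" "flip_pair N p' \<in> pairs N k"
      using x k k' by (simp_all add: flip_pair_mem_iff)
    show "?f (?f x) = x" using x(1) i by simp
    show "?f x \<in> {(p, p'). p \<in> pairs N k \<and> p' \<in> pairs N k' \<and> p \<prec>\<^sup>t p'}"
      using flip_pair_prec[OF mem] x mem by (simp add: i)
  qed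
qed

lemma part_coeff_flip:
  assumes q: "q \<noteq> 0" and P: "P \<in> bethe_partitions N n"
  shows "part_coeff_hat N q t P = part_coeff N (inverse q) (\<lambda>k. t (N - k)) (flip_part N P)"
proof -
  let ?S = "subpar (\<lambda>k. t (N - k)) (flip_part N P)"
  have fl: "?S K (flip_pair N p) = subpar t P k p" if "p \<in> pairs N k" "K = N - k" for k K p
  proof -
    have "N - (N - k) = k" using pairs_range[OF that(1)] by auto
    then show ?thesis using flip_pair_invol[OF that(1)] that(2) by (simp add: subpar_flip)
  qed
  have fl': "ff_prod (inverse q) (?S K p) (?S K' p') =
      ff_prod q (subpar t P (N - K') (flip_pair N p')) (subpar t P (N - K) (flip_pair N p))" for K K' p p'
    by (simp add: subpar_flip ff_prod_inverse)
  have 1: "(\<Prod>k\<in>{1..<N}. \<Prod>(p, p') | p \<in> pairs N k \<and> p' \<in> pairs N k \<and> p \<prec>\<^sup>t p'.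
                ff_prod q (subpar t P k p') (subpar t P k p))
    = (\<Prod>k\<in>{1..<N}. \<Prod>(p, p') | p \<in> pairs N k \<and> p' \<in> pairs N k \<and> p \<prec> p'.
                ff_prod (inverse q) (?S k p') (?S k p))"
  proof (rule prod.reindex_bij_witness[of _ "\<lambda>k. N - k" "\<lambda>k. N - k"])
    fix k assume k: "k \<in> {1..<N}"
    then have e: "N - (N - k) = k" by auto
    show "(\<Prod>(p, p') | p \<in> pairs N (N - k) \<and> p' \<in> pairs N (N - k) \<and> p \<prec> p'.
                ff_prod (inverse q) (?S (N - k) p') (?S (N - k) p))
      = (\<Prod>(p, p') | p \<in> pairs N k \<and> p' \<in> pairs N k \<and> p \<prec>\<^sup>t p'.
                ff_prod q (subpar t P k p') (subpar t P k p))"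
      unfolding prod_pairs_flip[OF k k] fl' e ..
  qed auto
  have 2: "(\<Prod>k\<in>{2..<N}. (\<Prod>(p, p') | p \<in> pairs N k \<and> p' \<in> pairs N (k - 1) \<and> p \<prec>\<^sup>t p'.
                   ff_prod q (subpar t P k p) (subpar t P (k - 1) p'))
              * (\<Prod>(i, j) | (i, j) \<in> pairs N k \<and> (i, j) \<in> pairs N (k - 1) \<and> i < j.
                   izergin_r q (subpar t P k (i, j)) (subpar t P (k - 1) (i, j))))
    = (\<Prod>k\<in>{2..<N}. (\<Prod>(p, p') | p \<in> pairs N k \<and> p' \<in> pairs N (k - 1) \<and> p \<prec> p'.
                   ff_prod (inverse q) (?S k p) (?S (k - 1) p'))
              * (\<Prod>(i, j) | (i, j) \<in> pairs N k \<and> (i, j) \<in> pairs N (k - 1) \<and> i < j.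
                   izergin_l (inverse q) (?S k (i, j)) (?S (k - 1) (i, j))))"
  \<comment> \<open>A factor is indexed by the upper of its two levels. The levels k and k - 1
    become N - k and N + 1 - k, and the latter is the upper one.\<close>
  proof (rule prod.reindex_bij_witness[of _ "\<lambda>k. N + 1 - k" "\<lambda>k. N + 1 - k"])
    fix k assume k: "k \<in> {2..<N}"
    then have r: "k \<in> {1..<N}" "k - 1 \<in> {1..<N}" and e: "N + 1 - k - 1 = N - k" "N + 1 - k = N - (k - 1)"
      "N - (N - k) = k" "N - (N - (k - 1)) = k - 1" by auto
    have a: "(\<Prod>(p, p') | p \<in> pairs N (N - (k - 1)) \<and> p' \<in> pairs N (N - k) \<and> p \<prec> p'.
            ff_prod (inverse q) (?S (N - (k - 1)) p) (?S (N - k) p'))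
      = (\<Prod>(p, p') | p \<in> pairs N k \<and> p' \<in> pairs N (k - 1) \<and> p \<prec>\<^sup>t p'.
            ff_prod q (subpar t P k p) (subpar t P (k - 1) p'))"
      unfolding prod_pairs_flip[OF r] fl' e ..
    let ?A = "{(i, j). (i, j) \<in> pairs N k \<and> (i, j) \<in> pairs N (k - 1) \<and> i < j}"
    let ?B = "{(i, j). (i, j) \<in> pairs N (N - (k - 1)) \<and> (i, j) \<in> pairs N (N - k) \<and> i < j}"
    have b: "(\<Prod>p\<in>?B. izergin_l (inverse q) (?S (N - (k - 1)) p) (?S (N - k) p))
      = (\<Prod>p\<in>?A. izergin_r q (subpar t P k p) (subpar t P (k - 1) p))"
    proof (rule prod.reindex_bij_witness[of _ "flip_pair N" "flip_pair N"])
      fix p assume p: "p \<in> ?A"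
      then have pk: "p \<in> pairs N k" "p \<in> pairs N (k - 1)" by auto
      then show "flip_pair N (flip_pair N p) = p" by (intro flip_pair_invol)
      show "flip_pair N p \<in> ?B" using p k by (auto simp: flip_pair_def pairs_iff)
    next
      fix p assume p: "p \<in> ?B"
      then have pk: "p \<in> pairs N (N - k)" by auto
      then show "flip_pair N (flip_pair N p) = p" by (rule flip_pair_invol)
      show "flip_pair N p \<in> ?A" using p k by (auto simp: flip_pair_def pairs_iff)
      have pk': "p \<in> pairs N (N - (k - 1))" using p by auto
      have mem: "flip_pair N p \<in> pairs N k" "flip_pair N p \<in> pairs N (k - 1)"
        using pk pk' r by (simp_all only: flip_pair_mem_iff)
      \<comment> \<open>The exchange of the two sets of an Izergin determinant needs lists of equal
        length, which the equal cardinalities on neighbouring levels supply.\<close>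
      have "card (P k (flip_pair N p)) = card (P (k - 1) (flip_pair N p))"
        using bethe_partitionsD(4)[OF P, of "fst (flip_pair N p)" "snd (flip_pair N p)" k "k - 1"] mem by simp
      then have len: "length (subpar t P k (flip_pair N p)) = length (subpar t P (k - 1) (flip_pair N p))"
        by (simp add: subpar_def)
      show "izergin_r q (subpar t P k (flip_pair N p)) (subpar t P (k - 1) (flip_pair N p))
        = izergin_l (inverse q) (?S (N - (k - 1)) p) (?S (N - k) p)"
        unfolding subpar_flip e izergin_r_swap[OF len q] ..
    qed
    show "(\<Prod>(p, p') | p \<in> pairs N (N + 1 - k) \<and> p' \<in> pairs N (N + 1 - k - 1) \<and> p \<prec> p'.
            ff_prod (inverse q) (?S (N + 1 - k) p) (?S (N + 1 - k - 1) p'))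
         * (\<Prod>(i, j) | (i, j) \<in> pairs N (N + 1 - k) \<and> (i, j) \<in> pairs N (N + 1 - k - 1) \<and> i < j.
            izergin_l (inverse q) (?S (N + 1 - k) (i, j)) (?S (N + 1 - k - 1) (i, j)))
       = (\<Prod>(p, p') | p \<in> pairs N k \<and> p' \<in> pairs N (k - 1) \<and> p \<prec>\<^sup>t p'.
            ff_prod q (subpar t P k p) (subpar t P (k - 1) p'))
         * (\<Prod>(i, j) | (i, j) \<in> pairs N k \<and> (i, j) \<in> pairs N (k - 1) \<and> i < j.
            izergin_r q (subpar t P k (i, j)) (subpar t P (k - 1) (i, j)))"
      unfolding e(1) unfolding e(2) a using b by (simp add: case_prod_beta)
  qed auto
  show ?thesis unfolding part_coeff_hat_def part_coeff_def 1 2 ..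
qed

lemma flip_pos_image: "a \<le> b \<Longrightarrow> b \<le> c \<Longrightarrow> flip_pos c ` {c - b<..c - a} = {a<..b}"
proof (intro equalityI subsetI)
  fix x assume "a \<le> b" "b \<le> c" "x \<in> {a<..b}"
  then have "x = flip_pos c (c + 1 - x)" "c + 1 - x \<in> {c - b<..c - a}" by (auto simp: flip_pos_def)
  then show "x \<in> flip_pos c ` {c - b<..c - a}" by (rule image_eqI)
qed (auto simp: flip_pos_def)

text \<open>The reflection is no map of the algebra: the matrix indices of the T stay as they are.
  So this is not an instance of \<open>upper_word_cong\<close>; only the sets of positions are
  transported, and the words are compared in the algebra for q.\<close>

lemma lower_word_cong:
  assumes q: "q \<noteq> 0" and g: "generic N q n t" and s: "s \<in> lower_permissible N n" and \<sigma>: "\<sigma> \<in> sym_group N n"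
  shows "rtt_cong N q (lower_word N n s (\<lambda>k l. t k (\<sigma> k l)))
    (part_word_hat N t (flip_part N (partition_of N (flip_mat N s) (flip_perm N n \<sigma>))))"
proof -
  let ?n = "\<lambda>k. n (N - k)"
  let ?m = "flip_mat N s"
  let ?\<sigma> = "flip_perm N n \<sigma>"
  let ?P = "flip_part N (partition_of N ?m ?\<sigma>)"
  note m = flip_mat_upper[OF s] and \<sigma>' = flip_perm_sym[OF \<sigma>]
  have P': "partition_of N ?m ?\<sigma> \<in> bethe_partitions N ?n" by (rule partition_of_bethe(1)[OF m \<sigma>'])
  have P: "?P \<in> bethe_partitions N n" using P' by (rule flip_part_bethe_back)
  have inj: "inj (\<sigma> k)" if "k \<in> {1..<N}" for k using sym_groupD(1)[OF \<sigma> that] by (rule permutes_inj)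
  have sub: "?P k p \<subseteq> {1..n k}" if "k \<in> {1..<N}" for k p
    using bethe_partitionsD(1,2)[OF P] that by (cases "p \<in> pairs N k") blast+
  have fin: "finite (?P k p)" if "k \<in> {1..<N}" for k p using sub[OF that] by (rule finite_subset) simp
  have set: "?P k p = \<sigma> k ` flip_pos (n k) ` set (block_positions ?m (N - k) (flip_pair N p))" if p: "p \<in> pairs N k" for k p
  proof -
    have k: "k \<in> {1..<N}" using p by (rule pairs_range)
    then have e: "N - (N - k) = k" "N - k \<in> {1..<N}" by auto
    have "flip_pair N p \<in> pairs N (N - k)" using p by (simp only: flip_pair_mem)
    then have "arrangement_of N ?m ?\<sigma> (N - k) (flip_pair N p) = map (?\<sigma> (N - k)) (block_positions ?m (N - k) (flip_pair N p))"
      by (simp add: arrangement_of_def)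
    then show ?thesis
      unfolding flip_part_def partition_of_def using e by (simp add: flip_perm_def image_comp)
  qed
  have sm: "s j (i - 1) \<le> s j i" "s j i \<le> n j" if "1 \<le> i" "i \<le> j" "j < N" for i j
  proof -
    have le: "?m (N - j) b \<le> ?m (N - j) a" if "N - j \<le> a" "a \<le> b" for a b
      using that \<open>j < N\<close> by (intro upper_antimono[OF m]) auto
    show "s j (i - 1) \<le> s j i"
      using that le[of "N - i" "N - i + 1"] by (simp add: flip_mat_def Suc_diff_le[symmetric])
    have "?m (N - j) (N - i) \<le> ?m (N - j) (N - j)" using that by (intro le) auto
    also have "\<dots> \<le> m_sum ?m (N - j) (N - j)" using that by (intro le_m_sum) auto
    also have "\<dots> = n j" using that m_sum_diag[OF m, of "N - j"] by simp
    finally show "s j i \<le> n j" using that by (simp add: flip_mat_def)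
  qed
  have "rtt_cong N q (\<Prod>l\<leftarrow>[s j (i - 1) + 1 ..< s j i + 1]. T i (j + 1) (t j (\<sigma> j l)))
     (T_prod i (j + 1) (subpar t ?P j (i, j)))" if j: "j \<in> {1..<N}" and i: "i \<in> {1..<j + 1}" for i j
  proof -
    have p: "(i, j) \<in> pairs N j" using i j by (auto simp: pairs_iff)
    have jN: "N - j \<in> {1..<N}" "N - (N - j) = j" "N - (N - i) = i" "N - (N - i + 1) = i - 1" using i j by auto
    have "block_positions ?m (N - j) (N - j, N - i) = [n j - s j i + 1..<n j - s j (i - 1) + 1]"
      using m_sum_diag[OF m jN(1)] jN by (simp add: block_positions_def flip_mat_def)
    then have "set (block_positions ?m (N - j) (flip_pair N (i, j))) = {n j - s j i<..n j - s j (i - 1)}"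
      by (auto simp: flip_pair_def)
    then have "?P j (i, j) = \<sigma> j ` {s j (i - 1)<..s j i}"
      unfolding set[OF p] using i j sm by (simp add: flip_pos_image)
    also have "\<dots> = set (map (\<sigma> j) [s j (i - 1) + 1 ..< s j i + 1])"
      by (simp add: atLeastSucLessThan_greaterThanLessThan atLeastLessThanSuc_atLeastAtMost
          atLeastSucAtMost_greaterThanAtMost del: upt_Suc)
    finally have "rtt_cong N q (\<Prod>l\<leftarrow>map (\<sigma> j) [s j (i - 1) + 1 ..< s j i + 1]. T i (j + 1) (t j l))
      (\<Prod>l\<leftarrow>sorted_list_of_set (?P j (i, j)). T i (j + 1) (t j l))"
      using i j sub[OF j, of "(i, j)"] fin[OF j] inj[OF j]
      by (intro T_prod_cong[OF q g]) (auto simp: distinct_map intro: inj_on_subset)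
    then show ?thesis unfolding T_prod_subpar by (simp add: o_def del: upt_Suc)
  qed
  then have 1: "rtt_cong N q (\<Prod>j\<leftarrow>rev [1..<N]. \<Prod>i\<leftarrow>[1..<j + 1].
          \<Prod>l\<leftarrow>[s j (i - 1) + 1 ..< s j i + 1]. T i (j + 1) (t j (\<sigma> j l)))
     (\<Prod>j\<leftarrow>rev [1..<N]. \<Prod>i\<leftarrow>[1..<j + 1]. T_prod i (j + 1) (subpar t ?P j (i, j)))"
    by (intro rtt_cong_prod_list) (simp only: set_rev set_upt)
  have "rtt_cong N q (\<Prod>l\<leftarrow>[s k k + 1 ..< n k + 1]. T (k + 1) (k + 1) (t k (\<sigma> k l)))
     (\<Prod>p\<leftarrow>filter (\<lambda>p. (k, k) \<prec>\<^sup>t p) (pair_list N k). T_prod (k + 1) (k + 1) (subpar t ?P k p))" if k: "k \<in> {1..<N}" for k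
  proof -
    let ?ps = "filter (\<lambda>p. (k, k) \<prec>\<^sup>t p) (pair_list N k)"
    let ?ys = "concat (map (\<lambda>p. sorted_list_of_set (?P k p)) ?ps)"
    have kN: "N - k \<in> {1..<N}" "N - (N - k) = k" using k by auto
    have kk: "(k, k) \<in> pairs N k" "flip_pair N (k, k) = (N - k, N - k)" using k by (auto simp: pairs_iff flip_pair_def)
    have "(\<Prod>p\<leftarrow>ps. \<Prod>l\<leftarrow>h p. F l) = (\<Prod>l\<leftarrow>concat (map h ps). F l)"
      for ps and h :: "nat \<times> nat \<Rightarrow> nat list" and F :: "nat \<Rightarrow> ncpoly"
      by (induction ps) simp_all
    then have "(\<Prod>p\<leftarrow>?ps. T_prod (k + 1) (k + 1) (subpar t ?P k p)) = (\<Prod>l\<leftarrow>?ys. T (k + 1) (k + 1) (t k l))"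
      unfolding T_prod_subpar .
    moreover have "(\<Prod>l\<leftarrow>[s k k + 1 ..< n k + 1]. T (k + 1) (k + 1) (t k (\<sigma> k l)))
       = (\<Prod>l\<leftarrow>map (\<sigma> k) [s k k + 1 ..< n k + 1]. T (k + 1) (k + 1) (t k l))" by (simp add: o_def del: upt_Suc)
    moreover have "rtt_cong N q \<dots> (\<Prod>l\<leftarrow>?ys. T (k + 1) (k + 1) (t k l))"
    proof (rule T_prod_cong[OF q g])
      show "distinct (map (\<sigma> k) [s k k + 1 ..< n k + 1])"
        using inj[OF k] by (auto simp: distinct_map intro: inj_on_subset)
      have "disjoint_family_on (?P k) (pairs N k)" by (rule bethe_partitionsD(3)[OF P k])
      then have "disjoint_family_on (?P k) (set ?ps)"
        by (rule disjoint_family_on_mono[rotated]) auto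
      then show "distinct ?ys"
        using fin[OF k] by (intro distinct_concat_disjoint) (auto simp: distinct_pair_list)
      have im: "flip_pair N ` {p \<in> pairs N k. (k, k) \<prec>\<^sup>t p} = {p \<in> pairs N (N - k). p \<prec> (N - k, N - k)}"
      proof (intro equalityI subsetI)
        fix p assume "p \<in> flip_pair N ` {p \<in> pairs N k. (k, k) \<prec>\<^sup>t p}"
        then obtain p' where p': "p = flip_pair N p'" "p' \<in> pairs N k" "(k, k) \<prec>\<^sup>t p'" by blast
        then show "p \<in> {p \<in> pairs N (N - k). p \<prec> (N - k, N - k)}"
          using flip_pair_prec[OF p'(2) kk(1)] unfolding kk(2) by (simp add: flip_pair_mem)
      next
        fix p assume "p \<in> {p \<in> pairs N (N - k). p \<prec> (N - k, N - k)}"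
        then have p: "p \<in> pairs N (N - k)" "p \<prec> (N - k, N - k)" by auto
        then have f: "flip_pair N p \<in> pairs N k" "flip_pair N (flip_pair N p) = p"
          using k by (simp_all add: flip_pair_mem_iff flip_pair_invol)
        then have "(k, k) \<prec>\<^sup>t flip_pair N p" using flip_pair_prec[OF f(1) kk(1)] p unfolding kk(2) by simp
        then show "p \<in> flip_pair N ` {p \<in> pairs N k. (k, k) \<prec>\<^sup>t p}"
          using f by (intro image_eqI[of _ _ "flip_pair N p"]) auto
      qed
      have "set ?ys = (\<Union>p\<in>{p \<in> pairs N k. (k, k) \<prec>\<^sup>t p}. ?P k p)"
        using fin[OF k] by simp
      also have "\<dots> = (\<Union>p\<in>{p \<in> pairs N k. (k, k) \<prec>\<^sup>t p}. \<sigma> k ` flip_pos (n k) ` set (block_positions ?m (N - k) (flip_pair N p)))"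
        using set by (intro SUP_cong refl) blast
      also have "\<dots> = \<sigma> k ` flip_pos (n k) ` (\<Union>p\<in>flip_pair N ` {p \<in> pairs N k. (k, k) \<prec>\<^sup>t p}. set (block_positions ?m (N - k) p))"
        by (simp add: image_UN)
      also have "\<dots> = \<sigma> k ` flip_pos (n k) ` {1..n k - s k k}"
        unfolding im diag_positions[OF m kN(1)] using kN by (simp add: flip_mat_def)
      \<comment> \<open>Written as a half-open interval with \<open>b = n k\<close>, so that
        \<open>flip_pos_image\<close> applies.\<close>
      also have "{1..n k - s k k} = {n k - n k<..n k - s k k}" by auto
      also have "flip_pos (n k) ` \<dots> = {s k k<..n k}" using sm[of k k] k by (intro flip_pos_image) auto
      finally have "set ?ys = \<sigma> k ` {s k k<..n k}" .
      then show "set (map (\<sigma> k) [s k k + 1 ..< n k + 1]) = set ?ys"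
        by (simp add: atLeastLessThanSuc_atLeastAtMost atLeastSucAtMost_greaterThanAtMost del: upt_Suc)
      show "set ?ys \<subseteq> {1..n k}" using sub[OF k] fin[OF k] by (simp add: UN_subset_iff)
    qed (use k in auto)
    ultimately show ?thesis by simp
  qed
  then have 2: "rtt_cong N q (\<Prod>k\<leftarrow>rev [1..<N]. \<Prod>l\<leftarrow>[s k k + 1 ..< n k + 1]. T (k + 1) (k + 1) (t k (\<sigma> k l)))
     (\<Prod>k\<leftarrow>rev [1..<N]. \<Prod>p\<leftarrow>filter (\<lambda>p. (k, k) \<prec>\<^sup>t p) (pair_list N k). T_prod (k + 1) (k + 1) (subpar t ?P k p))"
    by (intro rtt_cong_prod_list) simp
  have "(\<Prod>k\<leftarrow>rev [1..<N]. \<Prod>p\<leftarrow>filter (\<lambda>p. (k, k) \<prec>\<^sup>t p) (pair_list N k). T_prod (k + 1) (k + 1) (subpar t ?P k p))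
    = (\<Prod>k\<leftarrow>rev [1..<N - 1]. \<Prod>p\<leftarrow>filter (\<lambda>p. (k, k) \<prec>\<^sup>t p) (pair_list N k). T_prod (k + 1) (k + 1) (subpar t ?P k p))"
  proof (cases "1 < N")
    case True
    \<comment> \<open>On level N - 1 all second components equal N - 1 and first components are at
      most N - 1: nothing follows this pair, and the last level drops out.\<close>
    have "\<not> (N - 1, N - 1) \<prec>\<^sup>t p" if "p \<in> pairs N (N - 1)" for p
    proof (cases p)
      case (Pair i j)
      then have "i \<le> N - 1" "j = N - 1" using that by (auto simp: pairs_iff)
      then show ?thesis by (simp add: Pair prec_t_def)
    qed
    then have "filter (\<lambda>p. (N - 1, N - 1) \<prec>\<^sup>t p) (pair_list N (N - 1)) = []"
      by (simp add: filter_empty_conv)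
    moreover have "[1..<N] = [1..<N - 1] @ [N - 1]"
      using True upt_Suc_append[of 1 "N - 1"] by simp
    ultimately show ?thesis by simp
  qed simp
  with 2 show ?thesis unfolding lower_word_def part_word_hat_def by (intro rtt_cong_mult 1) simp
qed

text \<open>For q^-1 the one-sided condition on a pair of parameters is the condition for q on the
  same pair in the opposite order.\<close>

lemma generic_flip:
  assumes q: "q \<noteq> 0" and g: "generic N q n t"
  shows "generic N (inverse q) (\<lambda>k. n (N - k)) (\<lambda>k. t (N - k))"
proof -
  have 1: "t (N - k) l \<noteq> 0" if "k \<in> {1..<N}" "l \<in> {1..n (N - k)}" for k l
  proof -
    have "N - k \<in> {1..<N}" using that by auto
    then show ?thesis using genericD(1)[OF g _ that(2)] by simp
  qed
  have 2: "t (N - k) l \<noteq> t (N - k') l' \<and> (inverse q)\<^sup>2 * t (N - k) l \<noteq> t (N - k') l'"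
    if k: "k \<in> {1..<N}" "l \<in> {1..n (N - k)}" "k' \<in> {1..<N}" "l' \<in> {1..n (N - k')}"
      and ne: "(k, l) \<noteq> (k', l')" for k l k' l'
  proof -
    have r: "N - k \<in> {1..<N}" "N - k' \<in> {1..<N}" using k by auto
    have ne': "(N - k, l) \<noteq> (N - k', l')" using ne k by auto
    have "t (N - k) l \<noteq> t (N - k') l'" "q\<^sup>2 * t (N - k') l' \<noteq> t (N - k) l"
      using genericD(2)[OF g r(1) k(2) r(2) k(4) ne'] genericD(2)[OF g r(2) k(4) r(1) k(2) ne'[symmetric]] by auto
    then show ?thesis using q by (auto simp: field_simps)
  qed
  show ?thesis
    unfolding generic_def bethe_indices_def
  proof (intro conjI ballI)
    fix x assume "x \<in> (SIGMA k:{1..<N}. {1..n (N - k)})"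
    then show "case x of (k, l) \<Rightarrow> t (N - k) l \<noteq> 0" using 1 by (cases x) blast
  next
    fix x assume x: "x \<in> (SIGMA k:{1..<N}. {1..n (N - k)})"
    show "case x of (k, l) \<Rightarrow> \<forall>(k', l')\<in>SIGMA k:{1..<N}. {1..n (N - k)}. (k, l) \<noteq> (k', l') \<longrightarrow>
        t (N - k) l \<noteq> t (N - k') l' \<and> (inverse q)\<^sup>2 * t (N - k) l \<noteq> t (N - k') l'"
      using x 2 by (cases x) fast
  qed
qed

lemma pre_bethe_hat_sum_over_partitions:
  assumes N: "1 \<le> N" and q: "q \<noteq> 0" "q\<^sup>2 \<noteq> 1" and g: "generic N q n t"
  shows "in_Aq N q (pre_bethe_hat N q n t) =
    in_Aq N q (\<Sum>P\<in>bethe_partitions N n. scal (part_coeff_hat N q t P) * part_word_hat N t P)"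
proof -
  let ?n = "\<lambda>k. n (N - k)"
  let ?t = "\<lambda>k. t (N - k)"
  let ?V = "\<lambda>P. part_word_hat N t (flip_part N P)"
  let ?c = "\<lambda>m \<sigma>. upper_coeff N (inverse q) ?n m (\<lambda>k l. ?t k (\<sigma> k l))"
  have q': "inverse q \<noteq> 0" "(inverse q)\<^sup>2 \<noteq> 1" using q by (auto simp: power_inverse)
  \<comment> \<open>A double reflection restores \<open>n\<close> on the levels below
    \<open>N\<close>; both definitions use only these.\<close>
  have nn: "flip_perm N (\<lambda>k. n (N - (N - k))) = flip_perm N n"
    "sym_group N (\<lambda>k. n (N - (N - k))) = sym_group N n"
    by (auto simp: flip_perm_def fun_eq_iff sym_group_def)
  have coeff: "lower_coeff N q n s (\<lambda>k l. t k (\<sigma> k l)) = ?c (flip_mat N s) (flip_perm N n \<sigma>)"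
    if "s \<in> lower_permissible N n" for s \<sigma>
  proof (rule lower_coeff_flip[OF that])
    fix k l assume k: "k \<in> {1..<N}" and l: "l \<in> {1..n k}"
    then have "N - k \<in> {1..<N}" "N - (N - k) = k" by auto
    then show "?t (N - k) (flip_perm N n \<sigma> (N - k) l) = t k (\<sigma> k (n k + 1 - l))"
      using l by (simp add: flip_perm_def flip_pos_def)
  qed
  have "pre_bethe_hat N q n t = (\<Sum>s\<in>lower_permissible N n. \<Sum>\<sigma>\<in>sym_group N n.
      scal (lower_coeff N q n s (\<lambda>k l. t k (\<sigma> k l))) * lower_word N n s (\<lambda>k l. t k (\<sigma> k l)))"
    unfolding pre_bethe_hat_def Sym_def lower_coeff_def lower_word_def by (simp only: mult.assoc)
  then have "rtt_cong N q (pre_bethe_hat N q n t) (\<Sum>s\<in>lower_permissible N n. \<Sum>\<sigma>\<in>sym_group N n.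
      scal (lower_coeff N q n s (\<lambda>k l. t k (\<sigma> k l))) * ?V (partition_of N (flip_mat N s) (flip_perm N n \<sigma>)))"
    by (simp only:) (intro rtt_cong_sum rtt_cong_scal lower_word_cong q g)
  moreover have "(\<Sum>s\<in>lower_permissible N n. \<Sum>\<sigma>\<in>sym_group N n.
      scal (lower_coeff N q n s (\<lambda>k l. t k (\<sigma> k l))) * ?V (partition_of N (flip_mat N s) (flip_perm N n \<sigma>)))
    = (\<Sum>m\<in>upper_permissible N ?n. \<Sum>\<sigma>\<in>sym_group N ?n. scal (?c m \<sigma>) * ?V (partition_of N m \<sigma>))"
  proof (rule sum.reindex_bij_witness[of _ "flip_mat N" "flip_mat N"])
    fix s assume s: "s \<in> lower_permissible N n"
    show "(\<Sum>\<sigma>\<in>sym_group N ?n. scal (?c (flip_mat N s) \<sigma>) * ?V (partition_of N (flip_mat N s) \<sigma>))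
      = (\<Sum>\<sigma>\<in>sym_group N n. scal (lower_coeff N q n s (\<lambda>k l. t k (\<sigma> k l)))
          * ?V (partition_of N (flip_mat N s) (flip_perm N n \<sigma>)))"
    proof (rule sum.reindex_bij_witness[of _ "flip_perm N ?n" "flip_perm N n", symmetric])
      fix \<sigma> assume \<sigma>: "\<sigma> \<in> sym_group N n"
      show "flip_perm N ?n (flip_perm N n \<sigma>) = \<sigma>" by (rule flip_perm_invol[OF \<sigma>])
      show "flip_perm N n \<sigma> \<in> sym_group N ?n" by (rule flip_perm_sym[OF \<sigma>])
      show "scal (?c (flip_mat N s) (flip_perm N n \<sigma>)) * ?V (partition_of N (flip_mat N s) (flip_perm N n \<sigma>))
        = scal (lower_coeff N q n s (\<lambda>k l. t k (\<sigma> k l))) * ?V (partition_of N (flip_mat N s) (flip_perm N n \<sigma>))"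
        by (simp only: coeff[OF s])
    next
      fix \<sigma> assume \<sigma>: "\<sigma> \<in> sym_group N ?n"
      show "flip_perm N n (flip_perm N ?n \<sigma>) = \<sigma>" using flip_perm_invol[OF \<sigma>] unfolding nn .
      show "flip_perm N ?n \<sigma> \<in> sym_group N n" using flip_perm_sym[OF \<sigma>] unfolding nn .
    qed
  qed (auto intro: flip_mat_upper flip_mat_lower flip_mat_invol_lower flip_mat_invol_upper)
  \<comment> \<open>The exact identity with q^-1 in the coefficients. The value of \<open>V\<close>
    at a partition is the word of the reflected partition, and it is left untouched.\<close>
  moreover have "(\<Sum>m\<in>upper_permissible N ?n. \<Sum>\<sigma>\<in>sym_group N ?n. scal (?c m \<sigma>) * ?V (partition_of N m \<sigma>))
    = (\<Sum>P\<in>bethe_partitions N ?n. scal (part_coeff N (inverse q) ?t P) * ?V P)"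
    by (rule sum_over_partitions[OF N q' generic_flip[OF q(1) g]])
  moreover have "(\<Sum>P\<in>bethe_partitions N ?n. scal (part_coeff N (inverse q) ?t P) * ?V P)
    = (\<Sum>P\<in>bethe_partitions N n. scal (part_coeff_hat N q t P) * part_word_hat N t P)"
  proof (rule sum.reindex_bij_witness[of _ "flip_part N" "flip_part N"])
    fix P assume P: "P \<in> bethe_partitions N ?n"
    show "flip_part N (flip_part N P) = P" by (rule flip_part_invol[OF P])
    show P': "flip_part N P \<in> bethe_partitions N n" by (rule flip_part_bethe_back[OF P])
    show "scal (part_coeff_hat N q t (flip_part N P)) * part_word_hat N t (flip_part N P)
      = scal (part_coeff N (inverse q) ?t P) * ?V P"
      using part_coeff_flip[OF q(1) P'] flip_part_invol[OF P] by simp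
  qed (auto intro: flip_part_bethe flip_part_invol)
  ultimately show ?thesis by (simp only: rtt_cong_def)
qed

section \<open>Sums over partitions\<close>

theorem proposition3p1:
  fixes N :: nat and q :: complex and n :: "nat \<Rightarrow> nat" and t :: "nat \<Rightarrow> nat \<Rightarrow> complex"
  assumes "N \<ge> 2"
    and "q \<noteq> 0"
    and "\<forall>r::nat. r > 0 \<longrightarrow> q ^ r \<noteq> 1"
    and "\<forall>k\<in>{1..<N}. n k > 0"
    and "generic N q n t"
  shows
    "in_Aq N q (pre_bethe N q n t) =
     in_Aq N q (\<Sum>P \<in> bethe_partitions N n.
       scal ((\<Prod>k\<in>{1..<N}. \<Prod>(p, p') | p \<in> pairs N k \<and> p' \<in> pairs N k \<and> p \<prec> p'.
                ff_prod q (subpar t P k p') (subpar t P k p))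
           * (\<Prod>k\<in>{2..<N}.
                (\<Prod>(p, p') | p \<in> pairs N k \<and> p' \<in> pairs N (k - 1) \<and> p \<prec> p'.
                   ff_prod q (subpar t P k p) (subpar t P (k - 1) p'))
              * (\<Prod>(i, j) | (i, j) \<in> pairs N k \<and> (i, j) \<in> pairs N (k - 1) \<and> i < j.
                   izergin_l q (subpar t P k (i, j)) (subpar t P (k - 1) (i, j)))))
       * (\<Prod>k\<leftarrow>[1..<N]. \<Prod>j\<leftarrow>rev [k + 1..<N + 1]. T_prod k j (subpar t P k (k, j - 1)))
       * (\<Prod>k\<leftarrow>[2..<N]. \<Prod>p\<leftarrow>filter (\<lambda>p. p \<prec> (k, k)) (pair_list N k).
            T_prod k k (subpar t P k p)))
     \<and>
     in_Aq N q (pre_bethe_hat N q n t) =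
     in_Aq N q (\<Sum>P \<in> bethe_partitions N n.
       scal ((\<Prod>k\<in>{1..<N}. \<Prod>(p, p') | p \<in> pairs N k \<and> p' \<in> pairs N k \<and> p \<prec>\<^sup>t p'.
                ff_prod q (subpar t P k p') (subpar t P k p))
           * (\<Prod>k\<in>{2..<N}.
                (\<Prod>(p, p') | p \<in> pairs N k \<and> p' \<in> pairs N (k - 1) \<and> p \<prec>\<^sup>t p'.
                   ff_prod q (subpar t P k p) (subpar t P (k - 1) p'))
              * (\<Prod>(i, j) | (i, j) \<in> pairs N k \<and> (i, j) \<in> pairs N (k - 1) \<and> i < j.
                   izergin_r q (subpar t P k (i, j)) (subpar t P (k - 1) (i, j)))))
       * (\<Prod>k\<leftarrow>rev [1..<N]. \<Prod>j\<leftarrow>[1..<k + 1]. T_prod j (k + 1) (subpar t P k (j, k)))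
       * (\<Prod>k\<leftarrow>rev [1..<N - 1]. \<Prod>p\<leftarrow>filter (\<lambda>p. (k, k) \<prec>\<^sup>t p) (pair_list N k).
            T_prod (k + 1) (k + 1) (subpar t P k p)))"
proof -
  have N: "1 \<le> N" using assms(1) by simp
  have q: "q \<noteq> 0" "q\<^sup>2 \<noteq> 1" using assms(2,3) by auto
  show ?thesis
    using pre_bethe_sum_over_partitions[OF N q assms(5)] pre_bethe_hat_sum_over_partitions[OF N q assms(5)]
    unfolding part_coeff_def part_word_def part_coeff_hat_def part_word_hat_def
    by (simp only: mult.assoc)
qed

end
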